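(* Let $C = V(f)$ and $D = V(g)$ be symmetric curves in $\mathbb{P}^2_{\mathbb{C}}$ of degrees $d$ and $e$ respectively, which intersect transversely. Then the isomorphism type of the $S_3$-set $V(f,g) = C \cap D$ is determined by the product $de$ modulo $6$, as follows, where in each case $k \geq 0$ denotes the integer determined by the displayed expression for $de$: \begin{itemize} \item if $de = 6k$, then $V(f,g) \cong k[S_3]$; \item if $de = 6k+2$, then $V(f,g) \cong k[S_3] + [S_3/C_3]$; \item if $de = 6k+3$, then $V(f,g) \cong k[S_3] + [S_3/C_2]$; \item if $de = 6k+5$, then $V(f,g) \cong k[S_3] + [S_3/C_2] + [S_3/C_3]$; \item the cases $de = 6k+1$ and $de = 6k+4$ cannot occur, i.e. no two symmetric curves in $\mathbb{P}^2_{\mathbb{C}}$ whose degrees have product of the form $6k+1$ or $6k+4$ intersect transversely. \end{itemize}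
   Context: The symmetric group $S_3$ acts on $\mathbb{P}^2_{\mathbb{C}}$ by permuting the homogeneous coordinates. A symmetric curve of degree $d \geq 1$ is the curve $V(f) \subseteq \mathbb{P}^2_{\mathbb{C}}$ defined by a nonzero homogeneous polynomial $f \in \mathbb{C}[X,Y,Z]$ of degree $d$ that is symmetric, i.e. invariant under all permutations of $X,Y,Z$. Two curves $V(f), V(g)$ intersect transversely (are transverse) if at every point of $V(f,g)$ their intersection multiplicity is $1$, equivalently both curves are nonsingular there with distinct tangent lines. The intersection locus $V(f,g)$ is the set of common zeros, which is then a finite set with an induced action of $S_3$. Notation for isomorphism classes of finite $S_3$-sets: $+$ denotes disjoint union; $[S_3/H]$ denotes the class of the transitive $S_3$-set $S_3/H$ (an orbit whose points have stabilizer conjugate to $H$); $[S_3]$ is the free orbit; $k[S_3]$ is the disjoint union of $k$ copies of it; $C_2$ is the subgroup generated by a transposition and $C_3$ the subgroup generated by a $3$-cycle. *)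

theory Defs
  imports
    "HOL-Analysis.Finite_Cartesian_Product"
    "HOL-Library.Extended_Nat"
    "HOL-Library.Numeral_Type"
    "HOL-Library.Poly_Mapping"
    "HOL-Combinatorics.Transposition"
    "HOL-Computational_Algebra.Fraction_Field"
    "HOL-Algebra.Group_Action"
    "HOL-Algebra.Left_Coset"
    "HOL-Algebra.Generated_Groups"
begin

section \<open>Ternary forms\<close>

text \<open>
  The three variables $X, Y, Z$ are indexed by the elements \<open>0, 1, 2\<close> of the
  three-element type \<open>3\<close>; a monomial is its exponent vector.
\<close>

type_synonym mpoly3 = "(3 \<Rightarrow>\<^sub>0 nat) \<Rightarrow>\<^sub>0 complex"

definition mpoly_eval :: "mpoly3 \<Rightarrow> complex ^ 3 \<Rightarrow> complex" where
  "mpoly_eval f v =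
    (\<Sum>m\<in>Poly_Mapping.keys f.
       Poly_Mapping.lookup f m * (\<Prod>i\<in>UNIV. (v $ i) ^ Poly_Mapping.lookup m i))"

text \<open>The zero polynomial is homogeneous of every degree.\<close>

definition homogeneous :: "nat \<Rightarrow> mpoly3 \<Rightarrow> bool" where
  "homogeneous n f \<longleftrightarrow>
    (\<forall>m\<in>Poly_Mapping.keys f. (\<Sum>i\<in>UNIV. Poly_Mapping.lookup m i) = n)"

text \<open>
  For bijective \<open>\<sigma>\<close>, substitution of the variable with index \<open>\<sigma> i\<close> for the variable with
  index \<open>i\<close>: the coefficient of \<open>m\<close> in the result is the coefficient of \<open>m \<circ> \<sigma>\<close> in \<open>f\<close>.
\<close>

definition permute_vars :: "(3 \<Rightarrow> 3) \<Rightarrow> mpoly3 \<Rightarrow> mpoly3" where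
  "permute_vars \<sigma> f = Poly_Mapping.map_key (Poly_Mapping.map_key \<sigma>) f"

definition symmetric :: "mpoly3 \<Rightarrow> bool" where
  "symmetric f \<longleftrightarrow> (\<forall>\<sigma>. bij \<sigma> \<longrightarrow> permute_vars \<sigma> f = f)"

definition symmetric_curve :: "nat \<Rightarrow> mpoly3 \<Rightarrow> bool" where
  "symmetric_curve d f \<longleftrightarrow> d \<ge> 1 \<and> f \<noteq> 0 \<and> homogeneous d f \<and> symmetric f"


section \<open>The complex projective plane\<close>

definition proj_rel :: "(complex ^ 3) rel" where
  "proj_rel = {(v, w). v \<noteq> 0 \<and> w \<noteq> 0 \<and> (\<exists>c. c \<noteq> 0 \<and> w = c *s v)}"

definition proj_plane :: "(complex ^ 3) set set" where
  "proj_plane = (UNIV - {0}) // proj_rel"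

definition zero_locus :: "mpoly3 \<Rightarrow> (complex ^ 3) set set" where
  "zero_locus f = {P \<in> proj_plane. \<forall>v\<in>P. mpoly_eval f v = 0}"


section \<open>Intersection multiplicity and transversality\<close>

type_synonym ratfun3 = "mpoly3 fract"

text \<open>The local ring of the projective plane at \<open>P\<close>, inside the field of rational functions.\<close>

definition local_ring :: "(complex ^ 3) set \<Rightarrow> ratfun3 set" where
  "local_ring P =
    {Fract a s | a s n. homogeneous n a \<and> homogeneous n s \<and> (\<forall>v\<in>P. mpoly_eval s v \<noteq> 0)}"

text \<open>
  The dehomogenizations of a form \<open>f\<close> at \<open>P\<close>. Any two of them differ by a unit of the local
  ring, so each of them is an equation of the curve of \<open>f\<close> near \<open>P\<close>.
\<close>

definition local_equations :: "mpoly3 \<Rightarrow> (complex ^ 3) set \<Rightarrow> ratfun3 set" where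
  "local_equations f P =
    {Fract f h | h n. homogeneous n f \<and> homogeneous n h \<and> (\<forall>v\<in>P. mpoly_eval h v \<noteq> 0)}"

text \<open>The ideal generated by $f$ and $g$ in the local ring at \<open>P\<close>.\<close>

definition local_ideal :: "mpoly3 \<Rightarrow> mpoly3 \<Rightarrow> (complex ^ 3) set \<Rightarrow> ratfun3 set" where
  "local_ideal f g P =
    {\<alpha> * u + \<beta> * w | \<alpha> \<beta> u w.
       \<alpha> \<in> local_ring P \<and> \<beta> \<in> local_ring P \<and>
       u \<in> local_equations f P \<and> w \<in> local_equations g P}"

definition const_ratfun :: "complex \<Rightarrow> ratfun3" where
  "const_ratfun c = Fract (Poly_Mapping.single 0 c) 1"

definition independent_mod :: "ratfun3 set \<Rightarrow> ratfun3 set \<Rightarrow> bool" where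
  "independent_mod W B \<longleftrightarrow>
    (\<forall>c. (\<Sum>q\<in>B. const_ratfun (c q) * q) \<in> W \<longrightarrow> (\<forall>q\<in>B. c q = 0))"

text \<open>The complex dimension of the quotient space \<open>V / W\<close>, possibly infinite.\<close>

definition quotient_dim :: "ratfun3 set \<Rightarrow> ratfun3 set \<Rightarrow> enat" where
  "quotient_dim V W = Sup {enat (card B) | B. finite B \<and> B \<subseteq> V \<and> independent_mod W B}"

definition intersection_multiplicity ::
    "mpoly3 \<Rightarrow> mpoly3 \<Rightarrow> (complex ^ 3) set \<Rightarrow> enat" where
  "intersection_multiplicity f g P = quotient_dim (local_ring P) (local_ideal f g P)"

definition transverse :: "mpoly3 \<Rightarrow> mpoly3 \<Rightarrow> bool" where
  "transverse f g \<longleftrightarrow>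
    (\<forall>P \<in> zero_locus f \<inter> zero_locus g. intersection_multiplicity f g P = 1)"


section \<open>Sets with a group action\<close>

text \<open>
  A $G$-set is a carrier together with an action on it; as required by \<^locale>\<open>group_action\<close>,
  the action is extensional on the carrier.
\<close>

type_synonym ('g, 'x) gset = "'x set \<times> ('g \<Rightarrow> 'x \<Rightarrow> 'x)"

fun gset_iso :: "('g, 'm) monoid_scheme \<Rightarrow> ('g, 'x) gset \<Rightarrow> ('g, 'y) gset \<Rightarrow> bool" where
  "gset_iso G (E, \<phi>) (F, \<psi>) \<longleftrightarrow>
    group_action G E \<phi> \<and> group_action G F \<psi> \<and>
    (\<exists>h. bij_betw h E F \<and> (\<forall>g\<in>carrier G. \<forall>x\<in>E. h (\<phi> g x) = \<psi> g (h x)))"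

fun gset_sum :: "('g, 'x) gset \<Rightarrow> ('g, 'y) gset \<Rightarrow> ('g, 'x + 'y) gset" where
  "gset_sum (E, \<phi>) (F, \<psi>) = (E <+> F, \<lambda>g. \<lambda>x\<in>E <+> F. map_sum (\<phi> g) (\<psi> g) x)"

text \<open>The disjoint union of \<open>k\<close> copies.\<close>

fun gset_copies :: "nat \<Rightarrow> ('g, 'x) gset \<Rightarrow> ('g, nat \<times> 'x) gset" where
  "gset_copies k (E, \<phi>) = ({..<k} \<times> E, \<lambda>g. \<lambda>x\<in>{..<k} \<times> E. map_prod id (\<phi> g) x)"

definition coset_gset :: "('g, 'm) monoid_scheme \<Rightarrow> 'g set \<Rightarrow> ('g, 'g set) gset" where
  "coset_gset G H = (lcosets\<^bsub>G\<^esub> H, \<lambda>g. \<lambda>x\<in>lcosets\<^bsub>G\<^esub> H. g <#\<^bsub>G\<^esub> x)"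


section \<open>The symmetric group and its action on the plane\<close>

definition S3 :: "(3 \<Rightarrow> 3) monoid" where
  "S3 = BijGroup UNIV"

definition C2 :: "(3 \<Rightarrow> 3) set" where
  "C2 = generate S3 {Transposition.transpose 0 1}"

definition C3 :: "(3 \<Rightarrow> 3) set" where
  "C3 = generate S3 {\<lambda>i. i + 1}"  \<comment> \<open>addition in the type \<open>3\<close> is modulo 3\<close>

text \<open>Coordinate \<open>i\<close> of a point becomes coordinate \<open>\<sigma> i\<close>, so that this is a left action.\<close>

definition permute_coords :: "(3 \<Rightarrow> 3) \<Rightarrow> complex ^ 3 \<Rightarrow> complex ^ 3" where
  "permute_coords \<sigma> v = (\<chi> i. v $ inv_into UNIV \<sigma> i)"

definition intersection_gset ::
    "mpoly3 \<Rightarrow> mpoly3 \<Rightarrow> (3 \<Rightarrow> 3, (complex ^ 3) set) gset" where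
  "intersection_gset f g =
    (zero_locus f \<inter> zero_locus g,
     \<lambda>\<sigma>. \<lambda>P\<in>zero_locus f \<inter> zero_locus g. permute_coords \<sigma> ` P)"

end

theory Submission
  imports
    Defs
    "Subresultants.Subresultant_Gcd"
    "HOL-Analysis.Cartesian_Space"
    "HOL-Computational_Algebra.Field_as_Ring"
    "HOL-Computational_Algebra.Fundamental_Theorem_Algebra"
begin

text \<open>
  Transversality forces the gradients of \<open>f\<close> and \<open>g\<close> to be independent at each common zero. Hence, in
  generic linear coordinates, the resultant obtained by eliminating one variable has only simple roots,
  in bijection with the common zeros. Its degree is \<open>d * e\<close>, so there are exactly \<open>d * e\<close> of them.

  A point with a nontrivial stabilizer either has two equal coordinates, or lies in the orbit of
  \<open>[1 : -1 : 0]\<close> or of \<open>[1 : \<omega> : \<omega>\<^sup>2]\<close>. Together with Euler's identity, invariance under the stabilizer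
  makes the two gradients dependent in the first case. At \<open>[1 : -1 : 0]\<close> a symmetric form of odd degree
  vanishes, while one of even degree which vanishes has gradient zero; at \<open>[1 : \<omega> : \<omega>\<^sup>2]\<close> the same
  dichotomy holds with divisibility of the degree by 3. So these two orbits occur precisely when
  \<open>d * e\<close> is odd, respectively not divisible by 3, and the remaining points form free orbits.
\<close>

section \<open>Resultants\<close>

text \<open>Only the value 1 of the multiplicity is used, never a general comparison with orders of
  vanishing of a resultant: multiplicity 1 makes the local ideal maximal, which yields a statement
  about first derivatives, and independent gradients are what the simplicity of a root of the
  resultant requires. The coordinates have to be generic for two reasons. A root of the resultant
  should come from a single common zero, and no common zero may lie on the line at infinity, where
  it would lower the degree. These are finitely many conditions only once the intersection is known
  to be finite, so finiteness is obtained separately, in a chart whose centre merely lies off both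
  curves. The two special orbits have 3 and 2 points. Hence the number of points modulo 6 is 3 (if
  the product of the degrees is odd) plus 2 (if it is not divisible by 3). This agrees with the
  product itself exactly for the residues 0, 2, 3, 5, which is why 1 and 4 are impossible.\<close>

definition sylvester_row :: "'a poly \<Rightarrow> 'a poly \<Rightarrow> nat \<Rightarrow> 'a::comm_ring_1 poly" where
  "sylvester_row p q i =
    (if i < degree q then monom 1 (degree q - 1 - i) * p
     else monom 1 (degree p + degree q - 1 - i) * q)"

text \<open>Row i lists, in descending order, the coefficients of a shifted copy of \<open>p\<close>
  or \<open>q\<close>. Reading rows as polynomials turns suitable column operations into evaluation
  at a point.\<close>

lemma sylvester_mat_eq_coeff_row:
  assumes "i < degree p + degree q" "j < degree p + degree q"
  shows "sylvester_mat p q $$ (i, j) = coeff (sylvester_row p q i) (degree p + degree q - 1 - j)"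
proof (cases "i < degree q")
  case True
  have "coeff p (degree p + degree q - 1 - j - (degree q - 1 - i)) = 0"
    if "degree q - 1 - i \<le> degree p + degree q - 1 - j" "\<not> i \<le> j"
    using that True by (intro coeff_eq_0) linarith
  moreover have "degree p + degree q - 1 - j - (degree q - 1 - i) = degree p + i - j"
    if "i \<le> j" "j - i \<le> degree p"
    using that True by linarith
  ultimately show ?thesis
    using True assms
    by (subst sylvester_index_mat[OF assms])
       (auto simp: sylvester_row_def coeff_monom_mult)
next
  case False
  have "coeff q (degree p + degree q - 1 - j - (degree p + degree q - 1 - i)) = 0"
    if "degree p + degree q - 1 - i \<le> degree p + degree q - 1 - j" "\<not> i - degree q \<le> j"
    using that False assms by (intro coeff_eq_0) linarith
  moreover have "degree p + degree q - 1 - j - (degree p + degree q - 1 - i) = i - j"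
    if "j \<le> i"
    using that False assms by linarith
  ultimately show ?thesis
    using False assms
    by (subst sylvester_index_mat[OF assms])
       (auto simp: sylvester_row_def coeff_monom_mult)
qed

lemma degree_sylvester_row:
  assumes "i < degree p + degree q"
  shows "degree (sylvester_row p q i) < degree p + degree q"
proof (cases "i < degree q")
  case True
  have "degree (monom 1 (degree q - 1 - i) * p) \<le> (degree q - 1 - i) + degree p"
    by (rule order_trans[OF degree_mult_le]) (simp add: degree_monom_le)
  with True show ?thesis by (simp add: sylvester_row_def)
next
  case False
  have "degree (monom 1 (degree p + degree q - 1 - i) * q) \<le> (degree p + degree q - 1 - i) + degree q"
    by (rule order_trans[OF degree_mult_le]) (simp add: degree_monom_le)
  with False assms show ?thesis by (simp add: sylvester_row_def)
qed

lemma poly_eq_sum_reversed: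
  fixes p :: "'a::comm_semiring_1 poly"
  assumes "degree p < n"
  shows "poly p x = (\<Sum>j<n. coeff p (n - 1 - j) * x ^ (n - 1 - j))"
proof -
  have "poly p x = (\<Sum>j<n. coeff p j * x ^ j)"
    unfolding poly_altdef using assms by (intro sum.mono_neutral_left) (auto simp: coeff_eq_0)
  also have "\<dots> = (\<Sum>j<n. coeff p (n - 1 - j) * x ^ (n - 1 - j))"
    by (rule sum.reindex_bij_witness[of _ "\<lambda>j. n - 1 - j" "\<lambda>j. n - 1 - j"]) auto
  finally show ?thesis .
qed

text \<open>Weighting coefficient k by \<open>t ^ (degree p - k)\<close> changes the Sylvester
  matrix only by diagonal factors: \<open>D1\<close> times the new matrix equals the old one times
  \<open>D2\<close>. Comparing the exponents in the two diagonal determinants gives the power of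
  \<open>t\<close>.\<close>

lemma resultant_scale:
  fixes p q p' q' :: "'a::field poly"
  assumes deg: "degree p' = degree p" "degree q' = degree q"
    and cp: "\<And>k. k \<le> degree p \<Longrightarrow> coeff p' k = t ^ (degree p - k) * coeff p k"
    and cq: "\<And>k. k \<le> degree q \<Longrightarrow> coeff q' k = t ^ (degree q - k) * coeff q k"
    and t: "t \<noteq> 0"
  shows "resultant p' q' = t ^ (degree p * degree q) * resultant p q"
proof -
  define m n where "m = degree p" and "n = degree q"
  \<comment> \<open>\<open>r i\<close> is the number of places by which row i is shifted, counted
    separately in the block of \<open>p\<close> and in the block of \<open>q\<close>.\<close>
  define r where "r i = (if i < n then i else i - n)" for i
  define D1 where "D1 = mat (m + n) (m + n) (\<lambda>(i, j). if i = j then t ^ r i else 0)"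
  define D2 where "D2 = mat (m + n) (m + n) (\<lambda>(i, j). if i = j then t ^ i else 0)"
  have car: "D1 \<in> carrier_mat (m + n) (m + n)" "D2 \<in> carrier_mat (m + n) (m + n)"
    "sylvester_mat p q \<in> carrier_mat (m + n) (m + n)"
    "sylvester_mat p' q' \<in> carrier_mat (m + n) (m + n)"
    by (auto simp: D1_def D2_def m_def n_def deg sylvester_mat_def)
  have entry: "t ^ r i * sylvester_mat p' q' $$ (i, j) = sylvester_mat p q $$ (i, j) * t ^ j"
    if "i < m + n" "j < m + n" for i j
  proof -
    have 1: "t ^ i * coeff p' (m + i - j) = coeff p (m + i - j) * t ^ j"
      if "i \<le> j" "j - i \<le> m"
    proof -
      have "i + (m - (m + i - j)) = j" using that by linarith
      then show ?thesis using cp[of "m + i - j"] that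
        by (simp add: m_def mult.assoc[symmetric] power_add[symmetric])
    qed
    have 2: "t ^ (i - n) * coeff q' (i - j) = coeff q (i - j) * t ^ j"
      if "n \<le> i" "i - n \<le> j" "j \<le> i"
    proof -
      have "i - n + (n - (i - j)) = j" using that by linarith
      then show ?thesis using cq[of "i - j"] that
        by (simp add: n_def mult.assoc[symmetric] power_add[symmetric])
    qed
    show ?thesis
      using that 1 2 sylvester_index_mat[of i p q j] sylvester_index_mat[of i p' q' j]
      by (auto simp: deg m_def[symmetric] n_def[symmetric] r_def)
  qed
  have "D1 * sylvester_mat p' q' = sylvester_mat p q * D2"
  proof (rule eq_matI)
    fix i j
    assume "i < dim_row (sylvester_mat p q * D2)" "j < dim_col (sylvester_mat p q * D2)"
    then have ij: "i < m + n" "j < m + n" using car by auto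
    have "(D1 * sylvester_mat p' q') $$ (i, j)
        = (\<Sum>k\<in>{0..<m + n}. D1 $$ (i, k) * sylvester_mat p' q' $$ (k, j))"
      using ij car by (auto simp: scalar_prod_def)
    also have "\<dots> = (\<Sum>k\<in>{0..<m + n}. if k = i then t ^ r i * sylvester_mat p' q' $$ (i, j) else 0)"
      using ij by (intro sum.cong) (auto simp: D1_def)
    also have "\<dots> = t ^ r i * sylvester_mat p' q' $$ (i, j)" using ij by simp
    also have "\<dots> = sylvester_mat p q $$ (i, j) * t ^ j" using entry ij by simp
    also have "\<dots> = (\<Sum>k\<in>{0..<m + n}. if k = j then sylvester_mat p q $$ (i, j) * t ^ j else 0)"
      using ij by simp
    also have "\<dots> = (\<Sum>k\<in>{0..<m + n}. sylvester_mat p q $$ (i, k) * D2 $$ (k, j))"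
      using ij by (intro sum.cong) (auto simp: D2_def)
    also have "\<dots> = (sylvester_mat p q * D2) $$ (i, j)"
      using ij car by (auto simp: scalar_prod_def)
    finally show "(D1 * sylvester_mat p' q') $$ (i, j) = (sylvester_mat p q * D2) $$ (i, j)" .
  qed (use car in auto)
  then have "det D1 * resultant p' q' = resultant p q * det D2"
    using det_mult[OF car(1,4)] det_mult[OF car(3,2)] by (simp add: resultant_def)
  moreover have "det D1 = (\<Prod>i<m + n. t ^ r i)"
    using car(1) by (subst det_upper_triangular[OF _ car(1)])
      (auto simp: prod_list_diag_prod D1_def lessThan_atLeast0)
  moreover have "(\<Prod>i<m + n. t ^ r i) = t ^ (\<Sum>i<n. i) * t ^ (\<Sum>i<m. i)"
  proof -
    have "(\<Sum>i<m + n. r i) = (\<Sum>i<n. r i) + (\<Sum>i\<in>{n..<m + n}. r i)"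
      by (subst sum.union_disjoint[symmetric]) (auto intro!: sum.cong)
    also have "(\<Sum>i<n. r i) = (\<Sum>i<n. i)" by (simp add: r_def)
    also have "(\<Sum>i\<in>{n..<m + n}. r i) = (\<Sum>i<m. i)"
      by (rule sum.reindex_bij_witness[of _ "\<lambda>i. i + n" "\<lambda>i. i - n"]) (auto simp: r_def)
    finally show ?thesis by (simp add: power_sum[symmetric] power_add[symmetric])
  qed
  moreover have "det D2 = t ^ (\<Sum>i<m + n. i)"
    using car(2) by (subst det_upper_triangular[OF _ car(2)])
      (auto simp: prod_list_diag_prod D2_def lessThan_atLeast0 power_sum)
  \<comment> \<open>Each of the last m indices exceeds its shift \<open>r i\<close> by n; this
    excess \<open>m * n\<close> is the exponent in the claim.\<close>
  moreover have "(\<Sum>i<m + n. i) = (\<Sum>i<n. i) + (\<Sum>i<m. i) + m * n"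
    by (induction m) (auto simp: algebra_simps)
  ultimately have "t ^ ((\<Sum>i<n. i) + (\<Sum>i<m. i)) * resultant p' q'
      = t ^ ((\<Sum>i<n. i) + (\<Sum>i<m. i)) * (t ^ (m * n) * resultant p q)"
    by (simp add: power_add algebra_simps)
  then show ?thesis using t by (simp add: m_def n_def)
qed

lemma coprime_if_no_common_root:
  fixes p q :: "complex poly"
  assumes "p \<noteq> 0" and "\<And>z. poly p z = 0 \<Longrightarrow> poly q z \<noteq> 0"
  shows "coprime p q"
proof (rule coprimeI)
  fix r assume r: "r dvd p" "r dvd q"
  have "\<not> (\<exists>z. poly r z = 0)"
    using r assms(2) by (meson dvd_trans poly_eq_0_iff_dvd)
  then have "degree r = 0"
    using fundamental_theorem_of_algebra_alt[of r] by (metis degree_pCons_0)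
  moreover have "r \<noteq> 0" using r assms(1) by auto
  ultimately show "is_unit r" by (simp add: is_unit_iff_degree)
qed

lemma map_poly_eval_mult:
  fixes P Q :: "'a::comm_ring_1 poly poly"
  shows "map_poly (\<lambda>p. poly p x) (P * Q) = map_poly (\<lambda>p. poly p x) P * map_poly (\<lambda>p. poly p x) Q"
  by (rule poly_eqI) (simp add: coeff_map_poly coeff_mult poly_sum)

text \<open>A column operation makes the last column of the Sylvester matrix consist of the values
  of its rows at \<open>z0\<close>, all divisible by x - x0. If the determinant that remains after
  division vanished at \<open>x0\<close>, a relation between its rows would give a and b with a F0 +
  b G0 = 0. As \<open>z0\<close> is the only common root and not a double root of both, F0 / (z -
  z0) and G0 / (z - z0) are coprime, so (a, b) is a constant multiple of (G2, -F2). The last column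
  then says that this constant times the Jacobian is 0.\<close>

lemma resultant_simple_root:
  fixes F G :: "complex poly poly" and x0 z0 :: complex
  defines "F0 \<equiv> map_poly (\<lambda>p. poly p x0) F" and "G0 \<equiv> map_poly (\<lambda>p. poly p x0) G"
  assumes degF: "degree F0 = degree F" and degG: "degree G0 = degree G"
    and F0: "F0 \<noteq> 0" and G0: "G0 \<noteq> 0"
    and root: "poly F0 z0 = 0" "poly G0 z0 = 0"
    and unique: "\<And>z. poly F0 z = 0 \<Longrightarrow> poly G0 z = 0 \<Longrightarrow> z = z0"
    and jac: "poly (pderiv (poly F [:z0:])) x0 * poly (pderiv G0) z0
      \<noteq> poly (pderiv F0) z0 * poly (pderiv (poly G [:z0:])) x0"
  shows "poly (pderiv (resultant F G)) x0 \<noteq> 0"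
proof
  assume deriv0: "poly (pderiv (resultant F G)) x0 = 0"
  define m n where "m = degree F" and "n = degree G"
  define N where "N = m + n"
  have "m > 0" using F0 root(1) degF unfolding m_def
    by (metis degree_eq_zeroE gr0I poly_const_conv pCons_0_0)
  then have "N > 0" by (simp add: N_def)
  have ev: "comm_ring_hom (\<lambda>p::complex poly. poly p x0)"
    by unfold_locales auto
  have ev_F: "poly (poly F [:z0:]) x0 = poly F0 z0" for z0
    using poly_hom.poly_map_poly[of x0 F "[:z0:]"] by (simp add: F0_def)
  have ev_G: "poly (poly G [:z0:]) x0 = poly G0 z0" for z0
    using poly_hom.poly_map_poly[of x0 G "[:z0:]"] by (simp add: G0_def)
  obtain F1 where F1: "poly F [:z0:] = [:-x0, 1:] * F1"
    using root(1) ev_F poly_eq_0_iff_dvd by (metis dvdE)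
  obtain G1 where G1: "poly G [:z0:] = [:-x0, 1:] * G1"
    using root(2) ev_G poly_eq_0_iff_dvd by (metis dvdE)
  obtain F2 where F2: "F0 = [:-z0, 1:] * F2" using root(1) poly_eq_0_iff_dvd by (metis dvdE)
  obtain G2 where G2: "G0 = [:-z0, 1:] * G2" using root(2) poly_eq_0_iff_dvd by (metis dvdE)
  have ders: "poly (pderiv (poly F [:z0:])) x0 = poly F1 x0"
    "poly (pderiv (poly G [:z0:])) x0 = poly G1 x0"
    "poly (pderiv F0) z0 = poly F2 z0" "poly (pderiv G0) z0 = poly G2 z0"
    unfolding F1 G1 F2 G2 by (simp_all add: pderiv_mult pderiv_pCons del: mult_pCons_left)
  define row where "row = sylvester_row F G"
  \<comment> \<open>\<open>c i\<close> is the value of row i at \<open>z0\<close> divided by x -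
    x0.\<close>
  define c where "c i = (if i < n then [:z0:] ^ (n - 1 - i) * F1 else [:z0:] ^ (N - 1 - i) * G1)" for i
  have row_c: "poly (row i) [:z0:] = [:-x0, 1:] * c i" for i
    by (simp add: row_def sylvester_row_def c_def poly_monom F1 G1 m_def n_def N_def
        del: mult_pCons_left)
  \<comment> \<open>\<open>A\<close> is the Sylvester matrix with last column replaced by
    \<open>c\<close>. The unitriangular \<open>E\<close> performs the evaluation at
    \<open>z0\<close> in the last column, and \<open>D\<close> restores the factor x - x0.\<close>
  define A where "A = mat N N (\<lambda>(i, j). if j = N - 1 then c i else coeff (row i) (N - 1 - j))"
  define E where "E = mat N N (\<lambda>(i, j). if j = N - 1 then [:z0:] ^ (N - 1 - i)
      else if i = j then 1 else 0)"
  define D where "D = mat N N (\<lambda>(i, j). if i = j then (if j = N - 1 then [:-x0, 1:] else 1) else 0)"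
  have car: "A \<in> carrier_mat N N" "E \<in> carrier_mat N N" "D \<in> carrier_mat N N"
    "sylvester_mat F G \<in> carrier_mat N N"
    by (auto simp: A_def E_def D_def N_def m_def n_def sylvester_mat_def)
  have syl: "sylvester_mat F G $$ (i, j) = coeff (row i) (N - 1 - j)" if "i < N" "j < N" for i j
    using that sylvester_mat_eq_coeff_row[of i F G j] by (simp add: row_def N_def m_def n_def)
  have "sylvester_mat F G * E = A * D"
  proof (rule eq_matI)
    fix i j
    assume "i < dim_row (A * D)" "j < dim_col (A * D)"
    then have ij: "i < N" "j < N" using car by auto
    have "(sylvester_mat F G * E) $$ (i, j) = (\<Sum>k<N. coeff (row i) (N - 1 - k) * E $$ (k, j))"
      using ij car by (auto simp: scalar_prod_def syl lessThan_atLeast0)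
    also have "\<dots> = (if j = N - 1 then [:-x0, 1:] * c i else coeff (row i) (N - 1 - j))"
    proof (cases "j = N - 1")
      case True
      have "(\<Sum>k<N. coeff (row i) (N - 1 - k) * E $$ (k, j)) = poly (row i) [:z0:]"
        using ij True degree_sylvester_row[of i F G]
        by (subst poly_eq_sum_reversed[of _ N])
           (auto simp: E_def row_def N_def m_def n_def)
      then show ?thesis using True row_c by simp
    next
      case False
      have "(\<Sum>k<N. coeff (row i) (N - 1 - k) * E $$ (k, j))
          = (\<Sum>k<N. if k = j then coeff (row i) (N - 1 - j) else 0)"
        using ij False by (intro sum.cong) (auto simp: E_def)
      then show ?thesis using False ij by simp
    qed
    also have "\<dots> = (\<Sum>k<N. if k = j then A $$ (i, j) * D $$ (j, j) else 0)"
      using ij by (simp add: A_def D_def)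
    also have "\<dots> = (\<Sum>k<N. A $$ (i, k) * D $$ (k, j))"
      using ij by (intro sum.cong) (auto simp: D_def)
    also have "\<dots> = (A * D) $$ (i, j)"
      using ij car by (auto simp: scalar_prod_def lessThan_atLeast0)
    finally show "(sylvester_mat F G * E) $$ (i, j) = (A * D) $$ (i, j)" .
  qed (use car in auto)
  then have "resultant F G * det E = det A * det D"
    using det_mult[OF car(4,2)] det_mult[OF car(1,3)] by (simp add: resultant_def)
  moreover have "det E = (\<Prod>i<N. 1)"
    using car(2) by (subst det_upper_triangular[OF _ car(2)])
      (auto simp: prod_list_diag_prod E_def lessThan_atLeast0 intro!: prod.neutral)
  moreover have "det D = (\<Prod>i<N. if i = N - 1 then [:-x0, 1:] else 1)"
    using car(3) by (subst det_upper_triangular[OF _ car(3)])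
      (auto simp: prod_list_diag_prod D_def lessThan_atLeast0 intro!: prod.cong)
  moreover have "\<dots> = [:-x0, 1:]" using \<open>N > 0\<close> by simp
  ultimately have "resultant F G = det A * [:-x0, 1:]" by simp
  then have "poly (det A) x0 = 0"
    using deriv0 by (simp add: pderiv_mult pderiv_pCons del: mult_pCons_right)
  then have "det (map_mat (\<lambda>p. poly p x0) A) = 0" 
    using comm_ring_hom.hom_det[OF ev, of A] by simp
  \<comment> \<open>A kernel vector of the transpose is a linear relation between the rows of
    \<open>A\<close> at \<open>x0\<close>.\<close>
  define B where "B = transpose_mat (map_mat (\<lambda>p. poly p x0) A)"
  have carB: "B \<in> carrier_mat N N" using car by (simp add: B_def)
  have "det B = 0" unfolding B_def using car \<open>det (map_mat _ A) = 0\<close>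
    by (subst det_transpose[of _ N]) auto
  then obtain u where u: "u \<in> carrier_vec N" "u \<noteq> 0\<^sub>v N" "B *\<^sub>v u = 0\<^sub>v N"
    using det_0_iff_vec_prod_zero[OF carB] by blast
  have comb: "(\<Sum>i<N. poly (A $$ (i, j)) x0 * vec_index u i) = 0" if "j < N" for j
  proof -
    have "vec_index (B *\<^sub>v u) j = 0" using u that by simp
    then show ?thesis using that u(1) carB car
      by (simp add: scalar_prod_def B_def lessThan_atLeast0 row_transpose)
  qed
  \<comment> \<open>The relation read as a pair of polynomials: the weights of the rows of
    \<open>F\<close> form a, those of the rows of \<open>G\<close> form b.\<close>
  define a where "a = (\<Sum>i<n. monom (vec_index u i) (n - 1 - i))"
  define b where "b = (\<Sum>i\<in>{n..<N}. monom (vec_index u i) (N - 1 - i))"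
  have split: "(\<Sum>i<N. h i) = (\<Sum>i<n. h i) + (\<Sum>i\<in>{n..<N}. h i)" for h :: "nat \<Rightarrow> 'z::comm_monoid_add"
    by (subst sum.union_disjoint[symmetric]) (auto simp: N_def intro!: sum.cong)
  define w where "w = a * F0 + b * G0"
  have w_row: "w = (\<Sum>i<N. smult (vec_index u i) (map_poly (\<lambda>p. poly p x0) (row i)))"
  proof -
    have "smult (vec_index u i) (map_poly (\<lambda>p. poly p x0) (row i)) = 
        (if i < n then monom (vec_index u i) (n - 1 - i) * F0 else monom (vec_index u i) (N - 1 - i) * G0)" for i
      unfolding row_def sylvester_row_def F0_def G0_def n_def[symmetric] m_def[symmetric] N_def[symmetric]
      by (auto simp: map_poly_eval_mult map_poly_monom smult_monom mult_smult_left[symmetric])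
    then show ?thesis unfolding w_def a_def b_def by (simp add: split sum_distrib_right)
  qed
  \<comment> \<open>All columns but the last are unchanged columns of the Sylvester matrix, so the
    relation kills every coefficient of \<open>w\<close> except the constant one. That one vanishes
    as well because \<open>w\<close> is zero at \<open>z0\<close>.\<close>
  have w_coeff: "coeff w (N - 1 - j) = 0" if "j < N - 1" for j
  proof -
    have "coeff w (N - 1 - j) = (\<Sum>i<N. vec_index u i * poly (coeff (row i) (N - 1 - j)) x0)"
      unfolding w_row by (simp add: coeff_sum)
    also have "\<dots> = (\<Sum>i<N. poly (A $$ (i, j)) x0 * vec_index u i)"
      using that by (intro sum.cong) (auto simp: A_def mult.commute)
    finally show ?thesis using comb[of j] that by simp
  qed
  have w_z0: "poly w z0 = 0" unfolding w_def using root by simp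
  have degw: "degree w = 0"
  proof (rule ccontr)
    assume "degree w \<noteq> 0"
    moreover have "degree w \<le> N - 1" unfolding w_row
    proof (rule degree_sum_le)
      fix i assume "i \<in> {..<N}"
      then have "degree (row i) < N" using degree_sylvester_row[of i F G]
        by (simp add: row_def N_def m_def n_def)
      moreover have "degree (smult (vec_index u i) (map_poly (\<lambda>p. poly p x0) (row i))) \<le> degree (row i)"
        by (rule order_trans[OF degree_smult_le]) (rule degree_map_poly_le)
      ultimately show "degree (smult (vec_index u i) (map_poly (\<lambda>p. poly p x0) (row i))) \<le> N - 1" by linarith
    qed simp
    ultimately have "coeff w (N - 1 - (N - 1 - degree w)) = 0" by (intro w_coeff) linarith
    moreover have "N - 1 - (N - 1 - degree w) = degree w" using \<open>degree w \<le> N - 1\<close> by linarith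
    ultimately have "lead_coeff w = 0" by (simp only:)
    then show False using \<open>degree w \<noteq> 0\<close> by simp
  qed
  then have "w = 0" using w_z0 by (metis degree_eq_zeroE poly_const_conv pCons_0_0)
  then have "[:-z0, 1:] * (a * F2 + b * G2) = 0"
    unfolding w_def F2 G2 by (simp add: algebra_simps del: mult_pCons_left)
  then have ab: "a * F2 + b * G2 = 0" by (simp only: mult_eq_0_iff) simp
  have "F2 \<noteq> 0" "G2 \<noteq> 0" using F0 G0 F2 G2 by auto
  have "coprime G2 F2"
  proof (rule coprime_if_no_common_root[OF \<open>G2 \<noteq> 0\<close>])
    fix z assume "poly G2 z = 0"
    show "poly F2 z \<noteq> 0"
    proof
      assume "poly F2 z = 0"
      then have "z = z0" using \<open>poly G2 z = 0\<close> by (intro unique) (simp_all add: F2 G2)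
      then show False using jac ders \<open>poly F2 z = 0\<close> \<open>poly G2 z = 0\<close> by simp
    qed
  qed
  have "G2 dvd a * F2" using ab by (metis add_eq_0_iff dvd_triv_right dvd_minus_iff)
  then have "G2 dvd a" using \<open>coprime G2 F2\<close> by (simp add: coprime_dvd_mult_left_iff)
  then obtain k where k: "a = G2 * k" by (elim dvdE)
  have "G2 * (F2 * k + b) = 0" using ab unfolding k by (simp add: algebra_simps)
  then have "F2 * k + b = 0" using \<open>G2 \<noteq> 0\<close> by (simp only: mult_eq_0_iff) simp
  then have kb: "b = - F2 * k" by (simp add: eq_neg_iff_add_eq_0 add.commute)
  have dega: "degree a \<le> n - 1" unfolding a_def
    by (rule degree_sum_le) (auto intro: order_trans[OF degree_monom_le])
  have degG2: "degree G0 = degree G2 + 1" unfolding G2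
    using \<open>G2 \<noteq> 0\<close> by (subst degree_mult_eq) auto
  \<comment> \<open>The degree of a is at most n - 1, which is already the degree of
    \<open>G2\<close>.\<close>
  have "degree k = 0"
  proof (cases "k = 0")
    case False
    then have "degree a = degree G2 + degree k" using k \<open>G2 \<noteq> 0\<close> by (simp add: degree_mult_eq)
    then show ?thesis using dega degG2 degG by (simp add: n_def)
  qed simp
  then obtain k0 where k0: "k = [:k0:]" by (elim degree_eq_zeroE)
  \<comment> \<open>Only now does the relation in the last column enter; it pairs a and b at
    \<open>z0\<close> with \<open>F1\<close> and \<open>G1\<close> at \<open>x0\<close>, which
    produces the Jacobian.\<close>
  have "(\<Sum>i<N. poly (c i) x0 * vec_index u i) = 0"
  proof -
    have "(\<Sum>i<N. poly (c i) x0 * vec_index u i)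
        = (\<Sum>i<N. poly (A $$ (i, N - 1)) x0 * vec_index u i)"
      using \<open>N > 0\<close> by (intro sum.cong) (auto simp: A_def)
    then show ?thesis using comb[of "N - 1"] \<open>N > 0\<close> by simp
  qed
  moreover have "(\<Sum>i<N. poly (c i) x0 * vec_index u i) = poly a z0 * poly F1 x0 + poly b z0 * poly G1 x0"
    unfolding split a_def b_def
    unfolding poly_sum sum_distrib_right
    by (intro arg_cong2[where f = "(+)"] sum.cong) (auto simp: poly_monom c_def)
  ultimately have "k0 * (poly G2 z0 * poly F1 x0 - poly F2 z0 * poly G1 x0) = 0"
    unfolding k kb k0 by (auto simp: algebra_simps)
  moreover have "poly G2 z0 * poly F1 x0 - poly F2 z0 * poly G1 x0 \<noteq> 0"
    using jac unfolding ders by (simp add: mult.commute)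
  ultimately have "k0 = 0" by simp
  then have "a = 0" "b = 0" using k kb k0 by auto
  have "vec_index u i = 0" if "i < N" for i
  proof (cases "i < n")
    case True
    have "coeff a (n - 1 - i) = (\<Sum>j<n. if j = i then vec_index u i else 0)"
      unfolding a_def coeff_sum using True by (intro sum.cong) auto
    then show ?thesis using True \<open>a = 0\<close> by simp
  next
    case False
    have "coeff b (N - 1 - i) = (\<Sum>j\<in>{n..<N}. if j = i then vec_index u i else 0)"
      unfolding b_def coeff_sum using False that by (intro sum.cong) auto
    then show ?thesis using False that \<open>b = 0\<close> by simp
  qed
  then have "u = 0\<^sub>v N" using u(1) by auto
  then show False using u(2) by simp
qed

lemma card_roots_if_all_simple:
  fixes p :: "complex poly"
  assumes "\<And>x. poly p x = 0 \<Longrightarrow> poly (pderiv p) x \<noteq> 0"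
  shows "card {x. poly p x = 0} = degree p"
proof -
  have rs: "rsquarefree p" using assms by (auto simp: rsquarefree_roots)
  then have "p \<noteq> 0" by (simp add: rsquarefree_def)
  have "degree p = degree (smult (lead_coeff p) (\<Prod>z|poly p z = 0. [:-z, 1:]))"
    using complex_poly_decompose_rsquarefree[OF rs] by simp
  also have "\<dots> = degree (\<Prod>z|poly p z = 0. [:-z, 1:])" using \<open>p \<noteq> 0\<close> by simp
  also have "\<dots> = card {x. poly p x = 0}"
    by (subst degree_prod_sum_eq) auto
  finally show ?thesis by simp
qed

text \<open>An identity at all nonzero t is an identity of polynomials, so P is Q with its
  coefficients reversed with respect to n, and the coefficient of P in degree n is Q(0).\<close>

lemma degree_eq_if_reversed:
  fixes P Q :: "complex poly"
  assumes "\<And>t. t \<noteq> 0 \<Longrightarrow> poly P t = t ^ n * poly Q (inverse t)" and "poly Q 0 \<noteq> 0"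
  shows "degree P = n"
proof -
  have Q0: "coeff Q 0 \<noteq> 0" "Q \<noteq> 0" using assms(2) by (auto simp: poly_0_coeff_0)
  have eqI: "p = q" if "\<And>t. t \<noteq> 0 \<Longrightarrow> poly p t = poly q t" for p q :: "complex poly"
  proof (rule ccontr)
    assume "p \<noteq> q"
    then have "finite {t. poly (p - q) t = 0}" by (intro poly_roots_finite) simp
    moreover have "UNIV - {0} \<subseteq> {t. poly (p - q) t = 0}" using that by auto
    ultimately have "finite (UNIV - {0::complex})" by (rule rev_finite_subset)
    then show False using infinite_UNIV_char_0[where ?'a = complex] by simp
  qed
  have refl: "poly (reflect_poly Q) t = t ^ degree Q * poly Q (inverse t)" if "t \<noteq> 0" for t
    using that by (rule poly_reflect_poly_nz)
  have degr: "degree (reflect_poly Q) = degree Q" using Q0 by simp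
  show ?thesis
  proof (cases "degree Q \<le> n")
    case True
    have "P = monom 1 (n - degree Q) * reflect_poly Q"
      using True by (intro eqI) (simp add: assms refl poly_monom mult.assoc[symmetric] power_add[symmetric])
    then show ?thesis using True Q0 degr by (simp add: degree_mult_eq degree_monom_eq monom_eq_0_iff)
  next
    case False
    then have eq: "monom 1 (degree Q - n) * P = reflect_poly Q"
      by (intro eqI) (simp add: assms refl poly_monom mult.assoc[symmetric] power_add[symmetric])
    then have "P \<noteq> 0" using Q0 by auto
    then have "degree Q = degree Q - n + degree P"
      using eq degr by (metis degree_mult_eq degree_monom_eq monom_eq_0_iff one_neq_zero)
    then show ?thesis using False by simp
  qed
qed

no_notation Matrix.vec_index (infixl \<open>$\<close> 100)

section \<open>Evaluation of ternary forms\<close>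

lemma mpoly_eval_superset:
  assumes "finite K" "Poly_Mapping.keys f \<subseteq> K"
  shows "mpoly_eval f v =
    (\<Sum>m\<in>K. Poly_Mapping.lookup f m * (\<Prod>i\<in>UNIV. (v $ i) ^ Poly_Mapping.lookup m i))"
  unfolding mpoly_eval_def
  by (rule sum.mono_neutral_left[OF assms]) (auto simp: in_keys_iff)

lemma mpoly_eval_0 [simp]: "mpoly_eval 0 v = 0"
  by (simp add: mpoly_eval_def)

lemma mpoly_eval_add [simp]: "mpoly_eval (f + g) v = mpoly_eval f v + mpoly_eval g v"
proof -
  have sub: "Poly_Mapping.keys (f + g) \<subseteq> Poly_Mapping.keys f \<union> Poly_Mapping.keys g"
    by (rule Poly_Mapping.keys_add)
  show ?thesis
    by (simp add: mpoly_eval_superset[OF _ sub] lookup_add distrib_right sum.distrib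
        mpoly_eval_superset[of "Poly_Mapping.keys f \<union> Poly_Mapping.keys g" f]
        mpoly_eval_superset[of "Poly_Mapping.keys f \<union> Poly_Mapping.keys g" g])
qed

lemma mpoly_eval_single:
  "mpoly_eval (Poly_Mapping.single m c) v = c * (\<Prod>i\<in>UNIV. (v $ i) ^ Poly_Mapping.lookup m i)"
  by (subst mpoly_eval_superset[of "{m}"]) auto

lemma mpoly_eval_sum: "mpoly_eval (\<Sum>a\<in>A. h a) v = (\<Sum>a\<in>A. mpoly_eval (h a) v)"
  by (induction A rule: infinite_finite_induct) auto

lemma mpoly_sum_monomials:
  "f = (\<Sum>m\<in>Poly_Mapping.keys f. Poly_Mapping.single m (Poly_Mapping.lookup f m))"
  by (rule poly_mapping_eqI) (auto simp: lookup_sum lookup_single when_def in_keys_iff)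

lemma mpoly_eval_mult [simp]: "mpoly_eval (f * g) v = mpoly_eval f v * mpoly_eval g v"
proof -
  have "mpoly_eval (f * g) v = mpoly_eval ((\<Sum>m\<in>Poly_Mapping.keys f. Poly_Mapping.single m (Poly_Mapping.lookup f m))
      * (\<Sum>n\<in>Poly_Mapping.keys g. Poly_Mapping.single n (Poly_Mapping.lookup g n))) v"
    using mpoly_sum_monomials[of f] mpoly_sum_monomials[of g] by simp
  also have "\<dots> = (\<Sum>m\<in>Poly_Mapping.keys f. \<Sum>n\<in>Poly_Mapping.keys g.
      Poly_Mapping.lookup f m * (\<Prod>i\<in>UNIV. (v $ i) ^ Poly_Mapping.lookup m i) *
      (Poly_Mapping.lookup g n * (\<Prod>i\<in>UNIV. (v $ i) ^ Poly_Mapping.lookup n i)))"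
    by (simp add: sum_product mpoly_eval_sum mult_single mpoly_eval_single lookup_add power_add
        prod.distrib mult_ac)
  also have "\<dots> = mpoly_eval f v * mpoly_eval g v"
    by (simp add: mpoly_eval_def sum_product)
  finally show ?thesis .
qed

lemma mpoly_eval_1 [simp]: "mpoly_eval 1 v = 1"
  by (simp flip: single_one add: mpoly_eval_single)

lemma homogeneous_mult:
  assumes "homogeneous a f" "homogeneous b g"
  shows "homogeneous (a + b) (f * g)"
  unfolding homogeneous_def
proof
  fix m assume "m \<in> Poly_Mapping.keys (f * g)"
  then obtain k l where "m = k + l" "k \<in> Poly_Mapping.keys f" "l \<in> Poly_Mapping.keys g"
    using keys_mult[of f g] by auto
  then show "(\<Sum>i\<in>UNIV. Poly_Mapping.lookup m i) = a + b"
    using assms by (simp add: homogeneous_def lookup_add sum.distrib)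
qed

lemma homogeneous_const: "homogeneous 0 (Poly_Mapping.single 0 c)"
  by (simp add: homogeneous_def)

lemma mpoly_eval_scale:
  assumes "homogeneous d f"
  shows "mpoly_eval f (c *s v) = c ^ d * mpoly_eval f v"
proof -
  have "(\<Prod>i\<in>UNIV. (c * v $ i) ^ Poly_Mapping.lookup m i)
      = c ^ d * (\<Prod>i\<in>UNIV. (v $ i) ^ Poly_Mapping.lookup m i)"
    if "m \<in> Poly_Mapping.keys f" for m
  proof -
    have "(\<Sum>i\<in>UNIV. Poly_Mapping.lookup m i) = d" using assms that by (simp add: homogeneous_def)
    then show ?thesis by (simp add: power_mult_distrib prod.distrib power_sum[symmetric])
  qed
  then show ?thesis by (simp add: mpoly_eval_def sum_distrib_left mult_ac)
qed

definition linear_form :: "complex ^ 3 \<Rightarrow> mpoly3" where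
  "linear_form n = (\<Sum>i\<in>UNIV. Poly_Mapping.single (Poly_Mapping.single i 1) (n $ i))"

text \<open>Bilinear, without conjugation: the value at \<open>v\<close> of the linear form with
  coefficient vector \<open>n\<close>.\<close>

definition pairing :: "complex ^ 3 \<Rightarrow> complex ^ 3 \<Rightarrow> complex" where
  "pairing n v = (\<Sum>i\<in>UNIV. n $ i * v $ i)"

lemma mpoly_eval_linear_form: "mpoly_eval (linear_form n) v = pairing n v"
proof -
  have "(\<Prod>j\<in>UNIV. (v $ j) ^ Poly_Mapping.lookup (Poly_Mapping.single i 1) j) = v $ i" for i
  proof -
    have "(\<Prod>j\<in>UNIV. (v $ j) ^ Poly_Mapping.lookup (Poly_Mapping.single i 1) j)
        = (\<Prod>j\<in>UNIV. if j = i then v $ j else 1)"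
      by (intro prod.cong) (auto simp: lookup_single when_def)
    then show ?thesis by simp
  qed
  then show ?thesis
    by (simp add: linear_form_def pairing_def mpoly_eval_sum mpoly_eval_single)
qed

lemma homogeneous_linear_form: "homogeneous 1 (linear_form n)"
  unfolding homogeneous_def
proof
  fix m assume "m \<in> Poly_Mapping.keys (linear_form n)"
  then have "m \<in> (\<Union>i\<in>UNIV. Poly_Mapping.keys (Poly_Mapping.single (Poly_Mapping.single i 1) (n $ i)))"
    unfolding linear_form_def
    using keys_sum[of "\<lambda>i. Poly_Mapping.single (Poly_Mapping.single i (1::nat)) (n $ i)" UNIV] by blast
  then obtain i where "m = Poly_Mapping.single i 1" by (auto split: if_splits)
  then show "(\<Sum>i\<in>UNIV. Poly_Mapping.lookup m i) = 1" by (simp add: lookup_single when_def)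
qed

lemma pairing_add_right: "pairing n (u + v) = pairing n u + pairing n v"
  by (simp add: pairing_def distrib_left sum.distrib)

lemma pairing_scale_right: "pairing n (c *s v) = c * pairing n v"
  by (simp add: pairing_def sum_distrib_left mult.left_commute)

lemma pairing_add_left: "pairing (n + n') v = pairing n v + pairing n' v"
  by (simp add: pairing_def distrib_right sum.distrib)

lemma pairing_diff_left: "pairing (n - n') v = pairing n v - pairing n' v"
  by (simp add: pairing_def left_diff_distrib sum_subtractf)

lemma pairing_scale_left: "pairing (c *s n) v = c * pairing n v"
  by (simp add: pairing_def sum_distrib_left mult.assoc)

lemma pairing_axis [simp]: "pairing n (axis i 1) = n $ i"
proof -
  have "pairing n (axis i 1) = (\<Sum>j\<in>UNIV. if j = i then n $ i else 0)"
    unfolding pairing_def by (intro sum.cong) (auto simp: axis_def)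
  then show ?thesis by simp
qed

lemma pairing_axis_left [simp]: "pairing (axis i 1) v = v $ i"
  using pairing_axis[of v i] by (simp add: pairing_def mult.commute)

section \<open>Gradients\<close>

text \<open>Formulated through derivatives along complex lines, so that complex calculus in one
  variable suffices.\<close>

definition has_gradient :: "(complex ^ 3 \<Rightarrow> complex) \<Rightarrow> complex ^ 3 \<Rightarrow> complex ^ 3 \<Rightarrow> bool" where
  "has_gradient h v n \<longleftrightarrow>
    (\<forall>u. ((\<lambda>t. h (v + t *s u)) has_field_derivative pairing n u) (at 0))"

lemma has_gradient_const: "has_gradient (\<lambda>w. c) v 0"
  by (simp add: has_gradient_def pairing_def)

lemma has_gradient_coordinate: "has_gradient (\<lambda>w. w $ i) v (axis i 1)"
  by (auto simp: has_gradient_def intro!: derivative_eq_intros)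

lemma has_gradient_add:
  assumes "has_gradient h v n" "has_gradient k v n'"
  shows "has_gradient (\<lambda>w. h w + k w) v (n + n')"
  using assms by (auto simp: has_gradient_def pairing_add_left intro!: DERIV_add)

lemma has_gradient_mult:
  assumes "has_gradient h v n" "has_gradient k v n'"
  shows "has_gradient (\<lambda>w. h w * k w) v (k v *s n + h v *s n')"
  unfolding has_gradient_def
proof
  fix u
  show "((\<lambda>t. h (v + t *s u) * k (v + t *s u)) has_field_derivative
      pairing (k v *s n + h v *s n') u) (at 0)"
    using DERIV_mult[of "\<lambda>t. h (v + t *s u)" "pairing n u" 0 UNIV "\<lambda>t. k (v + t *s u)" "pairing n' u"] assms
    by (simp add: has_gradient_def pairing_add_left pairing_scale_left algebra_simps)
qed

lemma has_gradient_mpoly_add: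
  assumes "has_gradient (mpoly_eval f) v n" "has_gradient (mpoly_eval g) v n'"
  shows "has_gradient (mpoly_eval (f + g)) v (n + n')"
  using has_gradient_add[OF assms] by (simp add: has_gradient_def)

lemma has_gradient_mpoly_mult:
  assumes "has_gradient (mpoly_eval f) v n" "has_gradient (mpoly_eval g) v n'"
  shows "has_gradient (mpoly_eval (f * g)) v (mpoly_eval g v *s n + mpoly_eval f v *s n')"
  using has_gradient_mult[OF assms] by (simp add: has_gradient_def)

lemma has_gradient_linear_form: "has_gradient (mpoly_eval (linear_form n)) v n"
  by (auto simp: has_gradient_def mpoly_eval_linear_form pairing_add_right pairing_scale_right
      intro!: derivative_eq_intros)

lemma has_gradient_unique:
  assumes "has_gradient h v n" "has_gradient h v n'"
  shows "n = n'"
proof -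
  have "n $ i = n' $ i" for i
    using assms DERIV_unique unfolding has_gradient_def by (metis pairing_axis)
  then show ?thesis by (simp add: Finite_Cartesian_Product.vec_eq_iff)
qed

lemma ex_has_gradient: "\<exists>n. has_gradient (mpoly_eval f) v n"
proof -
  have pow: "\<exists>n. has_gradient (\<lambda>w. (w $ i) ^ k) v n" for i k
  proof (induction k)
    case 0
    show ?case using has_gradient_const[of 1 v] by auto
  next
    case (Suc k)
    then show ?case using has_gradient_mult[OF has_gradient_coordinate] by (simp del: split_paired_Ex) blast
  qed
  have "\<exists>n. has_gradient (\<lambda>w. \<Prod>i\<in>I. (w $ i) ^ e i) v n" if "finite I" for I :: "3 set" and e
    using that
  proof (induction I)
    case empty
    show ?case using has_gradient_const[of 1 v] by auto
  next
    case (insert i I)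
    then show ?case using pow[of i "e i"] has_gradient_mult by (auto simp del: split_paired_Ex) blast
  qed
  then have "\<exists>n. has_gradient (\<lambda>w. \<Prod>i\<in>UNIV. (w $ i) ^ e i) v n" for e by simp
  then have mon: "\<exists>n. has_gradient (\<lambda>w. c * (\<Prod>i\<in>UNIV. (w $ i) ^ e i)) v n" for c e
    using has_gradient_mult[OF has_gradient_const[of c v]] by blast
  have "\<exists>n. has_gradient (\<lambda>w. \<Sum>m\<in>K. Poly_Mapping.lookup f m * (\<Prod>i\<in>UNIV. (w $ i) ^ Poly_Mapping.lookup m i)) v n"
    if "finite K" for K
    using that
  proof (induction K)
    case empty
    show ?case using has_gradient_const[of 0 v] by auto
  next
    case (insert m K)
    then show ?case
      using mon[of "Poly_Mapping.lookup f m" "Poly_Mapping.lookup m"] has_gradient_add by auto blast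
  qed
  then show ?thesis unfolding mpoly_eval_def by simp
qed

text \<open>Differentiate f((1 + t) v) = (1 + t)^d f(v) at t = 0.\<close>

lemma euler_identity:
  assumes "homogeneous d f" "has_gradient (mpoly_eval f) v n"
  shows "pairing n v = of_nat d * mpoly_eval f v"
proof -
  have "v + t *s v = (1 + t) *s v" for t by (simp add: vector_sadd_rdistrib)
  then have "((\<lambda>t. (1 + t) ^ d * mpoly_eval f v) has_field_derivative pairing n v) (at 0)"
    using assms(2)[unfolded has_gradient_def, rule_format, of v]
    by (simp only: mpoly_eval_scale[OF assms(1)])
  moreover have "((\<lambda>t. (1 + t) ^ d * mpoly_eval f v) has_field_derivative of_nat d * mpoly_eval f v) (at 0)"
    by (auto intro!: derivative_eq_intros)
  ultimately show ?thesis by (rule DERIV_unique)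
qed

section \<open>Points of the projective plane\<close>

definition proj_point :: "complex ^ 3 \<Rightarrow> (complex ^ 3) set" where
  "proj_point v = {c *s v | c. c \<noteq> 0}"

lemma proj_rel_Image: "v \<noteq> 0 \<Longrightarrow> proj_rel `` {v} = proj_point v"
  by (auto simp: proj_rel_def proj_point_def)

lemma proj_point_self: "v \<in> proj_point v"
  unfolding proj_point_def by (rule CollectI, rule exI[of _ 1]) simp

lemma proj_point_in_proj_plane: "v \<noteq> 0 \<Longrightarrow> proj_point v \<in> proj_plane"
  unfolding proj_plane_def using proj_rel_Image[of v] by (auto simp: quotient_def)

lemma proj_point_scale:
  assumes "c \<noteq> 0"
  shows "proj_point (c *s v) = proj_point v"
proof
  show "proj_point (c *s v) \<subseteq> proj_point v"
  proof
    fix w assume "w \<in> proj_point (c *s v)"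
    then obtain a where "a \<noteq> 0" "w = (a * c) *s v" by (auto simp: proj_point_def vector_smult_assoc)
    then show "w \<in> proj_point v" using assms unfolding proj_point_def by (intro CollectI exI[of _ "a * c"]) simp
  qed
  show "proj_point v \<subseteq> proj_point (c *s v)"
  proof
    fix w assume "w \<in> proj_point v"
    then obtain a where "a \<noteq> 0" "w = a *s v" by (auto simp: proj_point_def)
    then show "w \<in> proj_point (c *s v)" using assms unfolding proj_point_def
      by (intro CollectI exI[of _ "a / c"]) (simp add: vector_smult_assoc)
  qed
qed

lemma proj_point_eq_iff:
  "proj_point v = proj_point w \<longleftrightarrow> (\<exists>c. c \<noteq> 0 \<and> w = c *s v)"
proof
  assume "proj_point v = proj_point w"
  then have "w \<in> proj_point v" using proj_point_self[of w] by simp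
  then show "\<exists>c. c \<noteq> 0 \<and> w = c *s v" by (auto simp: proj_point_def)
qed (auto simp: proj_point_scale)

lemma proj_planeE:
  assumes "P \<in> proj_plane"
  obtains v where "v \<noteq> 0" "P = proj_point v"
  using assms proj_rel_Image unfolding proj_plane_def by (auto elim!: quotientE)

lemma proj_point_in_zero_locus:
  assumes "homogeneous d f" "v \<noteq> 0"
  shows "proj_point v \<in> zero_locus f \<longleftrightarrow> mpoly_eval f v = 0"
proof -
  have "(\<forall>w\<in>proj_point v. mpoly_eval f w = 0) \<longleftrightarrow> mpoly_eval f v = 0"
    using proj_point_self[of v] mpoly_eval_scale[OF assms(1)] by (auto simp: proj_point_def)
  then show ?thesis using assms by (simp add: zero_locus_def proj_point_in_proj_plane)
qed

lemma nonvanishing_on_proj_point: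
  assumes "homogeneous d f" "mpoly_eval f v \<noteq> 0" "w \<in> proj_point v"
  shows "mpoly_eval f w \<noteq> 0"
  using assms by (auto simp: proj_point_def mpoly_eval_scale)

section \<open>Transversality and gradients\<close>

lemma Fract_eq_if_nonvanishing:
  fixes s t :: mpoly3
  assumes "mpoly_eval s v \<noteq> 0" "mpoly_eval t w \<noteq> 0"
  shows "Fract a s = Fract b t \<longleftrightarrow> a * t = b * s"
proof -
  have "s \<noteq> 0" "t \<noteq> 0" using assms by auto
  then show ?thesis by (rule eq_fract(1))
qed

text \<open>Clearing denominators turns membership in the local ideal into a polynomial identity, to
  which evaluation and differentiation at \<open>v\<close> apply. The degrees of \<open>A\<close>,
  \<open>B\<close> and \<open>S\<close> are not tracked.\<close>

lemma local_ideal_elem: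
  assumes "x \<in> local_ideal f g P" "v \<in> P"
  obtains S A B where "mpoly_eval S v \<noteq> 0" "x = Fract (A * f + B * g) S"
proof -
  obtain a s b t h k where 
    x: "x = Fract a s * Fract f h + Fract b t * Fract g k"
    and nz: "mpoly_eval s v \<noteq> 0" "mpoly_eval t v \<noteq> 0" "mpoly_eval h v \<noteq> 0" "mpoly_eval k v \<noteq> 0"
    using assms unfolding local_ideal_def local_ring_def local_equations_def by blast
  then have nz': "s \<noteq> 0" "t \<noteq> 0" "h \<noteq> 0" "k \<noteq> 0" by auto
  have "x = Fract ((a * t * k) * f + (b * s * h) * g) (s * h * (t * k))"
    unfolding x using nz' by (simp add: mult_ac)
  then show ?thesis using nz that by (metis mpoly_eval_mult mult_eq_0_iff)
qed

lemma const_ratfun_0 [simp]: "const_ratfun 0 = 0"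
  by (simp add: const_ratfun_def Zero_fract_def)

lemma const_ratfun_1 [simp]: "const_ratfun 1 = 1"
  by (simp add: const_ratfun_def One_fract_def)

lemma const_ratfun_mult: "const_ratfun a * const_ratfun b = const_ratfun (a * b)"
  by (simp add: const_ratfun_def mult_single)

lemma const_mult_in_local_ideal:
  assumes "x \<in> local_ideal f g P"
  shows "const_ratfun c * x \<in> local_ideal f g P"
proof -
  have ring: "const_ratfun c * y \<in> local_ring P" if y: "y \<in> local_ring P" for y
  proof -
    obtain a s n where *: "y = Fract a s" "homogeneous n a" "homogeneous n s"
      "\<forall>v\<in>P. mpoly_eval s v \<noteq> 0"
      using y unfolding local_ring_def by blast
    have "const_ratfun c * y = Fract (Poly_Mapping.single 0 c * a) s"
      unfolding * const_ratfun_def by simp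
    moreover have "homogeneous n (Poly_Mapping.single 0 c * a)"
      using homogeneous_mult[OF homogeneous_const *(2), of c] by simp
    ultimately show ?thesis using * unfolding local_ring_def by blast
  qed
  obtain \<alpha> \<beta> u w where "x = \<alpha> * u + \<beta> * w" "\<alpha> \<in> local_ring P" "\<beta> \<in> local_ring P"
    "u \<in> local_equations f P" "w \<in> local_equations g P"
    using assms unfolding local_ideal_def by blast
  moreover from this have "const_ratfun c * x = (const_ratfun c * \<alpha>) * u + (const_ratfun c * \<beta>) * w"
    by (simp add: algebra_simps)
  ultimately show ?thesis using ring unfolding local_ideal_def by blast
qed

text \<open>Multiplicity one forces the local ideal to be the maximal ideal, hence to contain all the
  linear forms through the point.\<close>

lemma linear_form_in_ideal_if_multiplicity_one:
  assumes f: "mpoly_eval f v = 0" and g: "mpoly_eval g v = 0" and v: "v \<noteq> 0"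
    and mult: "intersection_multiplicity f g (proj_point v) = 1"
    and n: "pairing n v = 0"
  obtains S A B where "mpoly_eval S v \<noteq> 0" "S * linear_form n = A * f + B * g"
proof -
  let ?P = "proj_point v"
  \<comment> \<open>A coordinate that does not vanish at \<open>v\<close> serves as the denominator
    that turns linear forms into elements of the local ring.\<close>
  obtain i where i: "v $ i \<noteq> 0" using v by (auto simp: Finite_Cartesian_Product.vec_eq_iff)
  define h where "h = linear_form (axis i 1)"
  have h: "homogeneous 1 h" unfolding h_def by (rule homogeneous_linear_form)
  have hv: "mpoly_eval h v \<noteq> 0" using i by (simp add: h_def mpoly_eval_linear_form)
  have hP: "\<forall>w\<in>?P. mpoly_eval h w \<noteq> 0" using nonvanishing_on_proj_point[OF h hv] by blast
  have "h \<noteq> 0" using hv by auto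
  define q where "q = Fract (linear_form n) h"
  have q: "q \<in> local_ring ?P" unfolding local_ring_def q_def
    using h hP homogeneous_linear_form[of n] by fast
  have one: "1 \<in> local_ring ?P" unfolding local_ring_def
    unfolding One_fract_def using homogeneous_const[of 1]
    by (intro CollectI exI[of _ "1::mpoly3"] exI[of _ "0::nat"]) simp
  have "1 \<noteq> q"
  proof
    assume "1 = q"
    then have "Fract 1 1 = Fract (linear_form n) h" by (simp add: q_def One_fract_def)
    then have "h = linear_form n" using \<open>h \<noteq> 0\<close> by (simp add: eq_fract)
    then show False using hv n by (simp add: mpoly_eval_linear_form)
  qed
  have "q \<in> local_ideal f g ?P"
  proof (rule ccontr)
    assume notin: "q \<notin> local_ideal f g ?P"
    \<comment> \<open>If \<open>q\<close> were outside the ideal, 1 and \<open>q\<close> would be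
      independent modulo it and the multiplicity would be at least 2.\<close>
    have indep: "independent_mod (local_ideal f g ?P) {1, q}"
      unfolding independent_mod_def
    proof (intro allI impI)
      fix c :: "ratfun3 \<Rightarrow> complex"
      assume "(\<Sum>q\<in>{1, q}. const_ratfun (c q) * q) \<in> local_ideal f g ?P"
      then have mem: "const_ratfun (c 1) + const_ratfun (c q) * q \<in> local_ideal f g ?P"
        using \<open>1 \<noteq> q\<close> by simp
      \<comment> \<open>Evaluation at \<open>v\<close> kills the ideal and the linear form, leaving
        \<open>c 1\<close> times nonzero values of \<open>h\<close> and \<open>S\<close>.\<close>
      have c1: "c 1 = 0"
      proof -
        obtain S A B where SAB: "mpoly_eval S v \<noteq> 0"
          "const_ratfun (c 1) + const_ratfun (c q) * q = Fract (A * f + B * g) S"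
          using local_ideal_elem[OF mem proj_point_self] by blast
        have "const_ratfun (c 1) + const_ratfun (c q) * q
            = Fract (Poly_Mapping.single 0 (c 1) * h + Poly_Mapping.single 0 (c q) * linear_form n) h"
          using \<open>h \<noteq> 0\<close> by (simp add: const_ratfun_def q_def)
        then have "(Poly_Mapping.single 0 (c 1) * h + Poly_Mapping.single 0 (c q) * linear_form n) * S
            = (A * f + B * g) * h"
          using SAB(2) Fract_eq_if_nonvanishing[OF hv SAB(1)] by metis
        then have "mpoly_eval ((Poly_Mapping.single 0 (c 1) * h + Poly_Mapping.single 0 (c q) * linear_form n) * S) v
            = mpoly_eval ((A * f + B * g) * h) v" by simp
        then show ?thesis
          using f g n hv SAB(1) by (simp add: mpoly_eval_single mpoly_eval_linear_form)
      qed
      have cq: "c q = 0"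
      proof (rule ccontr)
        assume "c q \<noteq> 0"
        have "const_ratfun (c q) * q \<in> local_ideal f g ?P" using mem c1 by simp
        then have "const_ratfun (inverse (c q)) * (const_ratfun (c q) * q) \<in> local_ideal f g ?P"
          by (rule const_mult_in_local_ideal)
        moreover have "const_ratfun (inverse (c q)) * (const_ratfun (c q) * q) = q"
          unfolding mult.assoc[symmetric] const_ratfun_mult using \<open>c q \<noteq> 0\<close> by simp
        ultimately show False using notin by (simp only:)
      qed
      show "\<forall>q\<in>{1, q}. c q = 0" using c1 cq by simp
    qed
    have "{1, q} \<subseteq> local_ring ?P" using q one by blast
    with indep have "\<exists>B. enat (card {1, q}) = enat (card B) \<and> finite B \<and> B \<subseteq> local_ring ?P \<and>
        independent_mod (local_ideal f g ?P) B"
      by (intro exI[of _ "{1, q}"] conjI finite.intros refl)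
    then have "enat (card {1, q}) \<le> quotient_dim (local_ring ?P) (local_ideal f g ?P)"
      unfolding quotient_dim_def by (rule Sup_upper[OF CollectI])
    also have "\<dots> = 1" using mult by (simp only: intersection_multiplicity_def)
    also have "card {1, q} = 2" using \<open>1 \<noteq> q\<close> by (rule card_2_iff[THEN iffD2, OF exI, OF exI, OF conjI[OF refl]])
    finally show False by (simp add: one_enat_def)
  qed
  then obtain S A B where SAB: "mpoly_eval S v \<noteq> 0" "q = Fract (A * f + B * g) S"
    using local_ideal_elem[OF _ proj_point_self] by blast
  then have "linear_form n * S = (A * f + B * g) * h"
    unfolding q_def by (simp only: Fract_eq_if_nonvanishing[OF hv SAB(1)])
  then have "S * linear_form n = (A * h) * f + (B * h) * g" by (simp add: algebra_simps)
  then show ?thesis using that SAB(1) by blast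
qed

text \<open>A dependence would put both gradients on a line spanned by some \<open>m\<close>. Let L
  be a linear form through v, with S L = A f + B g and S(v) nonzero. Since L, f and g vanish at v,
  taking gradients there gives S(v) L = A(v) grad f + B(v) grad g, so L is a multiple of
  \<open>m\<close>. But the linear forms through v fill a plane.\<close>

lemma gradients_independent:
  assumes f: "mpoly_eval f v = 0" and g: "mpoly_eval g v = 0" and v: "v \<noteq> 0"
    and mult: "intersection_multiplicity f g (proj_point v) = 1"
    and nf: "has_gradient (mpoly_eval f) v nf" and ng: "has_gradient (mpoly_eval g) v ng"
    and dep: "a *s nf + b *s ng = 0"
  shows "a = 0 \<and> b = 0"
proof (rule ccontr)
  assume ab: "\<not> (a = 0 \<and> b = 0)"
  have "\<exists>m x y. nf = x *s m \<and> ng = y *s m"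
  proof (cases "a = 0")
    case True
    then have "ng = 0" using ab dep by simp
    then show ?thesis by (intro exI[of _ nf] exI[of _ 1] exI[of _ 0]) simp
  next
    case False
    have "a *s nf = - (b *s ng)" using dep by (simp add: eq_neg_iff_add_eq_0)
    then have "inverse a *s (a *s nf) = inverse a *s (- (b *s ng))" by simp
    then have "nf = (- b / a) *s ng" using False
      by (simp add: vector_smult_assoc Finite_Cartesian_Product.vec_eq_iff field_simps)
    then show ?thesis by (intro exI[of _ ng] exI[of _ "- b / a"] exI[of _ 1]) simp
  qed
  then obtain m x y where m: "nf = x *s m" "ng = y *s m" by blast
  have mult_m: "\<exists>c. n = c *s m" if n: "pairing n v = 0" for n
  proof -
    obtain S A B where SAB: "mpoly_eval S v \<noteq> 0" "S * linear_form n = A * f + B * g"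
      using linear_form_in_ideal_if_multiplicity_one[OF f g v mult n] by blast
    obtain nS nA nB where grads: "has_gradient (mpoly_eval S) v nS" "has_gradient (mpoly_eval A) v nA"
      "has_gradient (mpoly_eval B) v nB"
      using ex_has_gradient by metis
    have "has_gradient (mpoly_eval (S * linear_form n)) v (mpoly_eval S v *s n)"
      using has_gradient_mpoly_mult[OF grads(1) has_gradient_linear_form[of n v]] n
      by (simp add: mpoly_eval_linear_form)
    moreover have "has_gradient (mpoly_eval (A * f + B * g)) v (mpoly_eval A v *s nf + mpoly_eval B v *s ng)"
      using has_gradient_mpoly_add[OF has_gradient_mpoly_mult[OF grads(2) nf]
          has_gradient_mpoly_mult[OF grads(3) ng]] f g by simp
    ultimately have "mpoly_eval S v *s n = mpoly_eval A v *s nf + mpoly_eval B v *s ng"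
      using SAB(2) has_gradient_unique by metis
    also have "\<dots> = (mpoly_eval A v * x + mpoly_eval B v * y) *s m"
      unfolding m by (simp add: vector_smult_assoc vector_sadd_rdistrib)
    finally have "inverse (mpoly_eval S v) *s (mpoly_eval S v *s n)
        = inverse (mpoly_eval S v) *s ((mpoly_eval A v * x + mpoly_eval B v * y) *s m)" by simp
    then have "n = (inverse (mpoly_eval S v) * (mpoly_eval A v * x + mpoly_eval B v * y)) *s m"
      using SAB(1) by (simp add: vector_smult_assoc)
    then show ?thesis by blast
  qed
  obtain i where i: "v $ i \<noteq> 0" using v by (auto simp: Finite_Cartesian_Product.vec_eq_iff)
  obtain j k where jk: "j \<noteq> i" "k \<noteq> i" "j \<noteq> k" by (rule that[of "i + 1" "i + 2"]) simp_all
  \<comment> \<open>Two independent linear forms through \<open>v\<close>: their minor in the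
    columns j and k is the square of \<open>v $ i\<close>.\<close>
  define n1 where "n1 = v $ i *s axis j 1 - v $ j *s axis i 1"
  define n2 where "n2 = v $ i *s axis k 1 - v $ k *s axis i 1"
  have "pairing n1 v = 0" "pairing n2 v = 0"
    by (simp_all add: n1_def n2_def pairing_diff_left pairing_scale_left)
  then obtain c1 c2 where "n1 = c1 *s m" "n2 = c2 *s m" using mult_m by blast
  then have "n1 $ j * n2 $ k = n1 $ k * n2 $ j" by simp
  then show False using i jk by (simp add: n1_def n2_def axis_def)
qed

section \<open>Linear coordinates\<close>

text \<open>The determinant with columns in the order 1, 2, 3. In the type \<open>3\<close> the
  index 3 is 0, so this is a cyclic shift of 0, 1, 2 and the sign is the usual one.\<close>

definition det3 :: "complex ^ 3 \<Rightarrow> complex ^ 3 \<Rightarrow> complex ^ 3 \<Rightarrow> complex" where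
  "det3 a b c = a $ 1 * (b $ 2 * c $ 3 - b $ 3 * c $ 2) - a $ 2 * (b $ 1 * c $ 3 - b $ 3 * c $ 1)
     + a $ 3 * (b $ 1 * c $ 2 - b $ 2 * c $ 1)"

lemma vec3_eq_iff: "(v::complex ^ 3) = w \<longleftrightarrow> v $ 1 = w $ 1 \<and> v $ 2 = w $ 2 \<and> v $ 3 = w $ 3"
  by (simp add: Finite_Cartesian_Product.vec_eq_iff forall_3)

text \<open>Cramer's rule with the denominator multiplied out, hence a polynomial identity.\<close>

lemma cramer3:
  "det3 p q r *s w = det3 w q r *s p + det3 p w r *s q + det3 p q w *s r"
  by (simp add: vec3_eq_iff det3_def algebra_simps)

lemma ex_coordinates:
  assumes "det3 p q r \<noteq> 0"
  obtains a b c where "w = a *s p + b *s q + c *s r"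
proof
  have "w = inverse (det3 p q r) *s (det3 p q r *s w)"
    using assms by (simp add: vector_smult_assoc)
  also have "\<dots> = inverse (det3 p q r) *s (det3 w q r *s p + det3 p w r *s q + det3 p q w *s r)"
    by (rule arg_cong[OF cramer3])
  also have "\<dots> = (inverse (det3 p q r) * det3 w q r) *s p + (inverse (det3 p q r) * det3 p w r) *s q
      + (inverse (det3 p q r) * det3 p q w) *s r"
    by (simp only: vector_smult_assoc vector_add_ldistrib)
  finally show "w = (inverse (det3 p q r) * det3 w q r) *s p + (inverse (det3 p q r) * det3 p w r) *s q
      + (inverse (det3 p q r) * det3 p q w) *s r" .
qed

lemma coordinates_unique:
  assumes "det3 p q r \<noteq> 0" "a *s p + b *s q + c *s r = a' *s p + b' *s q + c' *s r"
  shows "a = a' \<and> b = b' \<and> c = c'"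
proof -
  have "det3 (a *s p + b *s q + c *s r) q r = a * det3 p q r"
    "det3 p (a *s p + b *s q + c *s r) r = b * det3 p q r"
    "det3 p q (a *s p + b *s q + c *s r) = c * det3 p q r" for a b c
    by (simp_all add: det3_def algebra_simps)
  then show ?thesis using assms by (metis mult_cancel_right)
qed

text \<open>As a function of the first argument the determinant is linear, and its coefficients are
  the components of the cross product of u and v. These all vanish only for proportional
  vectors.\<close>

lemma ex_det3_nonzero:
  assumes "u \<noteq> 0" "\<And>c. v \<noteq> c *s u"
  shows "\<exists>w. det3 w u v \<noteq> 0"
proof (rule ccontr)
  assume "\<not> (\<exists>w. det3 w u v \<noteq> 0)"
  then have z: "det3 w u v = 0" for w by blast
  from z[of "axis 1 1"] z[of "axis 2 1"] z[of "axis 3 1"]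
  have uv: "u $ 2 * v $ 3 = u $ 3 * v $ 2" "u $ 1 * v $ 3 = u $ 3 * v $ 1" "u $ 1 * v $ 2 = u $ 2 * v $ 1"
    by (simp_all add: det3_def axis_def)
  consider "u $ 1 \<noteq> 0" | "u $ 2 \<noteq> 0" | "u $ 3 \<noteq> 0"
    using assms(1) by (auto simp: vec3_eq_iff)
  then have "\<exists>k. u $ k \<noteq> 0 \<and> v = (v $ k / u $ k) *s u"
  proof cases
    case 1
    then show ?thesis using uv by (intro exI[of _ 1]) (simp add: vec3_eq_iff field_simps)
  next
    case 2
    then show ?thesis using uv by (intro exI[of _ 2]) (simp add: vec3_eq_iff field_simps)
  next
    case 3
    then show ?thesis using uv by (intro exI[of _ 3]) (simp add: vec3_eq_iff field_simps)
  qed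
  then show False using assms(2) by blast
qed

section \<open>Restriction of a form to an affine chart\<close>

text \<open>The form at x p + q + z r, that is, in the chart where the coordinate along q is 1. The
  outer variable is z, the one to be eliminated; x then parametrises the lines through r.\<close>

definition chart_poly :: "mpoly3 \<Rightarrow> complex ^ 3 \<Rightarrow> complex ^ 3 \<Rightarrow> complex ^ 3 \<Rightarrow> complex poly poly" where
  "chart_poly f p q r = (\<Sum>m\<in>Poly_Mapping.keys f.
     [:[:Poly_Mapping.lookup f m:]:] *
     (\<Prod>i\<in>UNIV. [:[:q $ i, p $ i:], [:r $ i:]:] ^ Poly_Mapping.lookup m i))"

lemma poly_chart_poly:
  "poly (poly (chart_poly f p q r) [:z:]) x = mpoly_eval f (x *s p + q + z *s r)"
  by (simp add: chart_poly_def poly_sum poly_prod mpoly_eval_def algebra_simps)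

abbreviation specialize :: "complex \<Rightarrow> complex poly poly \<Rightarrow> complex poly" where
  "specialize x F \<equiv> map_poly (\<lambda>p. poly p x) F"

lemma poly_specialize: "poly (specialize x F) z = poly (poly F [:z:]) x"
  using poly_hom.poly_map_poly[of x F "[:z:]"] by simp

lemma poly_specialize_chart_poly:
  "poly (specialize x (chart_poly f p q r)) z = mpoly_eval f (x *s p + q + z *s r)"
  by (simp add: poly_specialize poly_chart_poly)

text \<open>Leading terms are tracked with upper bounds for the degrees, because the linear factors
  of a chart polynomial may have a vanishing z-coefficient.\<close>

lemma top_coeff_mult:
  fixes p q :: "'a::comm_ring_1 poly"
  assumes "degree p \<le> a" "degree q \<le> b"
  shows "degree (p * q) \<le> a + b \<and> coeff (p * q) (a + b) = coeff p a * coeff q b"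
proof
  show "degree (p * q) \<le> a + b" using degree_mult_le[of p q] assms by linarith
  have "coeff (p * q) (a + b) = (\<Sum>i\<le>a + b. if i = a then coeff p a * coeff q b else 0)"
    unfolding coeff_mult
  proof (rule sum.cong)
    fix i assume "i \<in> {..a + b}"
    then consider "i = a" | "i > a" | "a + b - i > b" by fastforce
    then show "coeff p i * coeff q (a + b - i) = (if i = a then coeff p a * coeff q b else 0)"
      using assms by cases (auto simp: coeff_eq_0)
  qed simp
  then show "coeff (p * q) (a + b) = coeff p a * coeff q b" by simp
qed

lemma top_coeff_power:
  fixes p :: "'a::comm_ring_1 poly"
  assumes "degree p \<le> 1"
  shows "degree (p ^ n) \<le> n \<and> coeff (p ^ n) n = coeff p 1 ^ n"
proof (induction n)
  case (Suc n)
  then show ?case using top_coeff_mult[OF assms, of "p ^ n" n] by simp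
qed simp

lemma top_coeff_prod:
  fixes l :: "'b \<Rightarrow> 'a::comm_ring_1 poly"
  assumes "finite I" "\<And>i. degree (l i) \<le> 1"
  shows "degree (\<Prod>i\<in>I. l i ^ n i) \<le> (\<Sum>i\<in>I. n i) \<and>
    coeff (\<Prod>i\<in>I. l i ^ n i) (\<Sum>i\<in>I. n i) = (\<Prod>i\<in>I. coeff (l i) 1 ^ n i)"
  using assms(1)
proof (induction I)
  case (insert j I)
  then show ?case
    using top_coeff_mult[of "l j ^ n j" "n j" "\<Prod>i\<in>I. l i ^ n i" "\<Sum>i\<in>I. n i"]
      top_coeff_power[OF assms(2), of j "n j"] by simp
qed simp

text \<open>In each monomial the coefficient of z^d is the product of the z-coefficients of the
  linear factors, which are the coordinates of r; summed up, this is f(r).\<close>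

lemma chart_poly_top_coeff:
  assumes "homogeneous d f"
  shows "degree (chart_poly f p q r) \<le> d" "coeff (chart_poly f p q r) d = [:mpoly_eval f r:]"
proof -
  have sum: "(\<Sum>i\<in>UNIV. Poly_Mapping.lookup m i) = d" if "m \<in> Poly_Mapping.keys f" for m
    using assms that by (simp add: homogeneous_def)
  note top = top_coeff_prod[of UNIV "\<lambda>i. [:[:q $ i, p $ i:], [:r $ i:]:]" "Poly_Mapping.lookup m" for m]
  show "degree (chart_poly f p q r) \<le> d"
    unfolding chart_poly_def
  proof (rule degree_sum_le)
    fix m assume "m \<in> Poly_Mapping.keys f"
    then have "degree (\<Prod>i\<in>UNIV. [:[:q $ i, p $ i:], [:r $ i:]:] ^ Poly_Mapping.lookup m i) \<le> d"
      using top[of m] sum by simp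
    then show "degree ([:[:Poly_Mapping.lookup f m:]:] *
        (\<Prod>i\<in>UNIV. [:[:q $ i, p $ i:], [:r $ i:]:] ^ Poly_Mapping.lookup m i)) \<le> d"
      by (simp add: degree_smult_le order_trans)
  qed simp
  have "poly (coeff (chart_poly f p q r) d) x = mpoly_eval f r" for x
  proof -
    have "coeff (\<Prod>i\<in>UNIV. [:[:q $ i, p $ i:], [:r $ i:]:] ^ Poly_Mapping.lookup m i) d
        = (\<Prod>i\<in>UNIV. [:r $ i:] ^ Poly_Mapping.lookup m i)"
      if "m \<in> Poly_Mapping.keys f" for m
      using top[of m] sum[OF that] by simp
    then show ?thesis
      by (simp add: chart_poly_def coeff_sum poly_sum poly_prod mpoly_eval_def)
  qed
  then show "coeff (chart_poly f p q r) d = [:mpoly_eval f r:]"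
    by (intro poly_eq_poly_eq_iff[THEN iffD1] ext) simp
qed

text \<open>If the centre r lies off the curve, the leading coefficient is a nonzero constant, so
  specialising x never lowers the degree. This is what lets the resultant commute with
  specialisation.\<close>

lemma degree_chart_poly:
  assumes "homogeneous d f" "mpoly_eval f r \<noteq> 0"
  shows "degree (chart_poly f p q r) = d" "degree (specialize x (chart_poly f p q r)) = d"
    "specialize x (chart_poly f p q r) \<noteq> 0"
    "lead_coeff (chart_poly f p q r) = [:mpoly_eval f r:]"
proof -
  show deg: "degree (chart_poly f p q r) = d"
    using chart_poly_top_coeff[OF assms(1), of p q r] assms(2)
    by (intro antisym le_degree) auto
  then show "lead_coeff (chart_poly f p q r) = [:mpoly_eval f r:]"
    using chart_poly_top_coeff(2)[OF assms(1)] by simp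
  have c: "coeff (specialize x (chart_poly f p q r)) d = mpoly_eval f r"
    using chart_poly_top_coeff(2)[OF assms(1), of p q r] by (simp add: coeff_map_poly)
  then show "specialize x (chart_poly f p q r) \<noteq> 0" using assms(2) by (metis coeff_0)
  show "degree (specialize x (chart_poly f p q r)) = d"
    using degree_map_poly_le[of "\<lambda>p. poly p x" "chart_poly f p q r"] deg c assms(2)
    by (intro antisym le_degree) auto
qed

text \<open>By homogeneity, the form at t p + q + z r is t^d times the form at q / t + p + (z / t)
  r. Thus passing from the chart of q to the chart of p inverts the parameter and weights the
  coefficients as in \<open>resultant_scale\<close>.\<close>

lemma coeff_chart_poly_inverse:
  assumes f: "homogeneous d f" and t: "t \<noteq> 0" and k: "k \<le> d"
  shows "coeff (specialize t (chart_poly f p q r)) k =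
    t ^ (d - k) * coeff (specialize (inverse t) (chart_poly f q p r)) k"
proof -
  have "specialize t (chart_poly f p q r)
      = smult (t ^ d) (pcompose (specialize (inverse t) (chart_poly f q p r)) [:0, inverse t:])"
  proof (rule poly_eq_poly_eq_iff[THEN iffD1], rule ext)
    fix z
    have "t *s p + q + z *s r = t *s (inverse t *s q + p + (inverse t * z) *s r)"
      using t by (simp add: vector_add_ldistrib vector_smult_assoc mult.assoc[symmetric] add.commute)
    then show "poly (specialize t (chart_poly f p q r)) z
      = poly (smult (t ^ d) (pcompose (specialize (inverse t) (chart_poly f q p r)) [:0, inverse t:])) z"
      using mpoly_eval_scale[OF f]
      by (simp add: poly_specialize_chart_poly poly_pcompose mult.commute)
  qed
  then have "coeff (specialize t (chart_poly f p q r)) k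
      = t ^ d * (inverse t ^ k * coeff (specialize (inverse t) (chart_poly f q p r)) k)"
    by (simp add: coeff_pcompose_linear)
  also have "t ^ d = t ^ (d - k) * t ^ k" using k by (simp add: power_add[symmetric])
  finally show ?thesis using t by (simp add: power_inverse field_simps)
qed

lemma pderiv_chart_poly:
  assumes "has_gradient (mpoly_eval f) (x0 *s p + q + z0 *s r) n"
  shows "poly (pderiv (poly (chart_poly f p q r) [:z0:])) x0 = pairing n p"
    and "poly (pderiv (specialize x0 (chart_poly f p q r))) z0 = pairing n r"
proof -
  have eq: "x0 *s p + q + z0 *s r + t *s p = (t + x0) *s p + q + z0 *s r"
    "x0 *s p + q + z0 *s r + t *s r = x0 *s p + q + (t + z0) *s r" for t
    by (simp_all add: vector_sadd_rdistrib algebra_simps)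
  have "((\<lambda>t. poly (poly (chart_poly f p q r) [:z0:]) (t + x0)) has_field_derivative pairing n p) (at 0)"
    using assms[unfolded has_gradient_def, rule_format, of p] by (simp only: eq poly_chart_poly)
  then have "((\<lambda>t. poly (poly (chart_poly f p q r) [:z0:]) t) has_field_derivative pairing n p) (at x0)"
    
    using iffD2[OF DERIV_shift[of "poly (poly (chart_poly f p q r) [:z0:])" _ 0 x0]] by simp
  then show "poly (pderiv (poly (chart_poly f p q r) [:z0:])) x0 = pairing n p"
    by (rule DERIV_unique[OF poly_DERIV])
  have "((\<lambda>t. poly (specialize x0 (chart_poly f p q r)) (t + z0)) has_field_derivative pairing n r) (at 0)"
    using assms[unfolded has_gradient_def, rule_format, of r] by (simp only: eq poly_specialize_chart_poly)
  then have "((\<lambda>t. poly (specialize x0 (chart_poly f p q r)) t) has_field_derivative pairing n r) (at z0)"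
    
    using iffD2[OF DERIV_shift[of "poly (specialize x0 (chart_poly f p q r))" _ 0 z0]] by simp
  then show "poly (pderiv (specialize x0 (chart_poly f p q r))) z0 = pairing n r"
    by (rule DERIV_unique[OF poly_DERIV])
qed

section \<open>The resultant of two transverse curves\<close>

text \<open>Stated for all gradient vectors instead of a chosen one; \<open>ex_has_gradient\<close>
  and \<open>has_gradient_unique\<close> make this harmless. It is the form in which transversality
  is used from here on.\<close>

definition independent_gradients :: "mpoly3 \<Rightarrow> mpoly3 \<Rightarrow> bool" where
  "independent_gradients f g \<longleftrightarrow> (\<forall>v nf ng a b. v \<noteq> 0 \<longrightarrow> mpoly_eval f v = 0 \<longrightarrow> mpoly_eval g v = 0 \<longrightarrow>
     has_gradient (mpoly_eval f) v nf \<longrightarrow> has_gradient (mpoly_eval g) v ng \<longrightarrow>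
     a *s nf + b *s ng = 0 \<longrightarrow> a = 0 \<and> b = 0)"

lemma transverse_imp_independent_gradients:
  assumes "homogeneous d f" "homogeneous e g" "transverse f g"
  shows "independent_gradients f g"
  unfolding independent_gradients_def
proof (intro allI impI)
  fix v nf ng a b
  assume *: "v \<noteq> 0" "mpoly_eval f v = 0" "mpoly_eval g v = 0"
    "has_gradient (mpoly_eval f) v nf" "has_gradient (mpoly_eval g) v ng" "a *s nf + b *s ng = 0"
  then have "proj_point v \<in> zero_locus f \<inter> zero_locus g"
    using assms by (simp add: proj_point_in_zero_locus)
  then have "intersection_multiplicity f g (proj_point v) = 1"
    using assms(3) unfolding transverse_def by blast
  with * show "a = 0 \<and> b = 0" using gradients_independent[of f v g nf ng a b] by blast
qed

text \<open>If the minor in the directions p and r vanished, a nontrivial combination of the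
  gradients would annihilate p and r. By Euler's identity it annihilates the point itself, hence q,
  hence everything, against independence.\<close>

lemma jacobian_nonzero:
  assumes f: "homogeneous d f" and g: "homogeneous e g" and ind: "independent_gradients f g"
    and det: "det3 p q r \<noteq> 0"
    and zero: "mpoly_eval f (x *s p + q + z *s r) = 0" "mpoly_eval g (x *s p + q + z *s r) = 0"
    and nf: "has_gradient (mpoly_eval f) (x *s p + q + z *s r) nf"
    and ng: "has_gradient (mpoly_eval g) (x *s p + q + z *s r) ng"
  shows "pairing nf p * pairing ng r \<noteq> pairing nf r * pairing ng p"
proof
  assume eq: "pairing nf p * pairing ng r = pairing nf r * pairing ng p"
  define v where "v = x *s p + q + z *s r"
  obtain a b where ab: "a \<noteq> 0 \<or> b \<noteq> 0" "a * pairing nf p + b * pairing ng p = 0"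
    "a * pairing nf r + b * pairing ng r = 0"
  proof (cases "pairing ng p = 0 \<and> pairing nf p = 0")
    case False
    then show ?thesis using eq by (intro that[of "pairing ng p" "- pairing nf p"]) (auto simp: algebra_simps)
  next
    case p0: True
    show ?thesis
    proof (cases "pairing ng r = 0 \<and> pairing nf r = 0")
      case False
      then show ?thesis using p0 by (intro that[of "pairing ng r" "- pairing nf r"]) (auto simp: algebra_simps)
    next
      case True
      then show ?thesis using p0 by (intro that[of 1 0]) auto
    qed
  qed
  define n where "n = a *s nf + b *s ng"
  have n: "pairing n w = a * pairing nf w + b * pairing ng w" for w
    by (simp add: n_def pairing_add_left pairing_scale_left)
  have np: "pairing n p = 0" and nr: "pairing n r = 0" using ab n by auto
  have "pairing n v = 0"
    using euler_identity[OF f nf] euler_identity[OF g ng] zero by (simp add: n v_def)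
  then have nq: "pairing n q = 0"
    using np nr by (simp add: v_def pairing_add_right pairing_scale_right)
  have "pairing n w = 0" for w
  proof -
    obtain a b c where "w = a *s p + b *s q + c *s r" using ex_coordinates[OF det] by blast
    then show ?thesis using np nq nr by (simp add: pairing_add_right pairing_scale_right)
  qed
  then have "n $ i = 0" for i by (metis pairing_axis)
  then have "n = 0" by (simp add: Finite_Cartesian_Product.vec_eq_iff)
  moreover have "v \<noteq> 0"
  proof
    assume "v = 0"
    moreover have "det3 p v r = det3 p q r" by (simp add: v_def det3_def algebra_simps)
    ultimately show False using det by (simp add: det3_def)
  qed
  ultimately show False
    using ind[unfolded independent_gradients_def, rule_format, of v nf ng a b] zero nf ng ab(1)
    unfolding n_def v_def by blast
qed

lemma jacobian_chart_poly_nonzero: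
  assumes "homogeneous d f" "homogeneous e g" "independent_gradients f g" "det3 p q r \<noteq> 0"
    and "mpoly_eval f (x *s p + q + z *s r) = 0" "mpoly_eval g (x *s p + q + z *s r) = 0"
  shows "poly (pderiv (poly (chart_poly f p q r) [:z:])) x * poly (pderiv (specialize x (chart_poly g p q r))) z
    \<noteq> poly (pderiv (specialize x (chart_poly f p q r))) z * poly (pderiv (poly (chart_poly g p q r) [:z:])) x"
proof -
  obtain nf ng where "has_gradient (mpoly_eval f) (x *s p + q + z *s r) nf"
    "has_gradient (mpoly_eval g) (x *s p + q + z *s r) ng"
    using ex_has_gradient by metis
  from jacobian_nonzero[OF assms this] pderiv_chart_poly[OF this(1)] pderiv_chart_poly[OF this(2)]
  show ?thesis by simp
qed

lemma common_root_iff_resultant_0: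
  fixes p q :: "complex poly"
  assumes "p \<noteq> 0"
  shows "resultant p q = 0 \<longleftrightarrow> (\<exists>z. poly p z = 0 \<and> poly q z = 0)"
proof
  assume "resultant p q = 0"
  then have "degree (gcd p q) \<noteq> 0" by (simp add: resultant_0_gcd)
  then obtain z where "poly (gcd p q) z = 0"
    using fundamental_theorem_of_algebra_alt[of "gcd p q"] by (metis degree_pCons_0)
  then show "\<exists>z. poly p z = 0 \<and> poly q z = 0"
    by (metis gcd_dvd1 gcd_dvd2 poly_eq_0_iff_dvd dvd_trans)
next
  assume "\<exists>z. poly p z = 0 \<and> poly q z = 0"
  then obtain z where "[:-z, 1:] dvd gcd p q" by (auto simp: poly_eq_0_iff_dvd)
  moreover have "gcd p q \<noteq> 0" using assms by simp
  ultimately have "degree [:-z, 1:] \<le> degree (gcd p q)" by (rule dvd_imp_degree_le)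
  then show "resultant p q = 0" by (simp add: resultant_0_gcd)
qed

text \<open>A basis p, q, r for projecting from the centre r, which lies off both curves. The line
  spanned by p and r is the line at infinity of the chart.\<close>

locale transverse_chart =
  fixes f g :: mpoly3 and d e :: nat and p q r :: "complex ^ 3"
  assumes f: "homogeneous d f" and g: "homogeneous e g"
    and ind: "independent_gradients f g"
    and det: "det3 p q r \<noteq> 0"
    and fr: "mpoly_eval f r \<noteq> 0" and gr: "mpoly_eval g r \<noteq> 0"
begin

abbreviation "F \<equiv> chart_poly f p q r"
abbreviation "G \<equiv> chart_poly g p q r"

definition zeros :: "(complex \<times> complex) set" where
  "zeros = {(x, z). mpoly_eval f (x *s p + q + z *s r) = 0 \<and> mpoly_eval g (x *s p + q + z *s r) = 0}"

lemma poly_resultant: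
  "poly (resultant F G) x = resultant (specialize x F) (specialize x G)"
proof -
  have hom: "comm_ring_hom (\<lambda>p::complex poly. poly p x)" by unfold_locales auto
  show ?thesis
    using comm_ring_hom.resultant_map_poly[OF hom, of F G] degree_chart_poly[OF f fr] degree_chart_poly[OF g gr]
    by simp
qed

lemma resultant_root_iff: "poly (resultant F G) x = 0 \<longleftrightarrow> (\<exists>z. (x, z) \<in> zeros)"
  using common_root_iff_resultant_0[OF degree_chart_poly(3)[OF f fr], of x p q "specialize x G"]
  by (simp add: poly_resultant zeros_def poly_specialize_chart_poly)

text \<open>A common factor of the two curves would make the Jacobian vanish along its zeros.\<close>

lemma resultant_nonzero: "resultant F G \<noteq> 0"
proof
  assume "resultant F G = 0"
  then have deg: "degree (gcd F G) \<noteq> 0" by (simp add: resultant_0_gcd)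
  define H where "H = gcd F G"
  obtain F' where F': "F = H * F'" unfolding H_def by (meson dvdE gcd_dvd1)
  obtain G' where G': "G = H * G'" unfolding H_def by (meson dvdE gcd_dvd2)
  \<comment> \<open>The leading coefficient of the common factor divides the nonzero constant f(r),
    so \<open>H\<close> keeps its positive degree when x is set to 0 and has a root there.\<close>
  have "lead_coeff H * lead_coeff F' = [:mpoly_eval f r:]"
    using degree_chart_poly(4)[OF f fr, of p q] lead_coeff_mult[of H F'] by (simp only: F'[symmetric])
  then have "poly (lead_coeff H) 0 * poly (lead_coeff F') 0 = mpoly_eval f r"
    by (metis poly_mult poly_const_conv poly_pCons mult_zero_left add.right_neutral poly_0)
  then have "poly (lead_coeff H) 0 \<noteq> 0" using fr by auto
  then have "coeff (specialize 0 H) (degree H) \<noteq> 0" by (simp add: coeff_map_poly)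
  then have "degree H \<le> degree (specialize 0 H)" by (rule le_degree)
  then have "degree (specialize 0 H) \<noteq> 0" using deg by (simp add: H_def)
  then obtain z where z: "poly (specialize 0 H) z = 0"
    using fundamental_theorem_of_algebra_alt[of "specialize 0 H"] by (metis degree_pCons_0)
  then have Hz: "poly (poly H [:z:]) 0 = 0" by (simp add: poly_specialize)
  have zero: "mpoly_eval f (0 *s p + q + z *s r) = 0" "mpoly_eval g (0 *s p + q + z *s r) = 0"
    using Hz F' G' poly_chart_poly[of f p q r z 0] poly_chart_poly[of g p q r z 0] by simp_all
  show False
    using jacobian_chart_poly_nonzero[OF f g ind det zero] z Hz
    unfolding F' G' map_poly_eval_mult by (simp add: pderiv_mult poly_specialize)
qed

lemma finite_zeros: "finite zeros"
proof -
  have "finite {x. poly (resultant F G) x = 0}" using resultant_nonzero by (rule poly_roots_finite)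
  moreover have "finite {z. poly (specialize x F) z = 0}" for x
    using degree_chart_poly(3)[OF f fr] by (rule poly_roots_finite)
  ultimately have "finite (SIGMA x:{x. poly (resultant F G) x = 0}. {z. poly (specialize x F) z = 0})"
    by (rule finite_SigmaI)
  moreover have "zeros \<subseteq> (SIGMA x:{x. poly (resultant F G) x = 0}. {z. poly (specialize x F) z = 0})"
    using resultant_root_iff by (auto simp: zeros_def poly_specialize_chart_poly)
  ultimately show ?thesis by (rule rev_finite_subset)
qed

text \<open>Exchanging p and q replaces x by its inverse, and \<open>resultant_scale\<close> turns
  this into a reversal of the resultant with respect to \<open>d * e\<close>. The value at 0 of the
  exchanged resultant belongs to the line at infinity and is nonzero since there is no common zero
  on it.\<close>

lemma degree_resultant:
  assumes "\<And>z. mpoly_eval f (p + z *s r) = 0 \<Longrightarrow> mpoly_eval g (p + z *s r) \<noteq> 0"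
  shows "degree (resultant F G) = d * e"
proof (rule degree_eq_if_reversed)
  let ?F = "chart_poly f q p r" and ?G = "chart_poly g q p r"
  have hom: "comm_ring_hom (\<lambda>p::complex poly. poly p x)" for x by unfold_locales auto
  have rev: "poly (resultant ?F ?G) x = resultant (specialize x ?F) (specialize x ?G)" for x
    using comm_ring_hom.resultant_map_poly[OF hom, of x ?F ?G] degree_chart_poly[OF f fr] degree_chart_poly[OF g gr]
    by simp
  show "poly (resultant F G) t = t ^ (d * e) * poly (resultant ?F ?G) (inverse t)" if "t \<noteq> 0" for t
    unfolding poly_resultant rev
    using resultant_scale[of "specialize t F" "specialize (inverse t) ?F" "specialize t G" "specialize (inverse t) ?G" t]
      coeff_chart_poly_inverse[OF f that] coeff_chart_poly_inverse[OF g that] that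
    by (simp add: degree_chart_poly[OF f fr] degree_chart_poly[OF g gr])
  show "poly (resultant ?F ?G) 0 \<noteq> 0"
    unfolding rev using common_root_iff_resultant_0[OF degree_chart_poly(3)[OF f fr], of 0 q p "specialize 0 ?G"] assms
    by (auto simp: poly_specialize_chart_poly)
qed

text \<open>No common zero is lost at infinity by \<open>line\<close>, and none is hidden behind
  another as seen from r by \<open>unique\<close>. So the common zeros correspond to the roots of
  the resultant, which are simple by the Jacobian and therefore as many as its degree.\<close>

lemma card_zeros:
  assumes line: "\<And>z. mpoly_eval f (p + z *s r) = 0 \<Longrightarrow> mpoly_eval g (p + z *s r) \<noteq> 0"
    and unique: "\<And>x z z'. (x, z) \<in> zeros \<Longrightarrow> (x, z') \<in> zeros \<Longrightarrow> z = z'"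
  shows "card zeros = d * e"
proof -
  have simple: "poly (pderiv (resultant F G)) x \<noteq> 0" if root: "poly (resultant F G) x = 0" for x
  proof -
    obtain z where z: "(x, z) \<in> zeros" using root resultant_root_iff by blast
    show ?thesis
    proof (rule resultant_simple_root)
      show "degree (specialize x F) = degree F" "degree (specialize x G) = degree G"
        by (simp_all add: degree_chart_poly[OF f fr] degree_chart_poly[OF g gr])
      show "specialize x F \<noteq> 0" "specialize x G \<noteq> 0"
        using degree_chart_poly(3)[OF f fr] degree_chart_poly(3)[OF g gr] by auto
      show "poly (specialize x F) z = 0" "poly (specialize x G) z = 0"
        using z by (auto simp: zeros_def poly_specialize_chart_poly)
      show "z' = z" if "poly (specialize x F) z' = 0" "poly (specialize x G) z' = 0" for z'
        using that unique[OF z, of z'] by (auto simp: zeros_def poly_specialize_chart_poly)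
      show "poly (pderiv (poly F [:z:])) x * poly (pderiv (specialize x G)) z
        \<noteq> poly (pderiv (specialize x F)) z * poly (pderiv (poly G [:z:])) x"
        using z by (intro jacobian_chart_poly_nonzero[OF f g ind det]) (auto simp: zeros_def)
    qed
  qed
  have "card zeros = card (fst ` zeros)"
    using unique by (intro card_image[symmetric]) (auto simp: inj_on_def)
  also have "fst ` zeros = {x. poly (resultant F G) x = 0}"
    unfolding resultant_root_iff by force
  also have "card \<dots> = d * e"
    using card_roots_if_all_simple[OF simple] degree_resultant[OF line] by simp
  finally show ?thesis .
qed

lemma inj_on_zeros: "inj_on (\<lambda>(x, z). proj_point (x *s p + q + z *s r)) A"
proof (rule inj_onI, clarify)
  fix x z x' z' assume "proj_point (x *s p + q + z *s r) = proj_point (x' *s p + q + z' *s r)"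
  then obtain c where "x' *s p + q + z' *s r = c *s (x *s p + q + z *s r)"
    by (auto simp: proj_point_eq_iff)
  then have "x' *s p + 1 *s q + z' *s r = (c * x) *s p + c *s q + (c * z) *s r"
    by (simp add: vector_add_ldistrib vector_smult_assoc)
  from coordinates_unique[OF det this] show "x = x' \<and> z = z'" by simp
qed

lemma chart_point_nonzero: "x *s p + q + z *s r \<noteq> 0"
proof
  assume "x *s p + q + z *s r = 0"
  then have "x *s p + 1 *s q + z *s r = 0 *s p + 0 *s q + 0 *s r" by simp
  from coordinates_unique[OF det this] show False by simp
qed

lemma zero_locus_cases:
  assumes "P \<in> zero_locus f \<inter> zero_locus g"
  obtains x z where "(x, z) \<in> zeros" "P = proj_point (x *s p + q + z *s r)"
  | z where "mpoly_eval f (p + z *s r) = 0" "mpoly_eval g (p + z *s r) = 0" "P = proj_point (p + z *s r)"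
proof -
  obtain w where w: "w \<noteq> 0" "P = proj_point w" using assms proj_planeE by (auto simp: zero_locus_def)
  have w0: "mpoly_eval f w = 0" "mpoly_eval g w = 0"
    using assms proj_point_in_zero_locus[OF f w(1)] proj_point_in_zero_locus[OF g w(1)] w(2) by auto
  obtain a b c where abc: "w = a *s p + b *s q + c *s r" using ex_coordinates[OF det] by blast
  have scale: "mpoly_eval f (k *s w) = 0" "mpoly_eval g (k *s w) = 0" for k
    using w0 mpoly_eval_scale[OF f] mpoly_eval_scale[OF g] by auto
  show thesis
  proof (cases "b = 0")
    case False
    have "(1 / b) *s w = (a / b) *s p + q + (c / b) *s r"
      using False by (simp add: abc vector_add_ldistrib vector_smult_assoc)
    moreover from this have "(a / b, c / b) \<in> zeros" using scale[of "1 / b"] by (simp add: zeros_def)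
    moreover have "P = proj_point ((1 / b) *s w)" using False w(2) by (simp add: proj_point_scale)
    ultimately show ?thesis using that(1) by simp
  next
    case b: True
    show ?thesis
    proof (cases "a = 0")
      case True
      \<comment> \<open>The remaining point of the line at infinity is the centre r, which is not on
        the curve of \<open>f\<close>.\<close>
      then have "c \<noteq> 0" using w b abc by auto
      then have "r = (1 / c) *s w" using True b by (simp add: abc vector_smult_assoc)
      then show ?thesis using scale fr by metis
    next
      case False
      then have "(1 / a) *s w = p + (c / a) *s r"
        using b by (simp add: abc vector_add_ldistrib vector_smult_assoc)
      moreover have "P = proj_point ((1 / a) *s w)" using False w(2) by (simp add: proj_point_scale)
      ultimately show ?thesis using that(2) scale by metis
    qed
  qed
qed

text \<open>Holds in every such chart, before any condition on the position of the common zeros; it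
  makes the later choice of generic coordinates a matter of finitely many conditions.\<close>

lemma finite_intersection: "finite (zero_locus f \<inter> zero_locus g)"
proof -
  have "finite {z. poly (specialize 0 (chart_poly f q p r)) z = 0}"
    using degree_chart_poly(3)[OF f fr] by (rule poly_roots_finite)
  then have "finite ((\<lambda>(x, z). proj_point (x *s p + q + z *s r)) ` zeros
      \<union> (\<lambda>z. proj_point (p + z *s r)) ` {z. poly (specialize 0 (chart_poly f q p r)) z = 0})"
    using finite_zeros by simp
  moreover have "zero_locus f \<inter> zero_locus g \<subseteq> (\<lambda>(x, z). proj_point (x *s p + q + z *s r)) ` zeros
      \<union> (\<lambda>z. proj_point (p + z *s r)) ` {z. poly (specialize 0 (chart_poly f q p r)) z = 0}"
  proof
    fix P assume "P \<in> zero_locus f \<inter> zero_locus g"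
    then show "P \<in> (\<lambda>(x, z). proj_point (x *s p + q + z *s r)) ` zeros
      \<union> (\<lambda>z. proj_point (p + z *s r)) ` {z. poly (specialize 0 (chart_poly f q p r)) z = 0}"
      by (cases rule: zero_locus_cases) (force simp: poly_specialize_chart_poly)+
  qed
  ultimately show ?thesis by (rule rev_finite_subset)
qed

lemma card_intersection:
  assumes line: "\<And>z. mpoly_eval f (p + z *s r) = 0 \<Longrightarrow> mpoly_eval g (p + z *s r) \<noteq> 0"
    and unique: "\<And>x z z'. (x, z) \<in> zeros \<Longrightarrow> (x, z') \<in> zeros \<Longrightarrow> z = z'"
  shows "card (zero_locus f \<inter> zero_locus g) = d * e"
proof -
  have "zero_locus f \<inter> zero_locus g = (\<lambda>(x, z). proj_point (x *s p + q + z *s r)) ` zeros"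
  proof (intro equalityI subsetI)
    fix P assume "P \<in> zero_locus f \<inter> zero_locus g"
    then show "P \<in> (\<lambda>(x, z). proj_point (x *s p + q + z *s r)) ` zeros"
      using line by (cases rule: zero_locus_cases) (force, blast)
  next
    fix P assume "P \<in> (\<lambda>(x, z). proj_point (x *s p + q + z *s r)) ` zeros"
    then show "P \<in> zero_locus f \<inter> zero_locus g"
      using proj_point_in_zero_locus[OF f chart_point_nonzero] proj_point_in_zero_locus[OF g chart_point_nonzero]
      by (auto simp: zeros_def)
  qed
  then show ?thesis using card_image[OF inj_on_zeros] card_zeros[OF assms] by simp
qed

end

section \<open>Generic coordinates\<close>

lemma digits_unique:
  fixes B :: nat
  assumes "a0 < B" "a1 < B" "b0 < B" "b1 < B"
    and "a0 + B * (a1 + B * a2) = b0 + B * (b1 + B * b2)"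
  shows "a0 = b0 \<and> a1 = b1 \<and> a2 = b2"
proof -
  have "B > 0" using assms(1) by simp
  have "a0 = (a0 + B * (a1 + B * a2)) mod B" using assms(1) by simp
  also have "\<dots> = b0" unfolding assms(5) using assms(3) by simp
  finally have 0: "a0 = b0" .
  then have eq: "a1 + B * a2 = b1 + B * b2" using assms(5) \<open>B > 0\<close> by simp
  have "a1 = (a1 + B * a2) mod B" using assms(2) by simp
  also have "\<dots> = b1" unfolding eq using assms(4) by simp
  finally have 1: "a1 = b1" .
  then have "a2 = b2" using eq \<open>B > 0\<close> by simp
  with 0 1 show ?thesis by blast
qed

text \<open>Kronecker substitution: the monomials in the powers of a single variable to the exponents
  1, \<open>B\<close>, \<open>B\<^sup>2\<close> are distinct as soon as \<open>B\<close> exceeds all exponents.\<close>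

lemma ex_mpoly_eval_nonzero:
  assumes "f \<noteq> 0"
  shows "\<exists>v. mpoly_eval f v \<noteq> 0"
proof -
  let ?K = "Poly_Mapping.keys f"
  define B where "B = Suc (Max ((\<lambda>(m, i). Poly_Mapping.lookup m i) ` (?K \<times> (UNIV :: 3 set))))"
  have B: "Poly_Mapping.lookup m i < B" if "m \<in> ?K" for m i
    unfolding B_def less_Suc_eq_le
    by (rule Max_ge[OF _ image_eqI[of _ _ "(m, i)"]]) (use that in simp_all)
  define \<kappa> where "\<kappa> m = Poly_Mapping.lookup m 1 + B * (Poly_Mapping.lookup m 2 + B * Poly_Mapping.lookup m (3::3))" for m
  have inj: "m = m'" if "m \<in> ?K" "m' \<in> ?K" "\<kappa> m = \<kappa> m'" for m m'
  proof (rule poly_mapping_eqI)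
    fix i :: 3
    have "Poly_Mapping.lookup m 1 = Poly_Mapping.lookup m' 1 \<and>
        Poly_Mapping.lookup m 2 = Poly_Mapping.lookup m' 2 \<and> Poly_Mapping.lookup m 3 = Poly_Mapping.lookup m' 3"
      using that(3) unfolding \<kappa>_def
      by (rule digits_unique[OF B[OF that(1)] B[OF that(1)] B[OF that(2)] B[OF that(2)]])
    then show "Poly_Mapping.lookup m i = Poly_Mapping.lookup m' i" using exhaust_3[of i] by auto
  qed
  define P where "P = (\<Sum>m\<in>?K. monom (Poly_Mapping.lookup f m) (\<kappa> m))"
  have "?K \<noteq> {}"
  proof
    assume "?K = {}"
    then have "f = 0" by (intro poly_mapping_eqI) (metis empty_iff in_keys_iff lookup_zero)
    with assms show False by blast
  qed
  then obtain m0 where m0: "m0 \<in> ?K" by blast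
  have "coeff P (\<kappa> m0) = (\<Sum>m\<in>?K. if m = m0 then Poly_Mapping.lookup f m0 else 0)"
    unfolding P_def coeff_sum
  proof (rule sum.cong)
    fix m assume "m \<in> ?K"
    then have "\<kappa> m = \<kappa> m0 \<longleftrightarrow> m = m0" using inj[OF _ m0] by blast
    then show "coeff (monom (Poly_Mapping.lookup f m) (\<kappa> m)) (\<kappa> m0)
        = (if m = m0 then Poly_Mapping.lookup f m0 else 0)" by simp
  qed simp
  then have "coeff P (\<kappa> m0) \<noteq> 0" using m0 by (simp add: in_keys_iff)
  then have "P \<noteq> 0" by auto
  then obtain t where t: "poly P t \<noteq> 0" using poly_all_0_iff_0[of P] by blast
  define v :: "complex ^ 3" where "v = (\<chi> i. if i = 1 then t else if i = 2 then t ^ B else t ^ (B * B))"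
  have v: "v $ 1 = t" "v $ 2 = t ^ B" "v $ 3 = t ^ (B * B)" by (simp_all add: v_def)
  have "(\<Prod>i\<in>UNIV. (v $ i) ^ Poly_Mapping.lookup m i) = t ^ \<kappa> m" for m
  proof -
    have "(\<Prod>i\<in>UNIV. (v $ i) ^ Poly_Mapping.lookup m i) = (v $ 1) ^ Poly_Mapping.lookup m 1
        * ((v $ 2) ^ Poly_Mapping.lookup m 2 * (v $ 3) ^ Poly_Mapping.lookup m 3)"
      unfolding UNIV_3 by simp
    then show ?thesis by (simp only: v \<kappa>_def distrib_left power_add power_mult)
  qed
  then have "mpoly_eval f v = poly P t" by (simp add: mpoly_eval_def P_def poly_sum poly_monom)
  then show ?thesis using t by (intro exI[of _ v]) simp
qed

text \<open>A property shared by forms and by determinants in one argument, stable under products,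
  and just strong enough for combining conditions of the type "not zero".\<close>

definition polynomial_on_lines :: "(complex ^ 3 \<Rightarrow> complex) \<Rightarrow> bool" where
  "polynomial_on_lines h \<longleftrightarrow> (\<forall>u v. \<exists>P. \<forall>t. h (u + t *s v) = poly P t)"

lemma polynomial_on_lines_mpoly_eval: "polynomial_on_lines (mpoly_eval f)"
  unfolding polynomial_on_lines_def
proof (intro allI)
  fix u v
  show "\<exists>P. \<forall>t. mpoly_eval f (u + t *s v) = poly P t"
    using poly_chart_poly[of f v u 0 0] by (intro exI[of _ "poly (chart_poly f v u 0) [:0:]"]) (simp add: add.commute)
qed

lemma polynomial_on_lines_det3: "polynomial_on_lines (\<lambda>w. det3 w a b)"
  unfolding polynomial_on_lines_def
proof (intro allI)
  fix u v
  show "\<exists>P. \<forall>t. det3 (u + t *s v) a b = poly P t"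
    by (intro exI[of _ "[:det3 u a b, det3 v a b:]"]) (simp add: det3_def algebra_simps)
qed

lemma polynomial_on_lines_mult:
  assumes "polynomial_on_lines h" "polynomial_on_lines k"
  shows "polynomial_on_lines (\<lambda>w. h w * k w)"
  using assms unfolding polynomial_on_lines_def by (metis poly_mult)

text \<open>Join a point where one function is nonzero to a point where the product of the others is
  nonzero. Both restrict to nonzero polynomials on this line, and so does their product.\<close>

lemma ex_common_nonzero:
  assumes "finite H" "\<And>h. h \<in> H \<Longrightarrow> polynomial_on_lines h" "\<And>h. h \<in> H \<Longrightarrow> \<exists>w. h w \<noteq> 0"
  shows "\<exists>w. \<forall>h\<in>H. h w \<noteq> 0"
proof -
  have "polynomial_on_lines (\<lambda>w. \<Prod>h\<in>H. h w) \<and> (\<exists>w. (\<Prod>h\<in>H. h w) \<noteq> 0)"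
    using assms
  proof (induction H)
    case empty
    show ?case by (auto simp: polynomial_on_lines_def intro: exI[of _ 1])
  next
    case (insert k H)
    have k: "polynomial_on_lines k" "\<exists>w. k w \<noteq> 0" using insert.prems by auto
    have H: "polynomial_on_lines (\<lambda>w. \<Prod>h\<in>H. h w)" "\<exists>w. (\<Prod>h\<in>H. h w) \<noteq> 0"
      using insert by auto
    then obtain a b where ab: "k a \<noteq> 0" "(\<Prod>h\<in>H. h b) \<noteq> 0" using k by auto
    obtain P where P: "\<And>t. k (a + t *s (b - a)) = poly P t"
      using k(1) unfolding polynomial_on_lines_def by blast
    obtain Q where Q: "\<And>t. (\<Prod>h\<in>H. h (a + t *s (b - a))) = poly Q t"
      using H(1) unfolding polynomial_on_lines_def by blast
    have "poly P 0 \<noteq> 0" using P[of 0] ab by simp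
    moreover have "poly Q 1 \<noteq> 0" using Q[of 1] ab by simp
    ultimately have "P * Q \<noteq> 0" by auto
    then obtain t where "poly (P * Q) t \<noteq> 0" using poly_all_0_iff_0[of "P * Q"] by blast
    then have "k (a + t *s (b - a)) * (\<Prod>h\<in>H. h (a + t *s (b - a))) \<noteq> 0" by (simp add: P Q)
    then have "\<exists>w. k w * (\<Prod>h\<in>H. h w) \<noteq> 0" by blast
    then show ?case using polynomial_on_lines_mult[OF k(1) H(1)] insert.hyps by simp
  qed
  then show ?thesis using assms(1) by auto
qed

text \<open>The centre r is taken off both curves and off every line through two common points, so
  projection from r separates them. Then p is taken off every line joining r to a common point, so
  the line at infinity contains none of them.\<close>

theorem bezout_transverse:
  assumes f: "homogeneous d f" and g: "homogeneous e g" and f0: "f \<noteq> 0" and g0: "g \<noteq> 0"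
    and de: "d \<ge> 1" "e \<ge> 1" and ind: "independent_gradients f g"
  shows "finite (zero_locus f \<inter> zero_locus g)" "card (zero_locus f \<inter> zero_locus g) = d * e"
proof -
  let ?V = "zero_locus f \<inter> zero_locus g"
  have ex_p: "\<exists>w. det3 w u r \<noteq> 0" if "u \<noteq> 0" "mpoly_eval f u = 0" "mpoly_eval f r \<noteq> 0" for u r
  proof (rule ex_det3_nonzero[OF that(1)])
    fix c
    have "mpoly_eval f (c *s u) = 0" using that(2) by (simp add: mpoly_eval_scale[OF f])
    then show "r \<noteq> c *s u" using that(3) by blast
  qed
  have r_indep: "\<exists>a. \<exists>w. det3 w a r \<noteq> 0" if "mpoly_eval f r \<noteq> 0" for r
  proof -
    have "r \<noteq> 0"
    proof
      assume "r = 0"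
      then have "mpoly_eval f r = mpoly_eval f (0 *s r)" by simp
      also have "\<dots> = 0" using de by (simp only: mpoly_eval_scale[OF f]) simp
      finally show False using that by simp
    qed
    then obtain j where j: "r $ j \<noteq> 0" by (auto simp: Finite_Cartesian_Product.vec_eq_iff)
    have "\<exists>w. det3 w (axis (j + 1) 1) r \<noteq> 0"
    proof (rule ex_det3_nonzero)
      show "axis (j + 1) 1 \<noteq> (0 :: complex ^ 3)" by (simp add: axis_eq_0_iff)
      fix c show "r \<noteq> c *s axis (j + 1) 1"
      proof
        assume "r = c *s axis (j + 1) 1"
        then have "r $ j = (c *s axis (j + 1) 1) $ j" by simp
        then show False using j by (simp add: axis_def)
      qed
    qed
    then show ?thesis by blast
  qed
  \<comment> \<open>An auxiliary chart: the generic choice below presupposes that there are only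
    finitely many common points.\<close>
  show fin: "finite ?V"
  proof -
    have "\<exists>r. \<forall>h\<in>{mpoly_eval f, mpoly_eval g}. h r \<noteq> 0"
      using ex_mpoly_eval_nonzero[OF f0] ex_mpoly_eval_nonzero[OF g0]
      by (intro ex_common_nonzero) (auto simp: polynomial_on_lines_mpoly_eval)
    then obtain r where r: "mpoly_eval f r \<noteq> 0" "mpoly_eval g r \<noteq> 0" by auto
    obtain q p where "det3 p q r \<noteq> 0" using r_indep[OF r(1)] by blast
    then interpret transverse_chart f g d e p q r using f g ind r by unfold_locales
    show ?thesis by (rule finite_intersection)
  qed
  define rep where "rep P = (SOME v. v \<noteq> 0 \<and> P = proj_point v)" for P
  have rep: "rep P \<noteq> 0" "proj_point (rep P) = P" "mpoly_eval f (rep P) = 0" "mpoly_eval g (rep P) = 0"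
    if "P \<in> ?V" for P
  proof -
    have "P \<in> proj_plane" using that by (simp add: zero_locus_def)
    then have "\<exists>v. v \<noteq> 0 \<and> P = proj_point v" using proj_planeE by blast
    then have "rep P \<noteq> 0 \<and> P = proj_point (rep P)" unfolding rep_def by (rule someI_ex)
    then show "rep P \<noteq> 0" "proj_point (rep P) = P" by auto
    then show "mpoly_eval f (rep P) = 0" "mpoly_eval g (rep P) = 0"
      using that proj_point_in_zero_locus[OF f, of "rep P"] proj_point_in_zero_locus[OF g, of "rep P"] by auto
  qed
  \<comment> \<open>The conditions on the centre r: off both curves and off all secants of the
    intersection.\<close>
  define H where "H = {mpoly_eval f, mpoly_eval g} \<union>
    (\<lambda>(P, Q) w. det3 w (rep P) (rep Q)) ` {(P, Q). P \<in> ?V \<and> Q \<in> ?V \<and> P \<noteq> Q}"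
  have "\<exists>r. \<forall>h\<in>H. h r \<noteq> 0"
  proof (rule ex_common_nonzero)
    have "finite {(P, Q). P \<in> ?V \<and> Q \<in> ?V \<and> P \<noteq> Q}"
      by (rule finite_subset[OF _ finite_cartesian_product[OF fin fin]]) auto
    then show "finite H" unfolding H_def by simp
    show "polynomial_on_lines h" if "h \<in> H" for h
      using that by (auto simp: H_def polynomial_on_lines_mpoly_eval polynomial_on_lines_det3)
    have "\<exists>w. det3 w (rep P) (rep Q) \<noteq> 0" if PQ: "P \<in> ?V" "Q \<in> ?V" "P \<noteq> Q" for P Q
    proof (rule ex_det3_nonzero[OF rep(1)[OF PQ(1)]])
      fix c show "rep Q \<noteq> c *s rep P"
      proof
        assume eq: "rep Q = c *s rep P"
        then have "c \<noteq> 0" using rep(1)[OF PQ(2)] by auto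
        then have "proj_point (rep P) = proj_point (rep Q)" using eq by (simp add: proj_point_scale)
        then show False using rep(2)[OF PQ(1)] rep(2)[OF PQ(2)] PQ(3) by simp
      qed
    qed
    then show "\<exists>w. h w \<noteq> 0" if "h \<in> H" for h
      using that ex_mpoly_eval_nonzero[OF f0] ex_mpoly_eval_nonzero[OF g0] by (auto simp: H_def)
  qed
  then obtain r where r: "\<And>h. h \<in> H \<Longrightarrow> h r \<noteq> 0" by blast
  have fr: "mpoly_eval f r \<noteq> 0" and gr: "mpoly_eval g r \<noteq> 0" by (rule r, simp add: H_def)+
  have rPQ: "det3 r (rep P) (rep Q) \<noteq> 0" if "P \<in> ?V" "Q \<in> ?V" "P \<noteq> Q" for P Q
  proof -
    have "(\<lambda>w. det3 w (rep P) (rep Q)) \<in> H"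
      unfolding H_def using that by (intro UnI2 image_eqI[of _ _ "(P, Q)"]) simp_all
    then show ?thesis by (rule r)
  qed
  obtain q where q: "\<exists>w. det3 w q r \<noteq> 0" using r_indep[OF fr] by blast
  \<comment> \<open>The conditions on p: it completes q and r to a basis, and the line through p and
    r misses the intersection.\<close>
  define K where "K = insert (\<lambda>w. det3 w q r) ((\<lambda>P w. det3 w (rep P) r) ` ?V)"
  have "\<exists>p. \<forall>h\<in>K. h p \<noteq> 0"
  proof (rule ex_common_nonzero)
    show "finite K" unfolding K_def using fin by blast
    show "polynomial_on_lines h" if "h \<in> K" for h using that by (auto simp: K_def polynomial_on_lines_det3)
    show "\<exists>w. h w \<noteq> 0" if "h \<in> K" for h
      using that q ex_p[OF rep(1) rep(3) fr] unfolding K_def by blast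
  qed
  then obtain p where p: "\<And>h. h \<in> K \<Longrightarrow> h p \<noteq> 0" by blast
  have det: "det3 p q r \<noteq> 0" using p[of "\<lambda>w. det3 w q r"] unfolding K_def by blast
  have pP: "det3 p (rep P) r \<noteq> 0" if "P \<in> ?V" for P
    using p[of "\<lambda>w. det3 w (rep P) r"] that unfolding K_def by blast
  interpret transverse_chart f g d e p q r using f g ind det fr gr by unfold_locales
  have in_V: "proj_point v \<in> ?V" if "v \<noteq> 0" "mpoly_eval f v = 0" "mpoly_eval g v = 0" for v
    using that proj_point_in_zero_locus[OF f that(1)] proj_point_in_zero_locus[OF g that(1)] by simp
  have rep_scale: "\<exists>c. c \<noteq> 0 \<and> rep (proj_point v) = c *s v" if "proj_point v \<in> ?V" for v
    using rep(2)[OF that] by (metis proj_point_eq_iff)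
  show "card ?V = d * e"
  proof (rule card_intersection)
    fix z assume fz: "mpoly_eval f (p + z *s r) = 0"
    show "mpoly_eval g (p + z *s r) \<noteq> 0"
    proof
      assume gz: "mpoly_eval g (p + z *s r) = 0"
      have "p + z *s r \<noteq> 0"
      proof
        assume 0: "p + z *s r = 0"
        have "1 *s p + 0 *s q + z *s r = p + z *s r" by simp
        also note 0
        also have "0 = 0 *s p + 0 *s q + 0 *s r" by simp
        finally have "(1 :: complex) = 0" using coordinates_unique[OF det] by blast
        then show False by simp
      qed
      then have V: "proj_point (p + z *s r) \<in> ?V" using in_V fz gz by blast
      then obtain c where c: "rep (proj_point (p + z *s r)) = c *s (p + z *s r)" using rep_scale by blast
      have "det3 p (c *s (p + z *s r)) r = 0" by (simp add: det3_def algebra_simps)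
      then show False using pP[OF V] unfolding c by blast
    qed
  next
    fix x z z' assume zz: "(x, z) \<in> zeros" "(x, z') \<in> zeros"
    let ?P = "proj_point (x *s p + q + z *s r)" and ?Q = "proj_point (x *s p + q + z' *s r)"
    have V: "?P \<in> ?V" "?Q \<in> ?V"
      using zz by (simp_all only: zeros_def mem_Collect_eq split_conv in_V[OF chart_point_nonzero])
    obtain c where c: "rep ?P = c *s (x *s p + q + z *s r)" using rep_scale[OF V(1)] by blast
    obtain c' where c': "rep ?Q = c' *s (x *s p + q + z' *s r)" using rep_scale[OF V(2)] by blast
    have "det3 r (c *s a) (c' *s b) = c * c' * det3 r a b" for a b
      by (simp add: det3_def algebra_simps)
    moreover have "det3 r (u + z *s r) (u + z' *s r) = 0" for u
      by (simp add: det3_def algebra_simps)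
    ultimately have "det3 r (rep ?P) (rep ?Q) = 0" unfolding c c' by simp
    then have "?P = ?Q" using rPQ[OF V] by blast
    then show "z = z'" using inj_onD[OF inj_on_zeros, of "(x, z)" "(x, z')" UNIV] by simp
  qed
qed

section \<open>Decomposing sets with a group action\<close>

text \<open>Bijectivity comes for free, since the inverse group element acts as the inverse
  map.\<close>

lemma group_actionI:
  assumes "group G"
    and closed: "\<And>g x. g \<in> carrier G \<Longrightarrow> x \<in> E \<Longrightarrow> \<phi> g x \<in> E"
    and ext: "\<And>g. g \<in> carrier G \<Longrightarrow> \<phi> g \<in> extensional E"
    and one: "\<And>x. x \<in> E \<Longrightarrow> \<phi> \<one>\<^bsub>G\<^esub> x = x"
    and mult: "\<And>g h x. g \<in> carrier G \<Longrightarrow> h \<in> carrier G \<Longrightarrow> x \<in> E \<Longrightarrow> \<phi> (g \<otimes>\<^bsub>G\<^esub> h) x = \<phi> g (\<phi> h x)"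
  shows "group_action G E \<phi>"
proof -
  interpret group G by fact
  have bij: "\<phi> g \<in> Bij E" if g: "g \<in> carrier G" for g
  proof -
    have "\<phi> (inv\<^bsub>G\<^esub> g) (\<phi> g x) = x" "\<phi> g (\<phi> (inv\<^bsub>G\<^esub> g) x) = x" if "x \<in> E" for x
      using that g mult[of "inv\<^bsub>G\<^esub> g" g x] mult[of g "inv\<^bsub>G\<^esub> g" x] one by simp_all
    then have "bij_betw (\<phi> g) E E"
      using g closed by (intro bij_betw_byWitness[of E "\<phi> (inv\<^bsub>G\<^esub> g)"]) auto
    then show ?thesis using ext[OF g] by (simp add: Bij_def)
  qed
  have "\<phi> (g \<otimes>\<^bsub>G\<^esub> h) = compose E (\<phi> g) (\<phi> h)" if "g \<in> carrier G" "h \<in> carrier G" for g h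
  proof (rule extensionalityI[of _ E])
    show "\<phi> (g \<otimes>\<^bsub>G\<^esub> h) \<in> extensional E" using that ext by simp
    show "\<phi> (g \<otimes>\<^bsub>G\<^esub> h) x = compose E (\<phi> g) (\<phi> h) x" if "x \<in> E" for x
      using that \<open>g \<in> _\<close> \<open>h \<in> _\<close> mult by (simp add: compose_def)
  qed simp
  then have "\<phi> \<in> hom G (BijGroup E)" using bij by (intro homI) (auto simp: BijGroup_def)
  then show ?thesis
    unfolding group_action_def group_hom_def group_hom_axioms_def
    using \<open>group G\<close> group_BijGroup by blast
qed

context group_action
begin

lemma group_G: "group G" using group_hom by (simp add: group_hom_def)

lemma action_one: "x \<in> E \<Longrightarrow> \<phi> \<one> x = x"
  using id_eq_one[symmetric] by simp

lemma action_inv: "g \<in> carrier G \<Longrightarrow> x \<in> E \<Longrightarrow> \<phi> (inv g) (\<phi> g x) = x"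
  using group_G action_one composition_rule[of x "inv g" g]
  by (simp add: group.l_inv group.inv_closed)

text \<open>The action laws on the target are transported along the equivariant bijection, so beyond
  equivariance only extensionality has to be supplied.\<close>

lemma gset_isoI:
  assumes bij: "bij_betw h E F"
    and ext: "\<And>g. g \<in> carrier G \<Longrightarrow> \<psi> g \<in> extensional F"
    and equiv: "\<And>g x. g \<in> carrier G \<Longrightarrow> x \<in> E \<Longrightarrow> h (\<phi> g x) = \<psi> g (h x)"
  shows "gset_iso G (E, \<phi>) (F, \<psi>)"
proof -
  have F: "F = h ` E" using bij by (simp add: bij_betw_def)
  have "group_action G F \<psi>"
  proof (rule group_actionI[OF group_G _ ext])
    interpret group G by (rule group_G)
    show "\<psi> g y \<in> F" if g: "g \<in> carrier G" and y: "y \<in> F" for g y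
    proof -
      obtain x where x: "x \<in> E" "y = h x" using y unfolding F by blast
      then have "\<psi> g y = h (\<phi> g x)" using equiv[OF g] by simp
      then show ?thesis using element_image[OF g x(1)] unfolding F by blast
    qed
    show "\<psi> \<one> y = y" if "y \<in> F" for y
    proof -
      obtain x where x: "x \<in> E" "y = h x" using \<open>y \<in> F\<close> unfolding F by blast
      then show ?thesis using action_one equiv[of \<one> x] by simp
    qed
    show "\<psi> (g \<otimes> k) y = \<psi> g (\<psi> k y)" if gk: "g \<in> carrier G" "k \<in> carrier G" and y: "y \<in> F" for g k y
    proof -
      obtain x where x: "x \<in> E" "y = h x" using y unfolding F by blast
      have "\<psi> (g \<otimes> k) y = h (\<phi> (g \<otimes> k) x)" using equiv[of "g \<otimes> k" x] x gk by simp
      also have "\<dots> = h (\<phi> g (\<phi> k x))" using composition_rule x gk by simp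
      also have "\<dots> = \<psi> g (h (\<phi> k x))" using equiv[OF gk(1) element_image[OF gk(2) x(1)]] by simp
      also have "\<dots> = \<psi> g (\<psi> k y)" using equiv[OF gk(2) x(1)] x by simp
      finally show ?thesis .
    qed
  qed
  then show ?thesis unfolding gset_iso.simps using bij equiv group_action_axioms by blast
qed

lemma group_action_restrict:
  assumes "A \<subseteq> E" "\<And>g x. g \<in> carrier G \<Longrightarrow> x \<in> A \<Longrightarrow> \<phi> g x \<in> A"
  shows "group_action G A (\<lambda>g. restrict (\<phi> g) A)"
proof (rule group_actionI[OF group_G])
  interpret group G by (rule group_G)
  show "restrict (\<phi> (g \<otimes> k)) A x = restrict (\<phi> g) A (restrict (\<phi> k) A x)"
    if "g \<in> carrier G" "k \<in> carrier G" "x \<in> A" for g k x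
    using that assms composition_rule[of x g k] by auto
qed (use assms action_one in auto)

lemma gset_iso_sum:
  assumes E: "E = A \<union> B" "A \<inter> B = {}"
    and A: "\<And>g x. g \<in> carrier G \<Longrightarrow> x \<in> A \<Longrightarrow> \<phi> g x \<in> A"
    and B: "\<And>g x. g \<in> carrier G \<Longrightarrow> x \<in> B \<Longrightarrow> \<phi> g x \<in> B"
    and S: "gset_iso G (A, \<lambda>g. restrict (\<phi> g) A) S"
    and T: "gset_iso G (B, \<lambda>g. restrict (\<phi> g) B) T"
  shows "gset_iso G (E, \<phi>) (gset_sum S T)"
proof -
  obtain X \<xi> where S_eq: "S = (X, \<xi>)" by fastforce
  obtain Y \<upsilon> where T_eq: "T = (Y, \<upsilon>)" by fastforce
  obtain a where a: "bij_betw a A X" "\<And>g x. g \<in> carrier G \<Longrightarrow> x \<in> A \<Longrightarrow> a (\<phi> g x) = \<xi> g (a x)"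
    using S unfolding S_eq by auto
  obtain b where b: "bij_betw b B Y" "\<And>g x. g \<in> carrier G \<Longrightarrow> x \<in> B \<Longrightarrow> b (\<phi> g x) = \<upsilon> g (b x)"
    using T unfolding T_eq by auto
  define h where "h x = (if x \<in> A then Inl (a x) else Inr (b x))" for x
  have hA: "h x = Inl (a x)" if "x \<in> A" for x using that by (simp add: h_def)
  have hB: "h x = Inr (b x)" if "x \<in> B" for x using that E(2) by (auto simp: h_def)
  have "bij_betw h E (X <+> Y)"
  proof (rule bij_betw_imageI)
    show "inj_on h E"
    proof (rule inj_onI)
      fix x y assume "x \<in> E" "y \<in> E" and eq: "h x = h y"
      then consider "x \<in> A" "y \<in> A" | "x \<in> B" "y \<in> B" | "x \<in> A" "y \<in> B" | "x \<in> B" "y \<in> A"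
        unfolding E(1) by blast
      then show "x = y"
        using eq inj_onD[OF bij_betw_imp_inj_on[OF a(1)]] inj_onD[OF bij_betw_imp_inj_on[OF b(1)]]
        by cases (simp_all add: hA hB)
    qed
    have "h ` A = Inl ` a ` A" "h ` B = Inr ` b ` B"
      unfolding image_image by (rule image_cong[OF refl], simp add: hA hB)+
    then have "h ` A = Inl ` X" "h ` B = Inr ` Y"
      using a(1) b(1) by (simp_all only: bij_betw_def)
    then show "h ` E = X <+> Y" unfolding E(1) Plus_def by (simp add: image_Un)
  qed
  then show ?thesis unfolding S_eq T_eq gset_sum.simps
  proof (rule gset_isoI)
    fix g x assume g: "g \<in> carrier G" and x: "x \<in> E"
    show "h (\<phi> g x) = (\<lambda>x\<in>X <+> Y. map_sum (\<xi> g) (\<upsilon> g) x) (h x)"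
    proof (cases "x \<in> A")
      case True
      then have "a x \<in> X" using a(1) by (auto simp: bij_betw_def)
      then show ?thesis using True g A a(2) by (simp add: hA InlI)
    next
      case False
      then have xB: "x \<in> B" using x E by blast
      then have "b x \<in> Y" using b(1) by (auto simp: bij_betw_def)
      then show ?thesis using xB g B b(2) by (simp add: hB InrI)
    qed
  qed simp
qed

lemma coset_of_stabilizer:
  assumes x: "x \<in> E" and a: "a \<in> carrier G"
  shows "{k \<in> carrier G. \<phi> k x = \<phi> a x} = a <# stabilizer G \<phi> x"
proof -
  interpret group G by (rule group_G)
  show ?thesis
  proof (intro equalityI subsetI)
    fix k assume "k \<in> {k \<in> carrier G. \<phi> k x = \<phi> a x}"
    then have k: "k \<in> carrier G" "\<phi> k x = \<phi> a x" by auto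
    then have "\<phi> (inv a \<otimes> k) x = x" using composition_rule[of x "inv a" k] a x action_inv by simp
    then have "inv a \<otimes> k \<in> stabilizer G \<phi> x" using a k by (simp add: stabilizer_def)
    moreover have "k = a \<otimes> (inv a \<otimes> k)" using a k by (simp add: m_assoc[symmetric])
    ultimately show "k \<in> a <# stabilizer G \<phi> x" unfolding l_coset_def by blast
  next
    fix k assume "k \<in> a <# stabilizer G \<phi> x"
    then obtain s where "s \<in> carrier G" "\<phi> s x = x" "k = a \<otimes> s"
      by (auto simp: l_coset_def stabilizer_def)
    then show "k \<in> {k \<in> carrier G. \<phi> k x = \<phi> a x}" using composition_rule[of x a s] a x by simp
  qed
qed

text \<open>Gives the equivariance of the map sending y to the set of group elements that carry x to
  y.\<close>

lemma transporter_translate: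
  assumes x: "x \<in> E" and y: "y \<in> E" and g: "g \<in> carrier G"
  shows "{k \<in> carrier G. \<phi> k x = \<phi> g y} = g <# {k \<in> carrier G. \<phi> k x = y}"
proof -
  interpret group G by (rule group_G)
  show ?thesis
  proof (intro equalityI subsetI)
    fix k assume "k \<in> {k \<in> carrier G. \<phi> k x = \<phi> g y}"
    then have k: "k \<in> carrier G" "\<phi> k x = \<phi> g y" by auto
    then have "\<phi> (inv g \<otimes> k) x = y" using composition_rule[of x "inv g" k] g x y action_inv by simp
    moreover have "k = g \<otimes> (inv g \<otimes> k)" using g k by (simp add: m_assoc[symmetric])
    moreover have "inv g \<otimes> k \<in> carrier G" using g k by simp
    ultimately show "k \<in> g <# {k \<in> carrier G. \<phi> k x = y}" unfolding l_coset_def by blast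
  next
    fix k assume "k \<in> g <# {k \<in> carrier G. \<phi> k x = y}"
    then obtain s where "s \<in> carrier G" "\<phi> s x = y" "k = g \<otimes> s"
      by (auto simp: l_coset_def)
    then show "k \<in> {k \<in> carrier G. \<phi> k x = \<phi> g y}" using composition_rule[of x g s] g x by simp
  qed
qed

text \<open>A point y of the orbit goes to the set of all group elements carrying x to y, a left
  coset of the stabilizer. This inverts the usual map from cosets to the orbit without choosing
  representatives.\<close>

lemma gset_iso_orbit:
  assumes x: "x \<in> E"
  shows "gset_iso G (orbit G \<phi> x, \<lambda>g. restrict (\<phi> g) (orbit G \<phi> x)) (coset_gset G (stabilizer G \<phi> x))"
proof -
  interpret group G by (rule group_G)
  let ?O = "orbit G \<phi> x" and ?H = "stabilizer G \<phi> x"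
  have sub: "?O \<subseteq> E" using x element_image by (auto simp: orbit_def)
  have stable: "\<phi> g y \<in> ?O" if "g \<in> carrier G" "y \<in> ?O" for g y
    using that x composition_rule[of x g] by (auto simp: orbit_def) (metis m_closed)
  interpret O: group_action G ?O "\<lambda>g. restrict (\<phi> g) ?O"
    using sub stable by (rule group_action_restrict)
  define h where "h y = {k \<in> carrier G. \<phi> k x = y}" for y
  have h: "h (\<phi> a x) = a <# ?H" if "a \<in> carrier G" for a
    unfolding h_def using x that by (rule coset_of_stabilizer)
  have "bij_betw h ?O (lcosets ?H)"
  proof (rule bij_betw_imageI)
    show "inj_on h ?O"
    proof (rule inj_onI)
      fix y z assume "y \<in> ?O" "z \<in> ?O" "h y = h z"
      moreover from this obtain a where "a \<in> carrier G" "y = \<phi> a x" by (auto simp: orbit_def)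
      ultimately have "a \<in> h z" by (auto simp: h_def)
      then show "y = z" using \<open>y = \<phi> a x\<close> by (simp add: h_def)
    qed
    have "?O = (\<lambda>a. \<phi> a x) ` carrier G" by (auto simp: orbit_def)
    then show "h ` ?O = lcosets ?H" using h by (auto simp: LCOSETS_def image_image)
  qed
  then show ?thesis unfolding coset_gset_def
  proof (rule O.gset_isoI)
    fix g y assume g: "g \<in> carrier G" and y: "y \<in> ?O"
    have "h y \<in> lcosets ?H" using y h by (auto simp: orbit_def LCOSETS_def)
    then show "h (restrict (\<phi> g) ?O y) = (\<lambda>y\<in>lcosets ?H. g <# y) (h y)"
      using y sub transporter_translate[OF x _ g, of y] by (auto simp: h_def)
  qed simp
qed

lemma orbit_eq:
  assumes x: "x \<in> E" and y: "y \<in> orbit G \<phi> x"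
  shows "orbit G \<phi> y = orbit G \<phi> x"
proof -
  have yE: "y \<in> E" using assms element_image by (auto simp: orbit_def)
  have in_E: "z \<in> E" if "z \<in> orbit G \<phi> w" "w \<in> E" for z w
    using that element_image by (auto simp: orbit_def)
  have xy: "x \<in> orbit G \<phi> y" using orbit_sym[OF x yE y] .
  show ?thesis
    using orbit_trans[OF x yE in_E[OF _ yE] y] orbit_trans[OF yE x in_E[OF _ x] xy] by blast
qed

lemma card_free_action:
  assumes fin: "finite E" and free: "\<And>x. x \<in> E \<Longrightarrow> stabilizer G \<phi> x = {\<one>}"
  shows "card (carrier G) * card (orbits G E \<phi>) = card E"
proof -
  interpret group G by (rule group_G)
  have sub: "orbit G \<phi> x \<subseteq> E" if "x \<in> E" for x using that element_image by (auto simp: orbit_def)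
  have Un: "\<Union> (orbits G E \<phi>) = E" using sub orbit_refl by (auto simp: orbits_def)
  have "card (orbit G \<phi> x) = card (carrier G)" if x: "x \<in> E" for x
  proof -
    have "inj_on (\<lambda>g. \<phi> g x) (carrier G)"
    proof (rule inj_onI)
      fix a b assume ab: "a \<in> carrier G" "b \<in> carrier G" "\<phi> a x = \<phi> b x"
      then have "a \<in> b <# {\<one>}" using coset_of_stabilizer[OF x ab(2)] free[OF x] by auto
      then show "a = b" using ab by (simp add: l_coset_def)
    qed
    moreover have "orbit G \<phi> x = (\<lambda>g. \<phi> g x) ` carrier G" by (auto simp: orbit_def)
    ultimately show ?thesis by (simp add: card_image)
  qed
  then have "card (carrier G) * card (orbits G E \<phi>) = card (\<Union> (orbits G E \<phi>))"
  proof (intro card_partition)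
    show "finite (orbits G E \<phi>)" using fin by (simp add: orbits_def setcompr_eq_image)
    show "finite (\<Union> (orbits G E \<phi>))" using fin Un by simp
    fix C D assume "C \<in> orbits G E \<phi>" "D \<in> orbits G E \<phi>" "C \<noteq> D"
    moreover from this obtain x y where "x \<in> E" "y \<in> E" "C = orbit G \<phi> x" "D = orbit G \<phi> y"
      by (auto simp: orbits_def)
    ultimately show "C \<inter> D = {}" using orbit_eq by blast
  qed (auto simp: orbits_def)
  then show ?thesis using Un by simp
qed

text \<open>A point is coded by the number of its orbit together with the coset, here a singleton,
  of the elements carrying the chosen representative of that orbit to it. Counting forces the number
  of orbits to be k.\<close>

lemma gset_iso_free:
  assumes fin: "finite E" and free: "\<And>x. x \<in> E \<Longrightarrow> stabilizer G \<phi> x = {\<one>}"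
    and card: "card E = k * card (carrier G)" and finG: "finite (carrier G)"
  shows "gset_iso G (E, \<phi>) (gset_copies k (coset_gset G {\<one>}))"
proof -
  interpret group G by (rule group_G)
  have "card (carrier G) * card (orbits G E \<phi>) = card E"
    using fin free by (rule card_free_action)
  moreover have "card (carrier G) > 0" using finG by (auto simp: card_gt_0_iff)
  ultimately have "card (orbits G E \<phi>) = k" using card by simp
  moreover have "finite (orbits G E \<phi>)" using fin by (simp add: orbits_def setcompr_eq_image)
  ultimately obtain num where num: "bij_betw num (orbits G E \<phi>) {..<k}"
    using ex_bij_betw_finite_nat[of "orbits G E \<phi>"] by (auto simp: lessThan_atLeast0)
  define rep where "rep C = (SOME x. x \<in> E \<and> orbit G \<phi> x = C)" for C
  have rep: "rep C \<in> E" "orbit G \<phi> (rep C) = C" if "C \<in> orbits G E \<phi>" for C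
  proof -
    have "\<exists>x. x \<in> E \<and> orbit G \<phi> x = C" using that by (auto simp: orbits_def)
    then have "rep C \<in> E \<and> orbit G \<phi> (rep C) = C" unfolding rep_def by (rule someI_ex)
    then show "rep C \<in> E" "orbit G \<phi> (rep C) = C" by auto
  qed
  have orb: "orbit G \<phi> x \<in> orbits G E \<phi>" if "x \<in> E" for x using that by (auto simp: orbits_def)
  define h where "h y = (num (orbit G \<phi> y), {g \<in> carrier G. \<phi> g (rep (orbit G \<phi> y)) = y})" for y
  have transport: "\<exists>a\<in>carrier G. y = \<phi> a (rep (orbit G \<phi> y))" if "y \<in> E" for y
    using orbit_refl[OF that] rep(2)[OF orb[OF that]] by (auto simp: orbit_def)
  have coset: "{g \<in> carrier G. \<phi> g x = \<phi> a x} = a <# {\<one>}" if "x \<in> E" "a \<in> carrier G" for x a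
    using coset_of_stabilizer[OF that] free[OF that(1)] by simp
  have hE: "h y \<in> {..<k} \<times> (lcosets {\<one>})" if yE: "y \<in> E" for y
  proof -
    have "num (orbit G \<phi> y) < k" using num orb[OF yE] by (auto simp: bij_betw_def)
    moreover have "{g \<in> carrier G. \<phi> g (rep (orbit G \<phi> y)) = y} \<in> lcosets {\<one>}"
    proof -
      obtain a where a: "a \<in> carrier G" "y = \<phi> a (rep (orbit G \<phi> y))" using transport[OF yE] by blast
      have "{g \<in> carrier G. \<phi> g (rep (orbit G \<phi> y)) = y} = a <# {\<one>}"
        using coset[OF rep(1)[OF orb[OF yE]] a(1)] a(2) by simp
      then show ?thesis using a(1) by (auto simp: LCOSETS_def)
    qed
    ultimately show ?thesis by (simp add: h_def)
  qed
  have "bij_betw h E ({..<k} \<times> (lcosets {\<one>}))"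
  proof (rule bij_betw_imageI)
    show "inj_on h E"
    proof (rule inj_onI)
      fix y z assume y: "y \<in> E" and z: "z \<in> E" and eq: "h y = h z"
      then have o: "orbit G \<phi> y = orbit G \<phi> z"
        using inj_onD[OF bij_betw_imp_inj_on[OF num]] orb by (simp add: h_def)
      obtain a where a: "a \<in> carrier G" "y = \<phi> a (rep (orbit G \<phi> y))" using transport[OF y] by blast
      then have "a \<in> snd (h y)" by (simp add: h_def)
      then have "z = \<phi> a (rep (orbit G \<phi> z))" unfolding eq by (simp add: h_def)
      then show "y = z" using a o by simp
    qed
    show "h ` E = {..<k} \<times> (lcosets {\<one>})"
    proof (intro equalityI subsetI)
      fix z assume "z \<in> {..<k} \<times> (lcosets {\<one>})"
      then obtain i a where z: "z = (i, a <# {\<one>})" "i < k" "a \<in> carrier G"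
        by (auto simp: LCOSETS_def)
      then obtain C where C: "C \<in> orbits G E \<phi>" "num C = i"
        using num by (metis bij_betw_imp_surj_on imageE lessThan_iff)
      have "\<phi> a (rep C) \<in> orbit G \<phi> (rep C)" using z(3) by (auto simp: orbit_def)
      then have "orbit G \<phi> (\<phi> a (rep C)) = C"
        using orbit_eq[OF rep(1)[OF C(1)]] rep(2)[OF C(1)] by simp
      then have "h (\<phi> a (rep C)) = z" using C z coset[OF rep(1)[OF C(1)] z(3)] by (simp add: h_def)
      then show "z \<in> h ` E" using element_image[OF z(3) rep(1)[OF C(1)]] by blast
    qed (use hE in blast)
  qed
  then show ?thesis unfolding coset_gset_def gset_copies.simps
  proof (rule gset_isoI)
    fix g y assume g: "g \<in> carrier G" and y: "y \<in> E"
    have "\<phi> g y \<in> orbit G \<phi> y" using g by (auto simp: orbit_def)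
    then have o: "orbit G \<phi> (\<phi> g y) = orbit G \<phi> y" by (rule orbit_eq[OF y])
    have "h y \<in> {..<k} \<times> (lcosets {\<one>})" using hE[OF y] .
    moreover have "h (\<phi> g y) = (fst (h y), g <# snd (h y))"
      unfolding h_def o using transporter_translate[OF rep(1)[OF orb[OF y]] y g] by simp
    ultimately show "h (\<phi> g y) = (\<lambda>x\<in>{..<k} \<times> (lcosets {\<one>}). map_prod id (\<lambda>x\<in>lcosets {\<one>}. g <# x) x) (h y)"
      by (auto simp: mem_Times_iff map_prod_def split: prod.split)
  qed simp
qed

end

section \<open>Symmetric forms\<close>

lemma three_eq_0: "(3::3) = 0" by simp
lemma cases_3: "(i::3) = 0 \<or> i = 1 \<or> i = 2"
  using exhaust_3[of i] unfolding three_eq_0 by blast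

lemma UNIV_3': "(UNIV :: 3 set) = {0, 1, 2}"
  unfolding UNIV_3 three_eq_0 by (simp add: insert_commute)

lemma sum_UNIV_3: "(\<Sum>i\<in>(UNIV :: 3 set). h i) = h 0 + h 1 + h 2"
  unfolding UNIV_3' by (simp add: add.assoc)

lemma fun3_eqI:
  fixes \<sigma> \<tau> :: "3 \<Rightarrow> 'a"
  assumes "\<sigma> 0 = \<tau> 0" "\<sigma> 1 = \<tau> 1" "\<sigma> 2 = \<tau> 2"
  shows "\<sigma> = \<tau>"
proof
  fix i show "\<sigma> i = \<tau> i" using cases_3[of i] assms by (elim disjE) simp_all
qed

lemma bij_3_cases:
  fixes \<sigma> :: "3 \<Rightarrow> 3"
  assumes "bij \<sigma>"
  obtains "\<sigma> = id" | i j where "i \<noteq> j" "\<sigma> = Transposition.transpose i j" | "\<sigma> = (\<lambda>i. i + 1)" | "\<sigma> = (\<lambda>i. i + 2)"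
proof -
  have ne: "\<sigma> 0 \<noteq> \<sigma> 1" "\<sigma> 0 \<noteq> \<sigma> 2" "\<sigma> 1 \<noteq> \<sigma> 2"
    using bij_is_inj[OF assms] by (simp_all add: inj_eq)
  have "(\<sigma> 0 = 0 \<and> \<sigma> 1 = 1 \<and> \<sigma> 2 = 2) \<or> (\<sigma> 0 = 0 \<and> \<sigma> 1 = 2 \<and> \<sigma> 2 = 1)
    \<or> (\<sigma> 0 = 1 \<and> \<sigma> 1 = 0 \<and> \<sigma> 2 = 2) \<or> (\<sigma> 0 = 1 \<and> \<sigma> 1 = 2 \<and> \<sigma> 2 = 0)
    \<or> (\<sigma> 0 = 2 \<and> \<sigma> 1 = 0 \<and> \<sigma> 2 = 1) \<or> (\<sigma> 0 = 2 \<and> \<sigma> 1 = 1 \<and> \<sigma> 2 = 0)"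
    using cases_3[of "\<sigma> 0"] cases_3[of "\<sigma> 1"] cases_3[of "\<sigma> 2"] ne by (elim disjE) simp_all
  then show thesis
  proof (elim disjE conjE)
    assume "\<sigma> 0 = 0" "\<sigma> 1 = 1" "\<sigma> 2 = 2"
    then have "\<sigma> = id" by (intro fun3_eqI[of \<sigma>]) simp_all
    then show thesis by (rule that(1))
  next
    assume "\<sigma> 0 = 0" "\<sigma> 1 = 2" "\<sigma> 2 = 1"
    then have "\<sigma> = Transposition.transpose 1 2" by (intro fun3_eqI[of \<sigma>]) (simp_all add: Transposition.transpose_def)
    then show thesis using that(2)[of 1 2] by simp
  next
    assume "\<sigma> 0 = 1" "\<sigma> 1 = 0" "\<sigma> 2 = 2"
    then have "\<sigma> = Transposition.transpose 0 1" by (intro fun3_eqI[of \<sigma>]) (simp_all add: Transposition.transpose_def)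
    then show thesis using that(2)[of 0 1] by simp
  next
    assume "\<sigma> 0 = 1" "\<sigma> 1 = 2" "\<sigma> 2 = 0"
    then have "\<sigma> = (\<lambda>i. i + 1)" by (intro fun3_eqI[of \<sigma>]) simp_all
    then show thesis by (rule that(3))
  next
    assume "\<sigma> 0 = 2" "\<sigma> 1 = 0" "\<sigma> 2 = 1"
    then have "\<sigma> = (\<lambda>i. i + 2)" by (intro fun3_eqI[of \<sigma>]) simp_all
    then show thesis by (rule that(4))
  next
    assume "\<sigma> 0 = 2" "\<sigma> 1 = 1" "\<sigma> 2 = 0"
    then have "\<sigma> = Transposition.transpose 0 2" by (intro fun3_eqI[of \<sigma>]) (simp_all add: Transposition.transpose_def)
    then show thesis using that(2)[of 0 2] by simp
  qed
qed

section \<open>Permuting coordinates, and its effect on values and gradients of symmetric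
  forms\<close>

lemma bij_add_3: "bij (\<lambda>i::3. i + k)"
  by (rule bij_betw_byWitness[of _ "\<lambda>i. i - k"]) auto

lemma permute_coords_nth: "bij \<sigma> \<Longrightarrow> permute_coords \<sigma> v $ \<sigma> i = v $ i"
  by (simp add: permute_coords_def bij_is_inj)

lemma permute_coords_comp:
  assumes "bij \<sigma>" "bij \<tau>"
  shows "permute_coords (\<sigma> \<circ> \<tau>) v = permute_coords \<sigma> (permute_coords \<tau> v)"
  using assms by (simp add: permute_coords_def o_inv_distrib)

lemma permute_coords_id: "permute_coords id v = v"
  by (simp add: permute_coords_def)

lemma permute_coords_add: "permute_coords \<sigma> (u + v) = permute_coords \<sigma> u + permute_coords \<sigma> v"
  and permute_coords_diff: "permute_coords \<sigma> (u - v) = permute_coords \<sigma> u - permute_coords \<sigma> v"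
  and permute_coords_scale: "permute_coords \<sigma> (c *s v) = c *s permute_coords \<sigma> v"
  by (simp_all add: permute_coords_def Finite_Cartesian_Product.vec_eq_iff)

lemma permute_coords_axis:
  assumes "bij \<sigma>"
  shows "permute_coords \<sigma> (axis j 1) = axis (\<sigma> j) 1"
  using assms by (auto simp: permute_coords_def axis_def Finite_Cartesian_Product.vec_eq_iff
      bij_is_surj surj_f_inv_f inv_f_f bij_is_inj)

lemma permute_coords_eqI:
  assumes "bij \<sigma>" "\<And>i. w $ \<sigma> i = v $ i"
  shows "permute_coords \<sigma> v = w"
  using assms by (metis (no_types, lifting) Finite_Cartesian_Product.vec_eq_iff bij_pointE permute_coords_nth)

lemma permute_coords_eq_0_iff:
  assumes "bij \<sigma>"
  shows "permute_coords \<sigma> v = 0 \<longleftrightarrow> v = 0"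
proof
  assume "permute_coords \<sigma> v = 0"
  then have "v $ i = 0" for i using permute_coords_nth[OF assms, of v i] by simp
  then show "v = 0" by (simp add: Finite_Cartesian_Product.vec_eq_iff)
qed (simp add: permute_coords_def Finite_Cartesian_Product.vec_eq_iff)

lemma permute_coords_image_proj_point:
  "permute_coords \<sigma> ` proj_point v = proj_point (permute_coords \<sigma> v)"
  by (auto simp: proj_point_def permute_coords_scale image_iff) (metis permute_coords_scale)

text \<open>Symmetry equates the coefficients of a monomial and of its permuted exponent vector;
  reindexing the product over the variables and then the sum over the monomials gives invariance of
  the values.\<close>

lemma mpoly_eval_permute_coords:
  assumes sym: "symmetric f" and \<sigma>: "bij \<sigma>"
  shows "mpoly_eval f (permute_coords \<sigma> v) = mpoly_eval f v"
proof -
  let ?K = "Poly_Mapping.keys f" and ?\<mu> = "Poly_Mapping.map_key \<sigma> :: (3 \<Rightarrow>\<^sub>0 nat) \<Rightarrow> _"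
    and ?\<nu> = "Poly_Mapping.map_key (inv_into UNIV \<sigma>) :: (3 \<Rightarrow>\<^sub>0 nat) \<Rightarrow> _"
  have inj: "inj \<sigma>" "inj (inv_into UNIV \<sigma>)" using \<sigma> by (simp_all add: bij_is_inj bij_imp_bij_inv)
  have inv: "?\<mu> (?\<nu> m) = m" "?\<nu> (?\<mu> m) = m" for m
  proof -
    have "inv_into UNIV \<sigma> \<circ> \<sigma> = (\<lambda>x. x)" "\<sigma> \<circ> inv_into UNIV \<sigma> = (\<lambda>x. x)"
      using inj(1) bij_is_surj[OF \<sigma>] by (simp_all add: fun_eq_iff surj_f_inv_f)
    then show "?\<mu> (?\<nu> m) = m" "?\<nu> (?\<mu> m) = m"
      by (simp_all only: map_key_compose[OF inj] map_key_compose[OF inj(2,1)] map_key_id)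
  qed
  then have "inj ?\<mu>" by (metis injI)
  then have lookup: "Poly_Mapping.lookup f (?\<mu> m) = Poly_Mapping.lookup f m" for m
    using sym \<sigma> map_key.rep_eq[of ?\<mu> f]
    by (metis comp_apply permute_vars_def symmetric_def)
  have bij: "bij_betw ?\<mu> ?K ?K"
    using inv lookup by (intro bij_betw_byWitness[of _ ?\<nu>]) (auto simp: in_keys_iff, metis)
  have "mpoly_eval f (permute_coords \<sigma> v)
      = (\<Sum>m\<in>?K. Poly_Mapping.lookup f (?\<mu> m) * (\<Prod>i\<in>UNIV. (permute_coords \<sigma> v $ i) ^ Poly_Mapping.lookup m i))"
    by (simp add: mpoly_eval_def lookup)
  also have "\<dots> = (\<Sum>m\<in>?K. Poly_Mapping.lookup f (?\<mu> m) * (\<Prod>i\<in>UNIV. (v $ i) ^ Poly_Mapping.lookup (?\<mu> m) i))"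
  proof (intro sum.cong refl arg_cong2[where f = "(*)"])
    fix m
    have "(\<Prod>i\<in>UNIV. (permute_coords \<sigma> v $ i) ^ Poly_Mapping.lookup m i)
        = (\<Prod>i\<in>UNIV. (permute_coords \<sigma> v $ \<sigma> i) ^ Poly_Mapping.lookup m (\<sigma> i))"
      by (rule prod.reindex_bij_betw[symmetric]) (use \<sigma> in simp)
    then show "(\<Prod>i\<in>UNIV. (permute_coords \<sigma> v $ i) ^ Poly_Mapping.lookup m i)
        = (\<Prod>i\<in>UNIV. (v $ i) ^ Poly_Mapping.lookup (?\<mu> m) i)"
      by (simp add: permute_coords_nth[OF \<sigma>] map_key.rep_eq[OF inj(1)])
  qed
  also have "\<dots> = mpoly_eval f v"
    unfolding mpoly_eval_def by (rule sum.reindex_bij_betw[OF bij])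
  finally show ?thesis .
qed

text \<open>Differentiate f(v + t e_j) = c^d f(v + (t / c) e_k), where k = \<sigma> j, at t = 0. The
  identity combines invariance under \<sigma> with homogeneity, and the chain rule contributes 1 /
  c.\<close>

lemma gradient_symmetry:
  assumes sym: "symmetric f" and hom: "homogeneous d f" and \<sigma>: "bij \<sigma>" and c: "c \<noteq> 0"
    and v: "permute_coords \<sigma> v = c *s v" and n: "has_gradient (mpoly_eval f) v n"
  shows "c * n $ j = c ^ d * n $ \<sigma> j"
proof -
  let ?u = "axis j 1 :: complex ^ 3"
  have eq: "mpoly_eval f (v + t *s ?u) = c ^ d * mpoly_eval f (v + (t / c) *s axis (\<sigma> j) 1)" for t
  proof -
    have "mpoly_eval f (v + t *s ?u) = mpoly_eval f (permute_coords \<sigma> (v + t *s ?u))"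
      by (rule mpoly_eval_permute_coords[OF sym \<sigma>, symmetric])
    also have "permute_coords \<sigma> (v + t *s ?u) = c *s v + t *s axis (\<sigma> j) 1"
      by (simp only: permute_coords_add permute_coords_scale v permute_coords_axis[OF \<sigma>])
    also have "\<dots> = c *s (v + (t / c) *s axis (\<sigma> j) 1)"
      using c by (simp add: vector_add_ldistrib vector_smult_assoc)
    finally show ?thesis by (simp only: mpoly_eval_scale[OF hom])
  qed
  have "((\<lambda>s. mpoly_eval f (v + s *s axis (\<sigma> j) 1)) has_field_derivative n $ \<sigma> j) (at (0 / c))"
    using n[unfolded has_gradient_def, rule_format, of "axis (\<sigma> j) 1"] by simp
  moreover have "((\<lambda>t. t / c) has_field_derivative 1 / c) (at 0)"
    using c by (auto intro!: derivative_eq_intros)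
  ultimately have "((\<lambda>t. mpoly_eval f (v + (t / c) *s axis (\<sigma> j) 1)) has_field_derivative n $ \<sigma> j * (1 / c)) (at 0)"
    by (rule DERIV_chain2)
  then have "((\<lambda>t. mpoly_eval f (v + t *s ?u)) has_field_derivative c ^ d * (n $ \<sigma> j * (1 / c))) (at 0)"
    unfolding eq by (rule DERIV_cmult)
  moreover have "((\<lambda>t. mpoly_eval f (v + t *s ?u)) has_field_derivative n $ j) (at 0)"
    using n[unfolded has_gradient_def, rule_format, of ?u] by simp
  ultimately have "n $ j = c ^ d * (n $ \<sigma> j * (1 / c))" by (rule DERIV_unique[symmetric])
  then show ?thesis using c by (simp add: field_simps)
qed

text \<open>At a point where two coordinates agree, the gradients of all symmetric forms through the
  point lie in one line: two of their components agree, and Euler's identity is a further linear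
  condition.\<close>

lemma coordinates_distinct:
  assumes f: "symmetric f" "homogeneous d f" and g: "symmetric g" "homogeneous e g"
    and ind: "independent_gradients f g"
    and v: "v \<noteq> 0" and zero: "mpoly_eval f v = 0" "mpoly_eval g v = 0" and ij: "i \<noteq> j"
  shows "v $ i \<noteq> v $ j"
proof
  assume eq: "v $ i = v $ j"
  have "\<exists>k\<in>{0, 1, 2}. k \<noteq> i \<and> k \<noteq> j \<and> (\<forall>l\<in>{0, 1, 2}. l = i \<or> l = j \<or> l = k)"
    using cases_3[of i] cases_3[of j] ij by (elim disjE) simp_all
  then obtain k where k: "k \<noteq> i" "k \<noteq> j" and ijk: "l = i \<or> l = j \<or> l = k" for l
    using cases_3 by blast
  have UNIV_ijk: "(UNIV :: 3 set) = {i, j, k}" using ijk by blast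
  obtain n n' where n: "has_gradient (mpoly_eval f) v n" and n': "has_gradient (mpoly_eval g) v n'"
    using ex_has_gradient by metis
  define \<sigma> where "\<sigma> = Transposition.transpose i j"
  have \<sigma>: "bij \<sigma>" unfolding \<sigma>_def by simp
  have "permute_coords \<sigma> v = 1 *s v"
    by (rule permute_coords_eqI[OF \<sigma>]) (simp add: \<sigma>_def Transposition.transpose_def eq)
  from gradient_symmetry[OF f \<sigma> _ this n, of i] gradient_symmetry[OF g \<sigma> _ this n', of i]
  have nij: "n $ j = n $ i" "n' $ j = n' $ i" by (simp_all add: \<sigma>_def)
  have "pairing n v = 0" "pairing n' v = 0"
    using euler_identity[OF f(2) n] euler_identity[OF g(2) n'] zero by simp_all
  then have euler: "2 * v $ i * n $ i + v $ k * n $ k = 0" "2 * v $ i * n' $ i + v $ k * n' $ k = 0"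
    using ij k nij eq unfolding pairing_def UNIV_ijk by (simp_all add: algebra_simps)
  \<comment> \<open>The two Euler relations form a homogeneous linear system with the nonzero
    solution (2 v_i, v_k), so its determinant vanishes.\<close>
  have "v $ i \<noteq> 0 \<or> v $ k \<noteq> 0"
  proof (rule ccontr)
    assume "\<not> (v $ i \<noteq> 0 \<or> v $ k \<noteq> 0)"
    then have "v $ l = 0" for l using eq ijk[of l] by (elim disjE) simp_all
    then show False using v by (simp add: Finite_Cartesian_Product.vec_eq_iff)
  qed
  moreover have "2 * (v $ i * (n $ i * n' $ k - n $ k * n' $ i))
      = (2 * v $ i * n $ i + v $ k * n $ k) * n' $ k - n $ k * (2 * v $ i * n' $ i + v $ k * n' $ k)"
    "v $ k * (n $ i * n' $ k - n $ k * n' $ i)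
      = n $ i * (2 * v $ i * n' $ i + v $ k * n' $ k) - n' $ i * (2 * v $ i * n $ i + v $ k * n $ k)"
    by (simp_all add: algebra_simps)
  ultimately have det: "n $ i * n' $ k - n $ k * n' $ i = 0" unfolding euler by auto
  \<comment> \<open>Component j of each gradient repeats component i, so a relation in the
    components i and k is a relation between the gradients.\<close>
  have dep: "a = 0 \<and> b = 0" if "a * n $ i + b * n' $ i = 0" "a * n $ k + b * n' $ k = 0" for a b
  proof -
    have "(a *s n + b *s n') $ l = 0" for l
      using that nij ijk[of l] by (elim disjE) simp_all
    then have "a *s n + b *s n' = 0" by (simp add: Finite_Cartesian_Product.vec_eq_iff)
    then show ?thesis using ind v zero n n' unfolding independent_gradients_def by blast
  qed
  \<comment> \<open>The vanishing minor itself supplies relations whose coefficients are the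
    components of the gradients; independence makes them all zero.\<close>
  have "n $ i = 0 \<and> n' $ i = 0" using dep[of "n' $ i" "- n $ i"] det by (simp add: algebra_simps)
  moreover have "n $ k = 0 \<and> n' $ k = 0" using dep[of "n' $ k" "- n $ k"] det by (simp add: algebra_simps)
  ultimately show False using dep[of 1 0] by simp
qed

lemma gradient_nonzero:
  assumes "independent_gradients f g" "v \<noteq> 0" "mpoly_eval f v = 0" "mpoly_eval g v = 0"
    and "has_gradient (mpoly_eval f) v n"
  shows "n \<noteq> 0"
proof
  assume "n = 0"
  obtain n' where "has_gradient (mpoly_eval g) v n'" using ex_has_gradient by blast
  then show False using assms \<open>n = 0\<close> unfolding independent_gradients_def
    by (metis vector_smult_lid vector_smult_lzero add.right_neutral zero_neq_one)
qed

lemma independent_gradients_commute: "independent_gradients f g \<Longrightarrow> independent_gradients g f"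
  unfolding independent_gradients_def by (metis add.commute)

section \<open>Symmetric forms at the point [1 : -1 : 0]\<close>

definition antisym_vec :: "3 \<Rightarrow> 3 \<Rightarrow> complex ^ 3" where
  "antisym_vec i j = axis i 1 - axis j 1"

lemma permute_antisym_vec: "bij \<sigma> \<Longrightarrow> permute_coords \<sigma> (antisym_vec i j) = antisym_vec (\<sigma> i) (\<sigma> j)"
  by (simp add: antisym_vec_def permute_coords_diff permute_coords_axis)

lemma antisym_vec_nonzero: "i \<noteq> j \<Longrightarrow> antisym_vec i j \<noteq> 0"
  by (auto simp: antisym_vec_def axis_def Finite_Cartesian_Product.vec_eq_iff)

text \<open>Transposing the first two coordinates negates the vector, so the value equals (-1)^d
  times itself.\<close>

lemma antisym_vec_zero_if_odd:
  assumes "symmetric f" "homogeneous d f" "odd d"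
  shows "mpoly_eval f (antisym_vec 0 1) = 0"
proof -
  have b: "bij (Transposition.transpose 0 (1::3))" by simp
  have "permute_coords (Transposition.transpose 0 1) (antisym_vec 0 1) = (-1) *s antisym_vec 0 1"
    unfolding permute_antisym_vec[OF b] by (simp add: antisym_vec_def)
  then have "mpoly_eval f (antisym_vec 0 1) = (-1) ^ d * mpoly_eval f (antisym_vec 0 1)"
    using mpoly_eval_permute_coords[OF assms(1) b, of "antisym_vec 0 1"] mpoly_eval_scale[OF assms(2)] by metis
  then show ?thesis using assms(3) by simp
qed

text \<open>For even d the transposition negates the gradient too, which makes it a multiple of (1,
  -1, 0). Euler's identity says that its pairing with (1, -1, 0) is 0, and this pairing is twice the
  multiple.\<close>

lemma gradient_antisym_vec_if_even:
  assumes "symmetric f" "homogeneous d f" "even d" "mpoly_eval f (antisym_vec 0 1) = 0"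
    and n: "has_gradient (mpoly_eval f) (antisym_vec 0 1) n"
  shows "n = 0"
proof -
  have b: "bij (Transposition.transpose 0 (1::3))" by simp
  have v: "permute_coords (Transposition.transpose 0 1) (antisym_vec 0 1) = (-1) *s antisym_vec 0 1"
    unfolding permute_antisym_vec[OF b] by (simp add: antisym_vec_def)
  have "- n $ j = n $ (Transposition.transpose 0 1 j)" for j
    using gradient_symmetry[OF assms(1,2) b _ v n, of j] assms(3) by simp
  from this[of 0] this[of 2] have *: "n $ 1 = - n $ 0" "n $ 2 = 0"
    by (simp_all add: Transposition.transpose_def)
  have "pairing n (antisym_vec 0 1) = 0" using euler_identity[OF assms(2) n] assms(4) by simp
  then have "n $ 0 = 0" using *
    by (simp add: pairing_def sum_UNIV_3 antisym_vec_def axis_def)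
  then have "n $ j = 0" for j using * cases_3[of j] by auto
  then show ?thesis by (simp add: Finite_Cartesian_Product.vec_eq_iff)
qed

section \<open>Cube roots of unity, and symmetric forms at the point
  [1 : \<omega> : \<omega>^2]\<close>

definition \<omega> :: complex where "\<omega> = cis (2 * pi / 3)"

lemma omega_cube: "\<omega> ^ 3 = 1"
  by (simp add: \<omega>_def DeMoivre)

lemma omega_neq_1: "\<omega> \<noteq> 1"
proof
  assume "\<omega> = 1"
  then have "sin (2 * pi / 3) = 0" by (metis \<omega>_def cis.sel(2) one_complex.sel(2))
  moreover have "sin (2 * pi / 3) > 0" by (rule sin_gt_zero) (auto simp: field_simps)
  ultimately show False by simp
qed

lemma omega_sum: "1 + \<omega> + \<omega>\<^sup>2 = 0"
proof -
  have "(\<omega> - 1) * (1 + \<omega> + \<omega>\<^sup>2) = \<omega> ^ 3 - 1" by (simp add: algebra_simps power2_eq_square power3_eq_cube)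
  then show ?thesis using omega_cube omega_neq_1 by simp
qed

lemma cube_root_cases:
  fixes z :: complex
  assumes "z ^ 3 = 1"
  shows "z = 1 \<or> z = \<omega> \<or> z = \<omega>\<^sup>2"
proof -
  have "(z - 1) * (z - \<omega>) * (z - \<omega>\<^sup>2)
      = z ^ 3 - \<omega> ^ 3 - (1 + \<omega> + \<omega>\<^sup>2) * z\<^sup>2 + \<omega> * (1 + \<omega> + \<omega>\<^sup>2) * z"
    by (simp add: algebra_simps power2_eq_square power3_eq_cube)
  then show ?thesis using assms by (simp add: omega_sum omega_cube)
qed

lemma omega_power_eq_1_iff: "\<omega> ^ n = 1 \<longleftrightarrow> 3 dvd n"
proof -
  have "\<omega> ^ n = \<omega> ^ (n mod 3)"
    by (metis div_mult_mod_eq mult.commute mult.left_neutral omega_cube power_add power_mult power_one)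
  moreover have "\<omega>\<^sup>2 \<noteq> 1"
  proof
    assume "\<omega>\<^sup>2 = 1"
    then have "\<omega> = 1" using omega_cube by (metis power3_eq_cube power2_eq_square mult_1)
    then show False using omega_neq_1 by simp
  qed
  moreover have "n mod 3 = 0 \<or> n mod 3 = 1 \<or> n mod 3 = 2" by linarith
  ultimately show ?thesis using omega_neq_1 by (auto simp: dvd_eq_mod_eq_0)
qed

definition cyclic_vec :: "complex ^ 3" where
  "cyclic_vec = (\<chi> i. if i = 0 then 1 else if i = 1 then \<omega> else \<omega>\<^sup>2)"

lemma cyclic_vec_nth: "cyclic_vec $ 0 = 1" "cyclic_vec $ 1 = \<omega>" "cyclic_vec $ 2 = \<omega>\<^sup>2"
  by (simp_all add: cyclic_vec_def)

lemma cyclic_vec_nonzero: "cyclic_vec \<noteq> 0"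
  using cyclic_vec_nth(1) by (metis zero_index zero_neq_one)

text \<open>Coordinate i moves to place i + 1, which lowers the exponents of \<omega> by one; the
  factor is the inverse of \<omega>.\<close>

lemma permute_cyclic_vec: "permute_coords (\<lambda>i. i + 1) cyclic_vec = \<omega>\<^sup>2 *s cyclic_vec"
proof (rule permute_coords_eqI[OF bij_add_3])
  fix i :: 3
  have "\<omega>\<^sup>2 * \<omega> = 1" "\<omega>\<^sup>2 * \<omega>\<^sup>2 = \<omega>"
    using omega_cube by (simp_all add: power2_eq_square power3_eq_cube mult.assoc)
  then show "(\<omega>\<^sup>2 *s cyclic_vec) $ (i + 1) = cyclic_vec $ i"
    using cases_3[of i] by (auto simp: cyclic_vec_nth three_eq_0)
qed

text \<open>Invariance and homogeneity multiply the value by \<omega>^(2d), which is 1 only if 3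
  divides d.\<close>

lemma cyclic_vec_zero_if_not_dvd:
  assumes "symmetric f" "homogeneous d f" "\<not> 3 dvd d"
  shows "mpoly_eval f cyclic_vec = 0"
proof -
  have "mpoly_eval f cyclic_vec = (\<omega>\<^sup>2) ^ d * mpoly_eval f cyclic_vec"
    using mpoly_eval_permute_coords[OF assms(1) bij_add_3, of 1 cyclic_vec] mpoly_eval_scale[OF assms(2)]
    unfolding permute_cyclic_vec by metis
  moreover have "(\<omega>\<^sup>2) ^ d \<noteq> 1"
    unfolding power_mult[symmetric] omega_power_eq_1_iff using assms(3) by presburger
  ultimately show ?thesis by simp
qed

text \<open>When 3 divides d, the cyclic shift forces the gradient to be a multiple of (1,
  \<omega>^2, \<omega>), the vector of reciprocals of the coordinates. The three terms of its
  pairing with the point are then equal, and by Euler's identity they sum to 0.\<close>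

lemma gradient_cyclic_vec_if_dvd:
  assumes "symmetric f" "homogeneous d f" "3 dvd d" "mpoly_eval f cyclic_vec = 0"
    and n: "has_gradient (mpoly_eval f) cyclic_vec n"
  shows "n = 0"
proof -
  have "\<omega>\<^sup>2 \<noteq> 0" using omega_cube by auto
  have "(\<omega>\<^sup>2) ^ d = 1"
    unfolding power_mult[symmetric] omega_power_eq_1_iff using assms(3) by simp
  then have s: "\<omega>\<^sup>2 * n $ j = n $ (j + 1)" for j
    using gradient_symmetry[OF assms(1,2) bij_add_3 \<open>\<omega>\<^sup>2 \<noteq> 0\<close> permute_cyclic_vec n, of j] by simp
  from s[of 0] s[of 1] have n12: "n $ 1 = \<omega>\<^sup>2 * n $ 0" "n $ 2 = \<omega>\<^sup>2 * (\<omega>\<^sup>2 * n $ 0)" by simp_all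
  have "pairing n cyclic_vec = 0" using euler_identity[OF assms(2) n] assms(4) by simp
  then have "n $ 0 + n $ 0 * \<omega> ^ 3 + n $ 0 * (\<omega> ^ 3 * \<omega> ^ 3) = 0"
    by (simp add: pairing_def sum_UNIV_3 cyclic_vec_nth n12 power2_eq_square power3_eq_cube mult_ac)
  then have "n $ 0 = 0" by (simp add: omega_cube)
  then have "n $ j = 0" for j using n12 cases_3[of j] by auto
  then show ?thesis by (simp add: Finite_Cartesian_Product.vec_eq_iff)
qed

section \<open>The action of the symmetric group\<close>

lemma carrier_S3: "carrier S3 = {\<sigma>. bij \<sigma>}"
  by (simp add: S3_def BijGroup_def Bij_def)

lemma mult_S3: "bij \<sigma> \<Longrightarrow> bij \<tau> \<Longrightarrow> \<sigma> \<otimes>\<^bsub>S3\<^esub> \<tau> = \<sigma> \<circ> \<tau>"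
  by (auto simp: S3_def BijGroup_def Bij_def compose_def)

lemma one_S3: "\<one>\<^bsub>S3\<^esub> = id"
  by (auto simp: S3_def BijGroup_def)

lemma group_S3: "group S3"
  unfolding S3_def by (rule group_BijGroup)

lemma card_carrier_S3: "card (carrier S3) = 6"
proof -
  have "carrier S3 = {\<sigma>. \<sigma> permutes UNIV}"
    unfolding carrier_S3 by (auto intro: bij_imp_permutes permutes_bij)
  moreover have "card {\<sigma>. \<sigma> permutes (UNIV :: 3 set)} = fact 3"
    by (rule card_permutations) simp_all
  ultimately show ?thesis by (simp add: fact_numeral)
qed

lemma ex_bij_3:
  fixes i j :: 3
  assumes "i \<noteq> j"
  obtains \<sigma> :: "3 \<Rightarrow> 3" where "bij \<sigma>" "\<sigma> 0 = i" "\<sigma> 1 = j"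
proof
  let ?\<tau> = "Transposition.transpose 0 i"
  let ?\<sigma> = "Transposition.transpose (?\<tau> 1) j \<circ> ?\<tau>"
  show "bij ?\<sigma>" by (rule bij_comp) simp_all
  have "i \<noteq> ?\<tau> 1" by (auto simp: Transposition.transpose_def)
  then show "?\<sigma> 0 = i" using assms by simp
  show "?\<sigma> 1 = j" by simp
qed

text \<open>Three steps around return to the start, so b^3 = 1, and b = 1 is excluded by distinct
  coordinates. The two primitive cube roots of unity give the two points of the orbit.\<close>

lemma proj_point_cyclic:
  assumes v: "v \<noteq> 0" and step: "\<And>l. v $ (l + 1) = b * v $ l" and ne: "v $ 0 \<noteq> v $ 1"
  shows "proj_point v = proj_point cyclic_vec \<or>
    proj_point v = proj_point (permute_coords (Transposition.transpose 1 2) cyclic_vec)"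
proof -
  have v12: "v $ 1 = b * v $ 0" "v $ 2 = b * v $ 1" "v $ 0 = b * v $ 2"
    using step[of 0] step[of 1] step[of 2] by (simp_all add: three_eq_0)
  have v0: "v $ 0 \<noteq> 0" using ne v12(1) by auto
  have "b ^ 3 * v $ 0 = b * (b * (b * v $ 0))" by (simp add: power3_eq_cube mult.assoc)
  also have "\<dots> = v $ 0" unfolding v12(1)[symmetric] v12(2)[symmetric] v12(3)[symmetric] ..
  finally have "b ^ 3 = 1" using v0 by simp
  moreover have "b \<noteq> 1" using ne v12(1) by auto
  ultimately consider "b = \<omega>" | "b = \<omega>\<^sup>2" using cube_root_cases by blast
  then show ?thesis
  proof cases
    case 1
    then have eq: "v $ l = (v $ 0 *s cyclic_vec) $ l" for l
      using cases_3[of l] v12(1,2) by (elim disjE) (simp_all add: cyclic_vec_nth power2_eq_square)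
    have "v = v $ 0 *s cyclic_vec" unfolding Finite_Cartesian_Product.vec_eq_iff using eq by blast
    then have "proj_point v = proj_point (v $ 0 *s cyclic_vec)" by (rule arg_cong)
    then show ?thesis unfolding proj_point_scale[OF v0] ..
  next
    case 2
    let ?t = "Transposition.transpose 1 (2::3)"
    have w: "permute_coords ?t cyclic_vec = (\<chi> l. cyclic_vec $ ?t l)"
      by (rule permute_coords_eqI) simp_all
    have "\<omega>\<^sup>2 * \<omega>\<^sup>2 = \<omega>"
      using omega_cube by (simp add: power2_eq_square power3_eq_cube mult.assoc)
    then have eq: "v $ l = (v $ 0 *s permute_coords ?t cyclic_vec) $ l" for l
      using cases_3[of l] v12(1,2) 2 unfolding w
      by (elim disjE) (simp_all add: cyclic_vec_nth Transposition.transpose_def mult.assoc[symmetric])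
    have "v = v $ 0 *s permute_coords ?t cyclic_vec"
      unfolding Finite_Cartesian_Product.vec_eq_iff using eq by blast
    then have "proj_point v = proj_point (v $ 0 *s permute_coords ?t cyclic_vec)" by (rule arg_cong)
    then show ?thesis unfolding proj_point_scale[OF v0] ..
  qed
qed

locale transverse_symmetric_curves =
  fixes f g :: mpoly3 and d e :: nat
  assumes f: "symmetric f" "homogeneous d f" and g: "symmetric g" "homogeneous e g"
    and f0: "f \<noteq> 0" and g0: "g \<noteq> 0" and d: "d \<ge> 1" and e: "e \<ge> 1"
    and ind: "independent_gradients f g"
begin

definition V :: "(complex ^ 3) set set" where
  "V = zero_locus f \<inter> zero_locus g"

definition act :: "(3 \<Rightarrow> 3) \<Rightarrow> (complex ^ 3) set \<Rightarrow> (complex ^ 3) set" where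
  "act \<sigma> = (\<lambda>P\<in>V. permute_coords \<sigma> ` P)"

lemma proj_point_in_V: "v \<noteq> 0 \<Longrightarrow> proj_point v \<in> V \<longleftrightarrow> mpoly_eval f v = 0 \<and> mpoly_eval g v = 0"
  by (simp add: V_def proj_point_in_zero_locus[OF f(2)] proj_point_in_zero_locus[OF g(2)])

lemma in_VE:
  assumes "P \<in> V"
  obtains v where "v \<noteq> 0" "P = proj_point v" "mpoly_eval f v = 0" "mpoly_eval g v = 0"
proof -
  obtain v where "v \<noteq> 0" "P = proj_point v"
    using assms proj_planeE[of P] unfolding V_def zero_locus_def by blast
  then show ?thesis using that assms proj_point_in_V by blast
qed

lemma permuted_in_V_iff:
  assumes "bij \<sigma>" "v \<noteq> 0"
  shows "proj_point (permute_coords \<sigma> v) \<in> V \<longleftrightarrow> proj_point v \<in> V"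
  using assms proj_point_in_V permute_coords_eq_0_iff[OF assms(1)]
    mpoly_eval_permute_coords[OF f(1) assms(1)] mpoly_eval_permute_coords[OF g(1) assms(1)] by simp

lemma act_proj_point: "proj_point v \<in> V \<Longrightarrow> act \<sigma> (proj_point v) = proj_point (permute_coords \<sigma> v)"
  by (simp add: act_def permute_coords_image_proj_point)

sublocale group_action S3 V act
proof (rule group_actionI[OF group_S3])
  fix \<sigma> P assume "\<sigma> \<in> carrier S3" "P \<in> V"
  then have "bij \<sigma>" by (simp add: carrier_S3)
  moreover obtain v where "v \<noteq> 0" "P = proj_point v" using in_VE[OF \<open>P \<in> V\<close>] by blast
  ultimately show "act \<sigma> P \<in> V" using permuted_in_V_iff act_proj_point \<open>P \<in> V\<close> by simp
next
  show "act \<sigma> \<in> extensional V" for \<sigma> by (simp add: act_def)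
next
  fix P assume "P \<in> V"
  then show "act \<one>\<^bsub>S3\<^esub> P = P" by (simp add: act_def one_S3 permute_coords_id)
next
  fix \<sigma> \<tau> P assume "\<sigma> \<in> carrier S3" "\<tau> \<in> carrier S3" and P: "P \<in> V"
  then have b: "bij \<sigma>" "bij \<tau>" by (simp_all add: carrier_S3)
  obtain v where v: "v \<noteq> 0" "P = proj_point v" using in_VE[OF P] by blast
  have V: "proj_point v \<in> V" "proj_point (permute_coords \<tau> v) \<in> V"
    using P v permuted_in_V_iff[OF b(2) v(1)] by simp_all
  show "act (\<sigma> \<otimes>\<^bsub>S3\<^esub> \<tau>) P = act \<sigma> (act \<tau> P)"
    unfolding v(2) mult_S3[OF b] act_proj_point[OF V(1)] act_proj_point[OF V(2)] permute_coords_comp[OF b] ..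
qed

lemma finite_V: "finite V" and card_V: "card V = d * e"
  unfolding V_def by (rule bezout_transverse[OF f(2) g(2) f0 g0 d e ind])+

definition antisym_point :: "(complex ^ 3) set" where "antisym_point = proj_point (antisym_vec 0 1)"

definition cyclic_point :: "(complex ^ 3) set" where "cyclic_point = proj_point cyclic_vec"

lemma antisym_point_in_V_iff: "antisym_point \<in> V \<longleftrightarrow> odd (d * e)"
proof
  assume "antisym_point \<in> V"
  then have zero: "mpoly_eval f (antisym_vec 0 1) = 0" "mpoly_eval g (antisym_vec 0 1) = 0"
    using proj_point_in_V[OF antisym_vec_nonzero, of 0 1] by (simp_all add: antisym_point_def)
  have nz: "antisym_vec 0 1 \<noteq> 0" by (rule antisym_vec_nonzero) simp
  obtain n n' where n: "has_gradient (mpoly_eval f) (antisym_vec 0 1) n"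
    and n': "has_gradient (mpoly_eval g) (antisym_vec 0 1) n'"
    using ex_has_gradient by metis
  have "odd d"
    using gradient_antisym_vec_if_even[OF f _ zero(1) n] gradient_nonzero[OF ind nz zero n] by blast
  moreover have "odd e"
    using gradient_antisym_vec_if_even[OF g _ zero(2) n']
      gradient_nonzero[OF independent_gradients_commute[OF ind] nz zero(2,1) n'] by blast
  ultimately show "odd (d * e)" by simp
next
  assume "odd (d * e)"
  then have "odd d" "odd e" by simp_all
  then show "antisym_point \<in> V"
    using antisym_vec_zero_if_odd[OF f] antisym_vec_zero_if_odd[OF g]
    by (simp add: antisym_point_def proj_point_in_V antisym_vec_nonzero)
qed

lemma cyclic_point_in_V_iff: "cyclic_point \<in> V \<longleftrightarrow> \<not> 3 dvd d * e"
proof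
  assume "cyclic_point \<in> V"
  then have zero: "mpoly_eval f cyclic_vec = 0" "mpoly_eval g cyclic_vec = 0"
    using proj_point_in_V[OF cyclic_vec_nonzero] by (simp_all add: cyclic_point_def)
  obtain n n' where n: "has_gradient (mpoly_eval f) cyclic_vec n"
    and n': "has_gradient (mpoly_eval g) cyclic_vec n'"
    using ex_has_gradient by metis
  have "\<not> 3 dvd d"
    using gradient_cyclic_vec_if_dvd[OF f _ zero(1) n] gradient_nonzero[OF ind cyclic_vec_nonzero zero n] by blast
  moreover have "\<not> 3 dvd e"
    using gradient_cyclic_vec_if_dvd[OF g _ zero(2) n']
      gradient_nonzero[OF independent_gradients_commute[OF ind] cyclic_vec_nonzero zero(2,1) n'] by blast
  moreover have "prime (3::nat)" by simp
  ultimately show "\<not> 3 dvd d * e" using prime_dvd_mult_iff by blast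
next
  assume "\<not> 3 dvd d * e"
  then have "\<not> 3 dvd d" "\<not> 3 dvd e" by (auto intro: dvd_mult dvd_mult2)
  then show "cyclic_point \<in> V"
    using cyclic_vec_zero_if_not_dvd[OF f] cyclic_vec_zero_if_not_dvd[OF g]
    by (simp add: cyclic_point_def proj_point_in_V cyclic_vec_nonzero)
qed

lemma orbit_memI:
  assumes "proj_point v \<in> V" "bij \<sigma>"
  shows "proj_point (permute_coords \<sigma> v) \<in> orbit S3 act (proj_point v)"
  unfolding orbit_def using assms act_proj_point[OF assms(1), of \<sigma>] by (auto simp: carrier_S3)

text \<open>A vector representing a fixed point is an eigenvector of \<sigma>, and its coordinates
  are pairwise distinct by \<open>coordinates_distinct\<close>. For a transposition the eigenvalue
  squares to 1 and is not 1, hence is -1, which makes the third coordinate 0. For a 3-cycle the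
  coordinates form a geometric progression.\<close>

lemma nontrivial_stabilizer:
  assumes P: "P \<in> V" and \<sigma>: "bij \<sigma>" "\<sigma> \<noteq> id" and fix_P: "act \<sigma> P = P"
  shows "antisym_point \<in> V \<and> P \<in> orbit S3 act antisym_point \<or>
    cyclic_point \<in> V \<and> P \<in> orbit S3 act cyclic_point"
proof -
  obtain v where v: "v \<noteq> 0" "P = proj_point v" and zero: "mpoly_eval f v = 0" "mpoly_eval g v = 0"
    using in_VE[OF P] by blast
  note distinct = coordinates_distinct[OF f g ind v(1) zero]
  have "proj_point v = proj_point (permute_coords \<sigma> v)"
    using fix_P act_proj_point P v(2) by simp
  then obtain c where c: "c \<noteq> 0" "permute_coords \<sigma> v = c *s v" by (auto simp: proj_point_eq_iff)
  have nth: "c * v $ \<sigma> l = v $ l" for l using permute_coords_nth[OF \<sigma>(1), of v l] c(2) by simp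
  have cyclic: ?thesis if step: "\<And>l. v $ (l + 1) = b * v $ l" for b
  proof -
    have b1: "bij (id :: 3 \<Rightarrow> 3)" "bij (Transposition.transpose 1 (2::3))" by simp_all
    have "P = proj_point (permute_coords id cyclic_vec) \<or>
        P = proj_point (permute_coords (Transposition.transpose 1 2) cyclic_vec)"
      unfolding permute_coords_id v(2) by (rule proj_point_cyclic[OF v(1) step distinct]) simp
    then obtain \<tau> where \<tau>: "bij \<tau>" "P = proj_point (permute_coords \<tau> cyclic_vec)"
      using b1 by blast
    then have "cyclic_point \<in> V"
      using P permuted_in_V_iff[OF \<tau>(1) cyclic_vec_nonzero] by (simp add: cyclic_point_def)
    moreover from this have "P \<in> orbit S3 act cyclic_point"
      using orbit_memI[OF _ \<tau>(1), of cyclic_vec] \<tau>(2) by (simp add: cyclic_point_def)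
    ultimately show ?thesis by blast
  qed
  show ?thesis
    using \<sigma>(1)
  proof (cases rule: bij_3_cases)
    case 1
    then show ?thesis using \<sigma>(2) by simp
  next
    case (2 i j)
    have ij: "c * v $ j = v $ i" "c * v $ i = v $ j" using nth[of i] nth[of j] 2 by simp_all
    have vi: "v $ i \<noteq> 0"
    proof
      assume 0: "v $ i = 0"
      then have "v $ j = 0" using ij(2)[symmetric] by simp
      then show False using distinct[OF 2(1)] 0 by simp
    qed
    have "c * c * v $ i = c * (c * v $ i)" by (rule mult.assoc)
    also have "\<dots> = v $ i" unfolding ij ..
    finally have "c * c = 1" using vi by simp
    then have "(c - 1) * (c + 1) = 0" by (simp add: algebra_simps)
    moreover have "c \<noteq> 1"
    proof
      assume "c = 1"
      then show False using distinct[OF 2(1)] ij(1) by simp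
    qed
    ultimately have "c = -1" by (simp add: eq_neg_iff_add_eq_0)
    have eq: "v $ l = (v $ i *s antisym_vec i j) $ l" for l
    proof (cases "l = i \<or> l = j")
      case True
      moreover have "v $ j = - v $ i" using ij(2)[symmetric] \<open>c = -1\<close> by simp
      ultimately show ?thesis using 2(1) by (elim disjE) (simp_all add: antisym_vec_def axis_def)
    next
      case False
      then have "\<sigma> l = l" using 2(2) by (simp add: Transposition.transpose_def)
      then have "- v $ l = v $ l" using nth[of l] \<open>c = -1\<close> by simp
      then show ?thesis using False by (simp add: antisym_vec_def axis_def)
    qed
    have "v = v $ i *s antisym_vec i j" unfolding Finite_Cartesian_Product.vec_eq_iff using eq by blast
    then have "proj_point v = proj_point (v $ i *s antisym_vec i j)" by (rule arg_cong)
    then have Pij: "P = proj_point (antisym_vec i j)"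
      unfolding v(2) proj_point_scale[OF vi] .
    obtain \<tau> :: "3 \<Rightarrow> 3" where \<tau>: "bij \<tau>" "\<tau> 0 = i" "\<tau> 1 = j" using ex_bij_3[OF 2(1)] .
    then have P\<tau>: "P = proj_point (permute_coords \<tau> (antisym_vec 0 1))"
      unfolding Pij by (simp add: permute_antisym_vec)
    then have "antisym_point \<in> V"
      using P permuted_in_V_iff[OF \<tau>(1) antisym_vec_nonzero, of 0 1] by (simp add: antisym_point_def)
    moreover from this have "P \<in> orbit S3 act antisym_point"
      using orbit_memI[OF _ \<tau>(1), of "antisym_vec 0 1"] P\<tau> by (simp add: antisym_point_def)
    ultimately show ?thesis by blast
  next
    case 3
    have "v $ (l + 1) = inverse c * v $ l" for l using nth[of l] c(1) 3 by (simp add: field_simps)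
    then show ?thesis by (rule cyclic)
  next
    case 4
    \<comment> \<open>Adding 2 inverts adding 1 in the type \<open>3\<close>, so the ratio of the
      progression is c itself and not its inverse.\<close>
    have "v $ (l + 1) = c * v $ l" for l using nth[of "l + 1"] 4 by (simp add: three_eq_0)
    then show ?thesis by (rule cyclic)
  qed
qed

text \<open>Index 2 carries the only zero coordinate, so a permutation fixing the point fixes 2 and
  is the identity or the transposition of 0 and 1.\<close>

lemma stabilizer_antisym_point:
  assumes "antisym_point \<in> V"
  shows "stabilizer S3 act antisym_point = C2" "card C2 = 2"
proof -
  interpret G: group S3 by (rule group_S3)
  let ?t = "Transposition.transpose 0 (1::3)"
  have V: "proj_point (antisym_vec 0 1) \<in> V" using assms by (simp add: antisym_point_def)
  have t: "bij ?t" by simp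
  have "permute_coords ?t (antisym_vec 0 1) = (-1) *s antisym_vec 0 1"
    unfolding permute_antisym_vec[OF t] by (simp add: antisym_vec_def)
  then have "?t \<in> stabilizer S3 act antisym_point"
    using act_proj_point[OF V, of ?t] proj_point_scale[of "-1"] t
    by (simp add: stabilizer_def carrier_S3 antisym_point_def)
  then have 1: "C2 \<subseteq> stabilizer S3 act antisym_point"
    unfolding C2_def using stabilizer_subgroup[OF assms] by (intro G.generate_subgroup_incl) auto
  have 2: "stabilizer S3 act antisym_point \<subseteq> {id, ?t}"
  proof
    fix \<sigma> assume "\<sigma> \<in> stabilizer S3 act antisym_point"
    then have \<sigma>: "bij \<sigma>" and "proj_point (permute_coords \<sigma> (antisym_vec 0 1)) = proj_point (antisym_vec 0 1)"
      using act_proj_point[OF V, of \<sigma>] by (simp_all add: stabilizer_def carrier_S3 antisym_point_def)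
    then obtain c where c: "c \<noteq> 0" "antisym_vec 0 1 = c *s antisym_vec (\<sigma> 0) (\<sigma> 1)"
      by (auto simp: proj_point_eq_iff permute_antisym_vec)
    have ne: "\<sigma> 0 \<noteq> \<sigma> 1" "\<sigma> 0 \<noteq> \<sigma> 2" "\<sigma> 1 \<noteq> \<sigma> 2"
      using bij_is_inj[OF \<sigma>] by (simp_all add: inj_eq)
    have "antisym_vec 0 1 $ 2 = c * antisym_vec (\<sigma> 0) (\<sigma> 1) $ 2" using c(2) by simp
    then have "antisym_vec (\<sigma> 0) (\<sigma> 1) $ 2 = 0" using c(1) by (simp add: antisym_vec_def axis_def)
    then have "\<sigma> 0 \<noteq> 2" "\<sigma> 1 \<noteq> 2" using ne by (auto simp: antisym_vec_def axis_def)
    then have "\<sigma> 0 = 0 \<and> \<sigma> 1 = 1 \<and> \<sigma> 2 = 2 \<or> \<sigma> 0 = 1 \<and> \<sigma> 1 = 0 \<and> \<sigma> 2 = 2"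
      using cases_3[of "\<sigma> 0"] cases_3[of "\<sigma> 1"] cases_3[of "\<sigma> 2"] ne by (elim disjE) simp_all
    then have "\<sigma> = id \<or> \<sigma> = ?t"
    proof (elim disjE conjE)
      assume "\<sigma> 0 = 0" "\<sigma> 1 = 1" "\<sigma> 2 = 2"
      then have "\<sigma> = id" by (intro fun3_eqI[of \<sigma>]) simp_all
      then show ?thesis ..
    next
      assume "\<sigma> 0 = 1" "\<sigma> 1 = 0" "\<sigma> 2 = 2"
      then have "\<sigma> = ?t" by (intro fun3_eqI[of \<sigma>]) (simp_all add: Transposition.transpose_def)
      then show ?thesis ..
    qed
    then show "\<sigma> \<in> {id, ?t}" by simp
  qed
  have 3: "{id, ?t} \<subseteq> C2"
    unfolding C2_def using generate.one[of S3 "{?t}"] generate.incl[of ?t "{?t}" S3] by (simp add: one_S3)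
  show "stabilizer S3 act antisym_point = C2" using 1 2 3 by blast
  have C2: "C2 = {id, ?t}" using 1 2 3 by blast
  have "id \<noteq> ?t"
  proof
    assume "id = ?t"
    then have "id (0::3) = ?t 0" by simp
    then show False by simp
  qed
  then show "card C2 = 2" unfolding C2 by (rule card_2_iff[THEN iffD2, OF exI, OF exI, OF conjI[OF refl]])
qed

text \<open>A transposition leaves one nonzero coordinate in place, so it could fix the point only
  with factor 1, which would equate the other two coordinates. Only the rotations remain.\<close>

lemma stabilizer_cyclic_point:
  assumes "cyclic_point \<in> V"
  shows "stabilizer S3 act cyclic_point = C3" "card C3 = 3"
proof -
  interpret G: group S3 by (rule group_S3)
  let ?s = "\<lambda>i::3. i + 1" and ?s2 = "\<lambda>i::3. i + 2"
  have V: "proj_point cyclic_vec \<in> V" using assms by (simp add: cyclic_point_def)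
  have zero: "mpoly_eval f cyclic_vec = 0" "mpoly_eval g cyclic_vec = 0"
    using V proj_point_in_V[OF cyclic_vec_nonzero] by simp_all
  note distinct = coordinates_distinct[OF f g ind cyclic_vec_nonzero zero]
  have "\<omega>\<^sup>2 \<noteq> 0" using omega_cube by auto
  then have "?s \<in> stabilizer S3 act cyclic_point"
    using act_proj_point[OF V, of ?s] proj_point_scale[of "\<omega>\<^sup>2" cyclic_vec] bij_add_3[of 1]
    by (simp add: stabilizer_def carrier_S3 cyclic_point_def permute_cyclic_vec)
  then have 1: "C3 \<subseteq> stabilizer S3 act cyclic_point"
    unfolding C3_def using stabilizer_subgroup[OF assms] by (intro G.generate_subgroup_incl) auto
  have 2: "stabilizer S3 act cyclic_point \<subseteq> {id, ?s, ?s2}"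
  proof
    fix \<sigma> assume "\<sigma> \<in> stabilizer S3 act cyclic_point"
    then have \<sigma>: "bij \<sigma>" and "proj_point cyclic_vec = proj_point (permute_coords \<sigma> cyclic_vec)"
      using act_proj_point[OF V, of \<sigma>] by (simp_all add: stabilizer_def carrier_S3 cyclic_point_def)
    then obtain c where c: "c \<noteq> 0" "permute_coords \<sigma> cyclic_vec = c *s cyclic_vec"
      by (auto simp: proj_point_eq_iff)
    have nth: "c * cyclic_vec $ \<sigma> l = cyclic_vec $ l" for l
      using permute_coords_nth[OF \<sigma>, of cyclic_vec l] c(2) by simp
    show "\<sigma> \<in> {id, ?s, ?s2}"
      using \<sigma>
    proof (cases rule: bij_3_cases)
      case (2 i j)
      have "\<exists>k\<in>{0, 1, 2}. k \<noteq> i \<and> k \<noteq> j"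
        using cases_3[of i] cases_3[of j] by (elim disjE) simp_all
      then obtain k where k: "k \<noteq> i" "k \<noteq> j" by blast
      then have "\<sigma> k = k" using 2(2) by (simp add: Transposition.transpose_def)
      moreover have "cyclic_vec $ k \<noteq> 0"
        using cases_3[of k] \<open>\<omega>\<^sup>2 \<noteq> 0\<close> by (elim disjE) (simp_all add: cyclic_vec_nth)
      ultimately have "c = 1" using nth[of k] by simp
      then have "cyclic_vec $ j = cyclic_vec $ i" using nth[of i] 2(2) by simp
      then show ?thesis using distinct[OF 2(1)] by simp
    qed simp_all
  qed
  have "?s \<otimes>\<^bsub>S3\<^esub> ?s = ?s2"
    unfolding mult_S3[OF bij_add_3 bij_add_3] by (simp add: fun_eq_iff add.assoc)
  then have 3: "{id, ?s, ?s2} \<subseteq> C3"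
    unfolding C3_def
    using generate.one[of S3 "{?s}"] generate.incl[of ?s "{?s}" S3] generate.eng[of ?s S3 "{?s}" ?s]
    by (simp add: one_S3)
  show "stabilizer S3 act cyclic_point = C3" using 1 2 3 by blast
  have C3: "C3 = {id, ?s, ?s2}" using 1 2 3 by blast
  have "id \<noteq> ?s" "?s \<noteq> ?s2" "id \<noteq> ?s2" by (auto simp: fun_eq_iff)
  then show "card C3 = 3" unfolding C3 card_3_iff by blast
qed

text \<open>The index is the order of the stabilizer, not the size: \<open>O2\<close> has three
  points and \<open>O3\<close> two when nonempty. Setting them to the empty set when the special
  point is absent lets one decomposition serve all residues.\<close>

definition O2 :: "(complex ^ 3) set set" where
  "O2 = (if antisym_point \<in> V then orbit S3 act antisym_point else {})"

definition O3 :: "(complex ^ 3) set set" where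
  "O3 = (if cyclic_point \<in> V then orbit S3 act cyclic_point else {})"

definition free_part :: "(complex ^ 3) set set" where
  "free_part = V - O2 - O3"

lemma orbit_stable:
  assumes P: "P \<in> V" and \<sigma>: "\<sigma> \<in> carrier S3" and Q: "Q \<in> orbit S3 act P"
  shows "act \<sigma> Q \<in> orbit S3 act P"
proof -
  interpret G: group S3 by (rule group_S3)
  obtain \<tau> where \<tau>: "\<tau> \<in> carrier S3" "Q = act \<tau> P" using Q by (auto simp: orbit_def)
  then have "act \<sigma> Q = act (\<sigma> \<otimes>\<^bsub>S3\<^esub> \<tau>) P" using composition_rule[OF P \<sigma>] by simp
  moreover have "\<sigma> \<otimes>\<^bsub>S3\<^esub> \<tau> \<in> carrier S3" using \<sigma> \<tau>(1) by simp
  ultimately show ?thesis unfolding orbit_def by blast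
qed

lemma O2_stable: "\<sigma> \<in> carrier S3 \<Longrightarrow> Q \<in> O2 \<Longrightarrow> act \<sigma> Q \<in> O2"
  and O3_stable: "\<sigma> \<in> carrier S3 \<Longrightarrow> Q \<in> O3 \<Longrightarrow> act \<sigma> Q \<in> O3"
  using orbit_stable by (simp_all add: O2_def O3_def split: if_splits)

lemma O2_subset: "O2 \<subseteq> V" and O3_subset: "O3 \<subseteq> V"
  using element_image by (auto simp: O2_def O3_def orbit_def)

lemma card_O2: "card O2 = (if antisym_point \<in> V then 3 else 0)"
  using orbit_stabilizer_theorem[of antisym_point] stabilizer_antisym_point card_carrier_S3
  by (auto simp: O2_def Coset.order_def)

lemma card_O3: "card O3 = (if cyclic_point \<in> V then 2 else 0)"
  using orbit_stabilizer_theorem[of cyclic_point] stabilizer_cyclic_point card_carrier_S3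
  by (auto simp: O3_def Coset.order_def)

text \<open>A common point would make the two orbits equal, but they have 3 and 2 points.\<close>

lemma O2_O3_disjoint: "O2 \<inter> O3 = {}"
proof (rule ccontr)
  assume "O2 \<inter> O3 \<noteq> {}"
  then obtain P where P: "P \<in> O2" "P \<in> O3" by blast
  then have V: "antisym_point \<in> V" "cyclic_point \<in> V" by (auto simp: O2_def O3_def split: if_splits)
  have "orbit S3 act P = O2" "orbit S3 act P = O3"
    using P V orbit_eq[OF V(1), of P] orbit_eq[OF V(2), of P] by (simp_all add: O2_def O3_def)
  then show False using card_O2 card_O3 V by simp
qed

lemma free_part_stable: "\<sigma> \<in> carrier S3 \<Longrightarrow> P \<in> free_part \<Longrightarrow> act \<sigma> P \<in> free_part"
proof -
  assume \<sigma>: "\<sigma> \<in> carrier S3" and P: "P \<in> free_part"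
  interpret G: group S3 by (rule group_S3)
  have PV: "P \<in> V" using P by (simp add: free_part_def)
  have "P = act (inv\<^bsub>S3\<^esub> \<sigma>) (act \<sigma> P)" using action_inv[OF \<sigma> PV] by simp
  then show ?thesis
    using O2_stable[of "inv\<^bsub>S3\<^esub> \<sigma>" "act \<sigma> P"] O3_stable[of "inv\<^bsub>S3\<^esub> \<sigma>" "act \<sigma> P"] P \<sigma> element_image[OF \<sigma> PV]
    by (auto simp: free_part_def)
qed

sublocale free: group_action S3 free_part "\<lambda>\<sigma>. restrict (act \<sigma>) free_part"
  using free_part_stable by (intro group_action_restrict) (auto simp: free_part_def)

lemma free_stabilizer:
  assumes "P \<in> free_part"
  shows "stabilizer S3 (\<lambda>\<sigma>. restrict (act \<sigma>) free_part) P = {\<one>\<^bsub>S3\<^esub>}"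
proof (intro equalityI subsetI)
  fix \<sigma> assume "\<sigma> \<in> stabilizer S3 (\<lambda>\<sigma>. restrict (act \<sigma>) free_part) P"
  then have \<sigma>: "bij \<sigma>" "act \<sigma> P = P" using assms by (auto simp: stabilizer_def carrier_S3)
  have "P \<in> V" "P \<notin> O2" "P \<notin> O3" using assms by (auto simp: free_part_def)
  then have "\<sigma> = id"
    using nontrivial_stabilizer[OF \<open>P \<in> V\<close> \<sigma>(1) _ \<sigma>(2)] unfolding O2_def O3_def
    by (cases "\<sigma> = id") (auto split: if_splits)
  then show "\<sigma> \<in> {\<one>\<^bsub>S3\<^esub>}" by (simp add: one_S3)
next
  fix \<sigma> assume "\<sigma> \<in> {\<one>\<^bsub>S3\<^esub>}"
  then show "\<sigma> \<in> stabilizer S3 (\<lambda>\<sigma>. restrict (act \<sigma>) free_part) P"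
    using free.stabilizer_one_closed[OF assms] by simp
qed

lemma finite_free_part: "finite free_part"
  using finite_V by (simp add: free_part_def)

lemma V_decomposition: "V = free_part \<union> O2 \<union> O3" "free_part \<inter> O2 = {}" "(free_part \<union> O2) \<inter> O3 = {}"
  using O2_subset O3_subset O2_O3_disjoint by (auto simp: free_part_def)

lemma card_decomposition: "d * e = card free_part + card O2 + card O3"
proof -
  have fin: "finite free_part" "finite O2" "finite O3"
    using finite_V O2_subset O3_subset by (auto simp: free_part_def intro: finite_subset)
  show ?thesis
    unfolding card_V[symmetric] V_decomposition(1)
    using fin V_decomposition(2,3) by (simp add: card_Un_disjoint)
qed

lemma six_dvd_card_free_part: "6 dvd card free_part"
  using free.card_free_action[OF finite_free_part free_stabilizer] card_carrier_S3 by (metis dvd_triv_left)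

lemma free_part_iso:
  assumes "card free_part = 6 * k"
  shows "gset_iso S3 (free_part, \<lambda>\<sigma>. restrict (act \<sigma>) free_part)
    (gset_copies k (coset_gset S3 {\<one>\<^bsub>S3\<^esub>}))"
proof (rule free.gset_iso_free[OF finite_free_part free_stabilizer])
  show "card free_part = k * card (carrier S3)" using assms by (simp add: card_carrier_S3)
  show "finite (carrier S3)" using card_carrier_S3 by (metis card.infinite zero_neq_numeral)
qed

lemma O2_iso:
  assumes "antisym_point \<in> V"
  shows "gset_iso S3 (O2, \<lambda>\<sigma>. restrict (act \<sigma>) O2) (coset_gset S3 C2)"
  using gset_iso_orbit[OF assms] stabilizer_antisym_point[OF assms] assms by (simp add: O2_def)

lemma O3_iso:
  assumes "cyclic_point \<in> V"
  shows "gset_iso S3 (O3, \<lambda>\<sigma>. restrict (act \<sigma>) O3) (coset_gset S3 C3)"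
  using gset_iso_orbit[OF assms] stabilizer_cyclic_point[OF assms] assms by (simp add: O3_def)

text \<open>The intermediate stage for residue 5: \<open>gset_iso_sum\<close> splits off one summand
  at a time, and there both special orbits occur.\<close>

lemma free_O2_iso:
  assumes "card free_part = 6 * k" "antisym_point \<in> V"
  shows "gset_iso S3 (free_part \<union> O2, \<lambda>\<sigma>. restrict (act \<sigma>) (free_part \<union> O2))
    (gset_sum (gset_copies k (coset_gset S3 {\<one>\<^bsub>S3\<^esub>})) (coset_gset S3 C2))"
proof -
  have stable: "act \<sigma> P \<in> free_part \<union> O2" if "\<sigma> \<in> carrier S3" "P \<in> free_part \<union> O2" for \<sigma> P
    using that free_part_stable O2_stable by blast
  have "free_part \<union> O2 \<subseteq> V" using V_decomposition(1) by blast
  then interpret U: group_action S3 "free_part \<union> O2" "\<lambda>\<sigma>. restrict (act \<sigma>) (free_part \<union> O2)"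
    using stable by (rule group_action_restrict)
  have res: "restrict (restrict (act \<sigma>) (free_part \<union> O2)) free_part = restrict (act \<sigma>) free_part"
    "restrict (restrict (act \<sigma>) (free_part \<union> O2)) O2 = restrict (act \<sigma>) O2" for \<sigma>
    by (auto simp: restrict_def fun_eq_iff)
  show ?thesis
    by (rule U.gset_iso_sum[OF refl V_decomposition(2)])
      (simp_all add: res free_part_stable O2_stable free_part_iso[OF assms(1)] O2_iso[OF assms(2)])
qed

text \<open>Parity and divisibility by 3 of the product decide which special orbits are present;
  subtracting their sizes from \<open>d * e\<close> leaves the size of the free part.\<close>

lemma orbit_decomposition:
  shows "d * e = 6 * k \<Longrightarrow> gset_iso S3 (V, act) (gset_copies k (coset_gset S3 {\<one>\<^bsub>S3\<^esub>}))"
    and "d * e = 6 * k + 2 \<Longrightarrow> gset_iso S3 (V, act)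
      (gset_sum (gset_copies k (coset_gset S3 {\<one>\<^bsub>S3\<^esub>})) (coset_gset S3 C3))"
    and "d * e = 6 * k + 3 \<Longrightarrow> gset_iso S3 (V, act)
      (gset_sum (gset_copies k (coset_gset S3 {\<one>\<^bsub>S3\<^esub>})) (coset_gset S3 C2))"
    and "d * e = 6 * k + 5 \<Longrightarrow> gset_iso S3 (V, act)
      (gset_sum (gset_sum (gset_copies k (coset_gset S3 {\<one>\<^bsub>S3\<^esub>})) (coset_gset S3 C2)) (coset_gset S3 C3))"
    and "d * e \<noteq> 6 * k + 1" and "d * e \<noteq> 6 * k + 4"
proof -
  \<comment> \<open>\<open>act\<close> is already extensional on \<open>V\<close>, so restricting it
    again changes nothing.\<close>
  have res: "(\<lambda>\<sigma>. restrict (act \<sigma>) V) = act" by (auto simp: act_def)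
  show "gset_iso S3 (V, act) (gset_copies k (coset_gset S3 {\<one>\<^bsub>S3\<^esub>}))" if de: "d * e = 6 * k"
  proof -
    have "\<not> odd (d * e)" "3 dvd d * e" unfolding de by presburger+
    then have "antisym_point \<notin> V" "cyclic_point \<notin> V"
      using antisym_point_in_V_iff cyclic_point_in_V_iff by blast+
    then have O: "O2 = {}" "O3 = {}" by (simp_all add: O2_def O3_def)
    then have "free_part = V" by (simp add: free_part_def)
    moreover have "card free_part = 6 * k" using card_decomposition unfolding de O by simp
    ultimately have "gset_iso S3 (V, \<lambda>\<sigma>. restrict (act \<sigma>) V) (gset_copies k (coset_gset S3 {\<one>\<^bsub>S3\<^esub>}))"
      using free_part_iso[of k] by (simp only:)
    then show ?thesis unfolding res .
  qed
  show "gset_iso S3 (V, act) (gset_sum (gset_copies k (coset_gset S3 {\<one>\<^bsub>S3\<^esub>})) (coset_gset S3 C3))"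
    if de: "d * e = 6 * k + 2"
  proof -
    have "\<not> odd (d * e)" "\<not> 3 dvd d * e" unfolding de by presburger+
    then have *: "antisym_point \<notin> V" "cyclic_point \<in> V"
      using antisym_point_in_V_iff cyclic_point_in_V_iff by blast+
    then have O2: "O2 = {}" and O3: "card O3 = 2" by (simp_all add: O2_def card_O3)
    have k: "card free_part = 6 * k" using card_decomposition unfolding de O2 O3 by simp
    have E: "V = free_part \<union> O3" "free_part \<inter> O3 = {}"
      using V_decomposition(1,3) unfolding O2 Un_empty_right .
    show ?thesis
      by (rule gset_iso_sum[OF E free_part_stable O3_stable free_part_iso[OF k] O3_iso[OF *(2)]])
  qed
  show "gset_iso S3 (V, act) (gset_sum (gset_copies k (coset_gset S3 {\<one>\<^bsub>S3\<^esub>})) (coset_gset S3 C2))"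
    if de: "d * e = 6 * k + 3"
  proof -
    have "odd (d * e)" "3 dvd d * e" unfolding de by presburger+
    then have *: "antisym_point \<in> V" "cyclic_point \<notin> V"
      using antisym_point_in_V_iff cyclic_point_in_V_iff by blast+
    then have O3: "O3 = {}" and O2: "card O2 = 3" by (simp_all add: O3_def card_O2)
    have k: "card free_part = 6 * k" using card_decomposition unfolding de O2 O3 by simp
    have E: "V = free_part \<union> O2" using V_decomposition(1) unfolding O3 Un_empty_right .
    show ?thesis
      by (rule gset_iso_sum[OF E V_decomposition(2) free_part_stable O2_stable free_part_iso[OF k] O2_iso[OF *(1)]])
  qed
  show "gset_iso S3 (V, act)
      (gset_sum (gset_sum (gset_copies k (coset_gset S3 {\<one>\<^bsub>S3\<^esub>})) (coset_gset S3 C2)) (coset_gset S3 C3))"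
    if de: "d * e = 6 * k + 5"
  proof -
    have "odd (d * e)" "\<not> 3 dvd d * e" unfolding de by presburger+
    then have *: "antisym_point \<in> V" "cyclic_point \<in> V"
      using antisym_point_in_V_iff cyclic_point_in_V_iff by blast+
    then have cards: "card O2 = 3" "card O3 = 2" by (simp_all add: card_O2 card_O3)
    have k: "card free_part = 6 * k" using card_decomposition unfolding de cards by simp
    show ?thesis
    proof (rule gset_iso_sum[OF V_decomposition(1,3) _ O3_stable free_O2_iso[OF k *(1)] O3_iso[OF *(2)]])
      show "act \<sigma> P \<in> free_part \<union> O2" if "\<sigma> \<in> carrier S3" "P \<in> free_part \<union> O2" for \<sigma> P
        using that free_part_stable O2_stable by blast
    qed
  qed
  \<comment> \<open>In the two excluded residues the special orbits account for 5 and 2 points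
    respectively. What remains is congruent to 2 modulo 6 both times, whereas free orbits have 6
    points.\<close>
  have mod6: "card free_part mod 6 = 0" using six_dvd_card_free_part by simp
  show "d * e \<noteq> 6 * k + 1"
  proof
    assume de: "d * e = 6 * k + 1"
    have "odd (d * e)" "\<not> 3 dvd d * e" unfolding de by presburger+
    then have "card O2 = 3" "card O3 = 2"
      using card_O2 card_O3 antisym_point_in_V_iff cyclic_point_in_V_iff by presburger+
    moreover have "6 * k + 1 = card free_part + card O2 + card O3"
      using card_decomposition unfolding de .
    ultimately show False using mod6 by presburger
  qed
  show "d * e \<noteq> 6 * k + 4"
  proof
    assume de: "d * e = 6 * k + 4"
    have "\<not> odd (d * e)" "\<not> 3 dvd d * e" unfolding de by presburger+
    then have "card O2 = 0" "card O3 = 2"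
      using card_O2 card_O3 antisym_point_in_V_iff cyclic_point_in_V_iff by presburger+
    moreover have "6 * k + 4 = card free_part + card O2 + card O3"
      using card_decomposition unfolding de .
    ultimately show False using mod6 by presburger
  qed
qed

end

theorem theorem1p1:
  fixes f g :: mpoly3 and d e :: nat
  assumes "symmetric_curve d f"
    and "symmetric_curve e g"
    and "transverse f g"
  shows "\<forall>k::nat.
    (d * e = 6 * k \<longrightarrow>
      gset_iso S3 (intersection_gset f g)
        (gset_copies k (coset_gset S3 {\<one>\<^bsub>S3\<^esub>}))) \<and>
    (d * e = 6 * k + 2 \<longrightarrow>
      gset_iso S3 (intersection_gset f g)
        (gset_sum (gset_copies k (coset_gset S3 {\<one>\<^bsub>S3\<^esub>})) (coset_gset S3 C3))) \<and>
    (d * e = 6 * k + 3 \<longrightarrow>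
      gset_iso S3 (intersection_gset f g)
        (gset_sum (gset_copies k (coset_gset S3 {\<one>\<^bsub>S3\<^esub>})) (coset_gset S3 C2))) \<and>
    (d * e = 6 * k + 5 \<longrightarrow>
      gset_iso S3 (intersection_gset f g)
        (gset_sum (gset_sum (gset_copies k (coset_gset S3 {\<one>\<^bsub>S3\<^esub>})) (coset_gset S3 C2))
          (coset_gset S3 C3))) \<and>
    d * e \<noteq> 6 * k + 1 \<and>
    d * e \<noteq> 6 * k + 4"
proof -
  interpret transverse_symmetric_curves f g d e
    using assms transverse_imp_independent_gradients[of d f e g]
    by unfold_locales (simp_all add: symmetric_curve_def)
  have "intersection_gset f g = (V, act)"
    unfolding intersection_gset_def V_def[symmetric] act_def[abs_def] ..
  then show ?thesis using orbit_decomposition by (simp only:) blast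
qed

end
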